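(* Let $\Gamma$ be a hyperbolic surface group (the fundamental group of a closed hyperbolic surface). Then there exists a Gromov hyperbolic symmetric metric space $X$ and an isometric and cobounded action of $\Gamma$ on $X$ such that: 1. Any element representing a simple closed geodesic is elliptic. 2. Any element representing a non-simple closed geodesic is loxodromic. 3. The action has bounded backtracking.
   Context: A non-trivial $g\in\Gamma$ represents the closed geodesic in its free homotopy class; this closed geodesic is called simple if its underlying primitive geodesic has no self-intersections (so powers of elements represented by simple closed curves are counted as simple), and non-simple otherwise. An isometry of $X$ is elliptic if it has bounded orbits, and loxodromic if its stable translation length $\lim_k d_X(x,g^kx)/k$ is positive. The action is cobounded if some (any) orbit is at finite Hausdorff distance from $X$. A symmetric metric space is a metric space in the usual sense. The action has bounded backtracking if, for a fixed word metric $d_S$ on $\Gamma$ ($S$ finite generating), orbits of geodesics of $\Gamma$ are quasigeodesics in $X$ up to reparameterization with uniform constants: for $x\in X$ there exist $L,C>0$ such that for every $d_S$-geodesic $g_0,\dots,g_n$ in $\Gamma$ there are an $(L,C)$-quasigeodesic $\gamma:[0,N]\to X$ (i.e. $L^{-1}|s-t|-C\le d_X(\gamma(s),\gamma(t))\le L|s-t|+C$) and a nondecreasing map $\theta:\{0,\dots,n\}\to[0,N]$ with $\theta(0)=0$, $\theta(n)=N$ and $d_X(\gamma(\theta(i)),g_ix)\le C$ for all $i$. *)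

theory Defs
  imports
    "HOL-Analysis.Analysis"
    "HOL-Algebra.Generated_Groups"
    "HOL-Algebra.Group_Action"
begin

section \<open>Closed hyperbolic surfaces and their closed geodesics\<close>

definition hyp_plane :: "complex set" where
  "hyp_plane = {z. Im z > 0}"

definition hyp_dist :: "complex \<Rightarrow> complex \<Rightarrow> real" where
  "hyp_dist z w = arcosh (1 + (cmod (z - w))\<^sup>2 / (2 * Im z * Im w))"

text \<open>
  Only the germ of the metric at each point matters. The path metric of a closed Riemannian
  surface of curvature \<open>-1\<close> is an instance; conversely, the charts below determine such a Riemannian
  metric, whose path metric agrees with \<^const>\<open>dist\<close> on small balls. The surface need not be
  orientable, since the charts may reverse orientation.
\<close>

definition closed_hyperbolic_surface :: "'a::metric_space set \<Rightarrow> bool" where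
  "closed_hyperbolic_surface S \<longleftrightarrow>
     S \<noteq> {} \<and> compact S \<and> connected S \<and>
     (\<forall>x\<in>S. \<exists>r>0. \<exists>f. \<exists>z\<in>hyp_plane.
        bij_betw f (S \<inter> ball x r) {w \<in> hyp_plane. hyp_dist z w < r} \<and>
        (\<forall>u\<in>S \<inter> ball x r. \<forall>v\<in>S \<inter> ball x r. hyp_dist (f u) (f v) = dist u v))"

definition has_period :: "(real \<Rightarrow> 'a) \<Rightarrow> real \<Rightarrow> bool" where
  "has_period c l \<longleftrightarrow> l > 0 \<and> (\<forall>t. c (t + l) = c t)"

text \<open>
  A closed geodesic of length \<open>l\<close> is a unit speed local geodesic \<open>c\<close> on the whole line with period
  \<open>l\<close>, not necessarily the least one: the underlying primitive geodesic is the restriction of \<open>c\<close>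
  to one least period.
\<close>

definition closed_geodesic :: "'a::metric_space set \<Rightarrow> (real \<Rightarrow> 'a) \<Rightarrow> real \<Rightarrow> bool" where
  "closed_geodesic S c l \<longleftrightarrow>
     range c \<subseteq> S \<and> has_period c l \<and>
     (\<forall>t. \<exists>e>0. \<forall>s\<in>{t - e<..<t + e}. \<forall>s'\<in>{t - e<..<t + e}. dist (c s) (c s') = \<bar>s - s'\<bar>)"

definition primitive_period :: "(real \<Rightarrow> 'a) \<Rightarrow> real \<Rightarrow> bool" where
  "primitive_period c l \<longleftrightarrow> has_period c l \<and> (\<forall>k. has_period c k \<longrightarrow> l \<le> k)"

definition simple_geodesic :: "(real \<Rightarrow> 'a) \<Rightarrow> bool" where
  "simple_geodesic c \<longleftrightarrow> (\<exists>l. primitive_period c l \<and> inj_on c {0..<l})"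


section \<open>The fundamental group\<close>

definition loops_at :: "'a::topological_space set \<Rightarrow> 'a \<Rightarrow> (real \<Rightarrow> 'a) set" where
  "loops_at S p = {\<gamma>. path \<gamma> \<and> path_image \<gamma> \<subseteq> S \<and> pathstart \<gamma> = p \<and> pathfinish \<gamma> = p}"

definition loop_class :: "'a::topological_space set \<Rightarrow> (real \<Rightarrow> 'a) \<Rightarrow> (real \<Rightarrow> 'a) set" where
  "loop_class S \<gamma> = {\<delta>. homotopic_paths S \<gamma> \<delta>}"

definition fundamental_group :: "'a::topological_space set \<Rightarrow> 'a \<Rightarrow> (real \<Rightarrow> 'a) set monoid" where
  "fundamental_group S p =
     \<lparr>carrier = loop_class S ` loops_at S p,
      mult = (\<lambda>A B. \<Union>\<alpha>\<in>A. \<Union>\<beta>\<in>B. loop_class S (\<alpha> +++ \<beta>)),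
      one = loop_class S (\<lambda>_. p)\<rparr>"

text \<open>The loop traversing a closed geodesic of length \<open>l\<close> once is freely homotopic to the element.\<close>

definition represents_geodesic ::
    "'a::metric_space set \<Rightarrow> (real \<Rightarrow> 'a) set \<Rightarrow> (real \<Rightarrow> 'a) \<Rightarrow> real \<Rightarrow> bool" where
  "represents_geodesic S g c l \<longleftrightarrow>
     closed_geodesic S c l \<and> (\<exists>\<gamma>\<in>g. homotopic_loops S \<gamma> (\<lambda>t. c (l * t)))"

definition represents_simple :: "'a::metric_space set \<Rightarrow> 'a \<Rightarrow> (real \<Rightarrow> 'a) set \<Rightarrow> bool" where
  "represents_simple S p g \<longleftrightarrow>
     g \<noteq> \<one>\<^bsub>fundamental_group S p\<^esub> \<and> (\<exists>c l. represents_geodesic S g c l \<and> simple_geodesic c)"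

definition represents_nonsimple :: "'a::metric_space set \<Rightarrow> 'a \<Rightarrow> (real \<Rightarrow> 'a) set \<Rightarrow> bool" where
  "represents_nonsimple S p g \<longleftrightarrow>
     g \<noteq> \<one>\<^bsub>fundamental_group S p\<^esub> \<and> (\<exists>c l. represents_geodesic S g c l \<and> \<not> simple_geodesic c)"


section \<open>Hyperbolic metric spaces and isometric actions\<close>

definition gromov_product :: "('x \<Rightarrow> 'x \<Rightarrow> real) \<Rightarrow> 'x \<Rightarrow> 'x \<Rightarrow> 'x \<Rightarrow> real" where
  "gromov_product d w x y = (d x w + d y w - d x y) / 2"

definition gromov_hyperbolic :: "'x set \<Rightarrow> ('x \<Rightarrow> 'x \<Rightarrow> real) \<Rightarrow> bool" where
  "gromov_hyperbolic X d \<longleftrightarrow>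
     (\<exists>\<delta>\<ge>0. \<forall>x\<in>X. \<forall>y\<in>X. \<forall>z\<in>X. \<forall>w\<in>X.
        gromov_product d w x z \<ge> min (gromov_product d w x y) (gromov_product d w y z) - \<delta>)"

definition isometric_action ::
    "('g, 'b) monoid_scheme \<Rightarrow> 'x set \<Rightarrow> ('x \<Rightarrow> 'x \<Rightarrow> real) \<Rightarrow> ('g \<Rightarrow> 'x \<Rightarrow> 'x) \<Rightarrow> bool" where
  "isometric_action G X d \<phi> \<longleftrightarrow>
     group_action G X \<phi> \<and>
     (\<forall>g\<in>carrier G. \<forall>x\<in>X. \<forall>y\<in>X. d (\<phi> g x) (\<phi> g y) = d x y)"

definition cobounded_action ::
    "('g, 'b) monoid_scheme \<Rightarrow> 'x set \<Rightarrow> ('x \<Rightarrow> 'x \<Rightarrow> real) \<Rightarrow> ('g \<Rightarrow> 'x \<Rightarrow> 'x) \<Rightarrow> bool" where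
  "cobounded_action G X d \<phi> \<longleftrightarrow>
     (\<exists>x\<in>X. \<exists>D. \<forall>y\<in>X. \<exists>g\<in>carrier G. d y (\<phi> g x) \<le> D)"

definition elliptic :: "'x set \<Rightarrow> ('x \<Rightarrow> 'x \<Rightarrow> real) \<Rightarrow> ('x \<Rightarrow> 'x) \<Rightarrow> bool" where
  "elliptic X d f \<longleftrightarrow>
     (\<forall>x\<in>X. Metric_space.mbounded X d (range (\<lambda>k::int. (f [^]\<^bsub>BijGroup X\<^esub> k) x)))"

definition loxodromic :: "'x set \<Rightarrow> ('x \<Rightarrow> 'x \<Rightarrow> real) \<Rightarrow> ('x \<Rightarrow> 'x) \<Rightarrow> bool" where
  "loxodromic X d f \<longleftrightarrow>
     (\<exists>\<tau>>0. \<forall>x\<in>X. (\<lambda>k::nat. d x ((f [^]\<^bsub>BijGroup X\<^esub> k) x) / real k) \<longlonglongrightarrow> \<tau>)"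


section \<open>Word metrics and bounded backtracking\<close>

definition finite_generating_set :: "('g, 'b) monoid_scheme \<Rightarrow> 'g set \<Rightarrow> bool" where
  "finite_generating_set G T \<longleftrightarrow> finite T \<and> T \<subseteq> carrier G \<and> generate G T = carrier G"

definition word_length :: "('g, 'b) monoid_scheme \<Rightarrow> 'g set \<Rightarrow> 'g \<Rightarrow> nat" where
  "word_length G T g =
     (LEAST n. \<exists>ws. length ws = n \<and> set ws \<subseteq> T \<union> m_inv G ` T \<and> foldr (mult G) ws \<one>\<^bsub>G\<^esub> = g)"

definition word_dist :: "('g, 'b) monoid_scheme \<Rightarrow> 'g set \<Rightarrow> 'g \<Rightarrow> 'g \<Rightarrow> nat" where
  "word_dist G T g h = word_length G T (inv\<^bsub>G\<^esub> g \<otimes>\<^bsub>G\<^esub> h)"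

definition word_geodesic :: "('g, 'b) monoid_scheme \<Rightarrow> 'g set \<Rightarrow> nat \<Rightarrow> (nat \<Rightarrow> 'g) \<Rightarrow> bool" where
  "word_geodesic G T n h \<longleftrightarrow>
     (\<forall>i\<le>n. h i \<in> carrier G) \<and>
     (\<forall>i\<le>n. \<forall>j\<le>n. real (word_dist G T (h i) (h j)) = \<bar>real i - real j\<bar>)"

definition quasigeodesic ::
    "'x set \<Rightarrow> ('x \<Rightarrow> 'x \<Rightarrow> real) \<Rightarrow> real \<Rightarrow> real \<Rightarrow> real \<Rightarrow> (real \<Rightarrow> 'x) \<Rightarrow> bool" where
  "quasigeodesic X d L C N \<gamma> \<longleftrightarrow>
     \<gamma> ` {0..N} \<subseteq> X \<and>
     (\<forall>s\<in>{0..N}. \<forall>t\<in>{0..N}.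
        \<bar>s - t\<bar> / L - C \<le> d (\<gamma> s) (\<gamma> t) \<and> d (\<gamma> s) (\<gamma> t) \<le> L * \<bar>s - t\<bar> + C)"

definition bounded_backtracking_wrt ::
    "('g, 'b) monoid_scheme \<Rightarrow> 'g set \<Rightarrow> 'x set \<Rightarrow> ('x \<Rightarrow> 'x \<Rightarrow> real) \<Rightarrow> ('g \<Rightarrow> 'x \<Rightarrow> 'x) \<Rightarrow> bool" where
  "bounded_backtracking_wrt G T X d \<phi> \<longleftrightarrow>
     (\<forall>x\<in>X. \<exists>L>0. \<exists>C>0. \<forall>n h. word_geodesic G T n h \<longrightarrow>
        (\<exists>N\<ge>0. \<exists>\<gamma>. quasigeodesic X d L C N \<gamma> \<and>
          (\<exists>\<theta> :: nat \<Rightarrow> real.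
             mono_on {0..n} \<theta> \<and> \<theta> ` {0..n} \<subseteq> {0..N} \<and> \<theta> 0 = 0 \<and> \<theta> n = N \<and>
             (\<forall>i\<le>n. d (\<gamma> (\<theta> i)) (\<phi> (h i) x) \<le> C))))"

text \<open>
  The property does not depend on the word metric; quantifying over all finite generating sets makes
  this visible in the definition. The quantifier is not vacuous for the fundamental group of a
  closed surface, which is finitely generated.
\<close>

definition bounded_backtracking ::
    "('g, 'b) monoid_scheme \<Rightarrow> 'x set \<Rightarrow> ('x \<Rightarrow> 'x \<Rightarrow> real) \<Rightarrow> ('g \<Rightarrow> 'x \<Rightarrow> 'x) \<Rightarrow> bool" where
  "bounded_backtracking G X d \<phi> \<longleftrightarrow>
     (\<forall>T. finite_generating_set G T \<longrightarrow> bounded_backtracking_wrt G T X d \<phi>)"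

end

theory Submission
  imports Defs "HOL-Real_Asymp.Real_Asymp"
begin

text \<open>The universal cover of \<open>S\<close> is the hyperbolic plane, on which \<open>\<Gamma>\<close> acts through its holonomy. Join
  two points of the plane by an edge if they have distance at most \<open>1\<close> or lie on a common lift of a simple
  closed geodesic; let \<open>X\<close> be \<open>\<Gamma>\<close> with the metric pulled back by the orbit map from the graph distance
  \<open>dg\<close>. The hyperbolic geodesic between the ends of a chain of \<open>n\<close> edges stays
  within \<open>O(log n)\<close> of the chain, so hyperbolic geodesics are uniformly quasi-monotone for \<open>dg\<close>; this gives hyperbolicity and, since \<open>\<Gamma>\<close>-geodesics
  are hyperbolic quasigeodesics, bounded backtracking. The axis of a simple element has
  diameter at most \<open>1\<close>. The axis of a non-simple element crosses one of its translates transversally,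
  hence a lift of a simple closed geodesic cannot follow it for long without
  crossing a translate of itself; so \<open>dg\<close> is unbounded on the axis, and it grows linearly
  because it is quasi-additive along the axis.\<close>

section \<open>Coarse geometry\<close>

text \<open>Edges along simple lines can be arbitrarily long for the hyperbolic distance, so edge
  paths need not be hyperbolic quasigeodesics and the usual Morse lemma does not apply to them. What
  survives is that a line contains the whole hyperbolic segment between two of its points, so the
  segment spanned by an edge is \<open>dg\<close>-close to both ends of that edge. This is the
  condition \<open>link\<close>; combined with thin triangles it gives the logarithm. At a point of
  a hyperbolic geodesic almost as far as possible from a shortest edge path, say at distance h, a
  chain of length linear in h runs around the ball of radius h. Hence h = O(log h), and h is
  bounded. Balls of \<open>dg\<close> can be unbounded in the plane, so the growth of
  \<open>dg\<close> along an axis cannot come from local finiteness; it comes from counting the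
  edges of a path against points on the axis. The action on the plane is free, so the orbit map is
  injective and \<open>dg\<close> pulls back to a genuine metric on \<Gamma>, on which left
  multiplication is transitive. Orientation reversing isometries are kept throughout, as the surface
  may be non-orientable.\<close>

lemma log_dominated_bound:
  fixes a b c e :: real
  assumes "a > 0" "b > 0" "c > 0"
  shows "\<exists>H. \<forall>h\<ge>0. h \<le> c * log 2 (a * h + b) + e \<longrightarrow> h \<le> H"
proof -
  have "filterlim (\<lambda>h::real. h - c * log 2 (a * h + b) - e) at_top at_top"
    using assms by real_asymp
  then have "\<forall>\<^sub>F h in at_top. h - c * log 2 (a * h + b) - e > 0"
    unfolding filterlim_at_top_dense by blast
  then obtain H where "\<forall>h\<ge>H. h - c * log 2 (a * h + b) - e > 0"
    by (auto simp: eventually_at_top_linorder)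
  then show ?thesis by (intro exI[of _ H]) (metis diff_gt_0_iff_gt diff_diff_eq linorder_not_le nle_le)
qed

lemma relpow_subset: "(R :: ('a \<times> 'a) set) \<subseteq> S \<Longrightarrow> R ^^ n \<subseteq> S ^^ n"
  by (induction n) (simp_all add: relcomp_mono)

section \<open>Geodesics, metric intervals and thin triangles in a hyperbolic space\<close>

definition geod :: "'p set \<Rightarrow> ('p \<Rightarrow> 'p \<Rightarrow> real) \<Rightarrow> (real \<Rightarrow> 'p) \<Rightarrow> real \<Rightarrow> bool" where
  "geod Y D c L \<longleftrightarrow> c ` {0..L} \<subseteq> Y \<and> (\<forall>s\<in>{0..L}. \<forall>t\<in>{0..L}. D (c s) (c t) = \<bar>s - t\<bar>)"

text \<open>Hyperbolicity compares the three ways of pairing four points. In this form it comes out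
  of Ptolemy's inequality for the plane, and one substitution makes triangles thin.\<close>

locale geodesic_hyperbolic =
  fixes Y :: "'p set" and D :: "'p \<Rightarrow> 'p \<Rightarrow> real" and \<delta> :: real
  assumes nonneg: "\<lbrakk>x\<in>Y; y\<in>Y\<rbrakk> \<Longrightarrow> 0 \<le> D x y"
    and commute: "D x y = D y x"
    and zero: "\<lbrakk>x\<in>Y; y\<in>Y\<rbrakk> \<Longrightarrow> D x y = 0 \<longleftrightarrow> x = y"
    and triangle: "\<lbrakk>x\<in>Y; y\<in>Y; z\<in>Y\<rbrakk> \<Longrightarrow> D x z \<le> D x y + D y z"
    and four_point: "\<lbrakk>x\<in>Y; y\<in>Y; z\<in>Y; w\<in>Y\<rbrakk> \<Longrightarrow> D x z + D y w \<le> max (D x y + D z w) (D x w + D y z) + \<delta>"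
    and geod_exists: "\<lbrakk>x\<in>Y; y\<in>Y\<rbrakk> \<Longrightarrow> \<exists>c. geod Y D c (D x y) \<and> c 0 = x \<and> c (D x y) = y"
    and delta_nonneg: "\<delta> \<ge> 0"
begin

declare nonneg [simp]

lemma dist_self [simp]: "x \<in> Y \<Longrightarrow> D x x = 0"
  using zero by blast

text \<open>The metric interval, that is, the union of all geodesics from \<open>x\<close> to
  \<open>y\<close>; no geodesic has to be chosen.\<close>

definition seg :: "'p \<Rightarrow> 'p \<Rightarrow> 'p set" where
  "seg x y = {m\<in>Y. D x m + D m y = D x y}"

lemma seg_commute: "seg x y = seg y x"
  unfolding seg_def by (auto simp: commute add.commute)

lemma geod_in: "geod Y D c L \<Longrightarrow> t \<in> {0..L} \<Longrightarrow> c t \<in> Y"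
  unfolding geod_def by auto

lemma geod_dist: "geod Y D c L \<Longrightarrow> s \<in> {0..L} \<Longrightarrow> t \<in> {0..L} \<Longrightarrow> D (c s) (c t) = \<bar>s - t\<bar>"
  unfolding geod_def by auto

lemma geod_seg:
  assumes "geod Y D c L" "0 \<le> s" "s \<le> t" "t \<le> u" "u \<le> L"
  shows "c t \<in> seg (c s) (c u)"
  using assms geod_in[of c L t] geod_dist[of c L s t] geod_dist[of c L t u] geod_dist[of c L s u]
  unfolding seg_def by auto

lemma geod_reverse: "geod Y D c L \<Longrightarrow> geod Y D (\<lambda>t. c (L - t)) L"
  unfolding geod_def by auto

text \<open>The candidate is the point of \<open>c\<close> at the same distance from
  \<open>c 0\<close> as \<open>m\<close>. In the four-point inequality for \<open>m\<close>, this
  point and the two ends, both sums on the right are at most L + K. If \<open>m\<close> is farther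
  than L from \<open>c 0\<close>, the end \<open>c L\<close> is already close enough.\<close>

lemma near_geodesic:
  assumes c: "geod Y D c L" and L: "D (c 0) (c L) = L" "L \<ge> 0" and m: "m \<in> Y"
    and K: "D (c 0) m + D m (c L) \<le> L + K"
  shows "\<exists>t\<in>{0..L}. D m (c t) \<le> K + \<delta>"
proof -
  have c0: "c 0 \<in> Y" "c L \<in> Y" using geod_in[OF c] L by auto
  have K0: "K \<ge> 0" using triangle[OF c0(1) m c0(2)] K L by auto
  show ?thesis
  proof (cases "D (c 0) m \<le> L")
    case True
    let ?t = "D (c 0) m"
    have t: "?t \<in> {0..L}" using True nonneg[OF c0(1) m] by simp
    have ct: "c ?t \<in> Y" using geod_in[OF c t] .
    have "D (c 0) (c ?t) = ?t" "D (c ?t) (c L) = L - ?t"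
      using geod_dist[OF c, of 0 ?t] geod_dist[OF c, of ?t L] t L by auto
    moreover have "D m (c ?t) + D (c 0) (c L) \<le> max (D m (c 0) + D (c ?t) (c L)) (D m (c L) + D (c 0) (c ?t)) + \<delta>"
      by (rule four_point[OF m c0(1) ct c0(2)])
    ultimately have "D m (c ?t) \<le> K + \<delta>"
      using K L K0 commute[of m "c 0"] by linarith
    then show ?thesis using t by blast
  next
    case False
    then have "D m (c L) \<le> K + \<delta>" using K delta_nonneg by linarith
    then show ?thesis using L by (intro bexI[of _ L]) auto
  qed
qed

lemma seg_near:
  assumes "x \<in> Y" "y \<in> Y" "m \<in> Y" "D x m + D m y \<le> D x y + K"
  shows "\<exists>m'\<in>seg x y. D m m' \<le> K + \<delta>"
proof -
  obtain c where c: "geod Y D c (D x y)" "c 0 = x" "c (D x y) = y" using geod_exists assms by blast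
  have "\<exists>t\<in>{0..D x y}. D m (c t) \<le> K + \<delta>"
    by (rule near_geodesic[OF c(1)]) (use assms c in auto)
  moreover have "c t \<in> seg x y" if "t\<in>{0..D x y}" for t
    using geod_seg[OF c(1), of 0 t "D x y"] that c by auto
  ultimately show ?thesis by blast
qed

text \<open>The four-point inequality with diagonals my and xz, in which \<open>D x z\<close> splits
  as \<open>D x m + D m z\<close> and cancels.\<close>

lemma seg_triangle_between:
  assumes "x \<in> Y" "y \<in> Y" "z \<in> Y" "m \<in> seg x z"
  shows "D x m + D m y \<le> D x y + \<delta> \<or> D y m + D m z \<le> D y z + \<delta>"
proof -
  have m: "m \<in> Y" "D x m + D m z = D x z" using assms by (auto simp: seg_def)
  have "D m y + D x z \<le> max (D m x + D y z) (D m z + D x y) + \<delta>"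
    using four_point[of m x y z] assms m by auto
  then show ?thesis using m commute[of m x] commute[of m y] by linarith
qed

lemma seg_thin:
  assumes "x \<in> Y" "y \<in> Y" "z \<in> Y" "m \<in> seg x z"
  shows "\<exists>m'\<in>seg x y \<union> seg y z. D m m' \<le> 2 * \<delta>"
proof -
  have m: "m \<in> Y" using assms by (auto simp: seg_def)
  from seg_triangle_between[OF assms] show ?thesis
    using seg_near[of x y m \<delta>] seg_near[of y z m \<delta>] assms m by (auto simp: commute)
qed

text \<open>Triangles are cut off one at a time from the end, so the constant is linear in n. This
  is enough where the number of sides is fixed, as in \<open>dg_axis_unbounded\<close>; the
  logarithmic version is \<open>chain_log_bound\<close>.\<close>

lemma seg_polygon:
  assumes "\<And>i. i \<le> n \<Longrightarrow> p i \<in> Y" "m \<in> seg (p 0) (p n)" "n > 0"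
  shows "\<exists>i<n. \<exists>m'\<in>seg (p i) (p (Suc i)). D m m' \<le> 2 * \<delta> * real n"
  using assms
proof (induction n arbitrary: m)
  case 0 then show ?case by simp
next
  case (Suc n)
  show ?case
  proof (cases "n = 0")
    case True
    have "m \<in> Y" using Suc.prems by (auto simp: seg_def)
    then show ?thesis using Suc.prems True delta_nonneg by (intro exI[of _ 0]) (auto intro!: bexI[of _ m] simp: zero)
  next
    case False
    obtain m' where m': "m' \<in> seg (p 0) (p n) \<union> seg (p n) (p (Suc n))" "D m m' \<le> 2 * \<delta>"
      using seg_thin[of "p 0" "p n" "p (Suc n)" m] Suc.prems by auto
    have mY: "m \<in> Y" "m' \<in> Y" using Suc.prems m' by (auto simp: seg_def)
    consider "m' \<in> seg (p 0) (p n)" | "m' \<in> seg (p n) (p (Suc n))" using m' by blast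
    then show ?thesis
    proof cases
      case 1
      then obtain i m'' where i: "i < n" "m'' \<in> seg (p i) (p (Suc i))" "D m' m'' \<le> 2 * \<delta> * real n"
        using Suc.IH[of m'] Suc.prems False by auto
      have "D m m'' \<le> D m m' + D m' m''" using triangle[of m m' m''] mY i by (auto simp: seg_def)
      also have "\<dots> \<le> 2 * \<delta> * real (Suc n)" using i m' by (simp add: algebra_simps)
      finally show ?thesis using i by (intro exI[of _ i]) auto
    next
      case 2
      have "2 * \<delta> * 1 \<le> 2 * \<delta> * real (Suc n)" using delta_nonneg by (intro mult_left_mono) auto
      then have "D m m' \<le> 2 * \<delta> * real (Suc n)" using m' by linarith
      then show ?thesis using 2 by blast
    qed
  qed
qed

end

text \<open>\<open>d\<close> is a second pseudo-metric, coarsely dominated by \<open>D\<close>. The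
  theory is used twice: for the electrified distance \<open>dg\<close>, and for \<open>hD\<close>
  itself, where it yields the Morse lemma for ordinary quasigeodesics.\<close>

locale coarse_paths = geodesic_hyperbolic Y D \<delta> for Y :: "'p set" and D \<delta> +
  fixes d :: "'p \<Rightarrow> 'p \<Rightarrow> real" and A :: real
  assumes A_ge1: "A \<ge> 1"
    and d_nonneg: "\<lbrakk>x\<in>Y; y\<in>Y\<rbrakk> \<Longrightarrow> d x y \<ge> 0"
    and d_refl: "x \<in> Y \<Longrightarrow> d x x = 0"
    and d_sym: "d x y = d y x"
    and d_triangle: "\<lbrakk>x\<in>Y; y\<in>Y; z\<in>Y\<rbrakk> \<Longrightarrow> d x z \<le> d x y + d y z"
    and d_le: "\<lbrakk>x\<in>Y; y\<in>Y\<rbrakk> \<Longrightarrow> d x y \<le> A * D x y + A"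
begin

text \<open>The ends may be far apart for \<open>D\<close>; what counts is that the whole
  \<open>D\<close>-interval between them is \<open>d\<close>-close to both.\<close>

definition link :: "'p \<Rightarrow> 'p \<Rightarrow> bool" where
  "link u v \<longleftrightarrow> (\<forall>m\<in>seg u v. d m u \<le> A \<and> d m v \<le> A)"

text \<open>Repetition of a point is allowed so that a chain can be padded to a greater length, in
  particular to a power of 2.\<close>

definition chain_rel :: "'p set \<Rightarrow> ('p \<times> 'p) set" where
  "chain_rel Z = {(u, v). u \<in> Z \<and> v \<in> Z \<and> (u = v \<or> link u v)}"

lemma link_sym: "link u v \<Longrightarrow> link v u"
  unfolding link_def using seg_commute[of u v] by auto

lemma chain_rel_sym: "sym (chain_rel Z)"
  unfolding chain_rel_def sym_def using link_sym by auto

lemma chain_pow_mono: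
  assumes "(u, v) \<in> chain_rel Z ^^ n" "v \<in> Z" "n \<le> n'"
  shows "(u, v) \<in> chain_rel Z ^^ n'"
proof -
  have "(v, v) \<in> chain_rel Z ^^ k" for k
    by (induction k) (use assms(2) in \<open>auto simp: chain_rel_def\<close>)
  then have "(u, v) \<in> chain_rel Z ^^ (n + (n' - n))"
    using assms(1) by (subst relpow_add) auto
  then show ?thesis using assms(3) by simp
qed

lemma chain_pow_sym: "(u, v) \<in> chain_rel Z ^^ n \<Longrightarrow> (v, u) \<in> chain_rel Z ^^ n"
proof (induction n arbitrary: u v)
  case 0 then show ?case by simp
next
  case (Suc n)
  then obtain w where "(u, w) \<in> chain_rel Z ^^ n" "(w, v) \<in> chain_rel Z" by auto
  then have "(w, u) \<in> chain_rel Z ^^ n" "(v, w) \<in> chain_rel Z"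
    using Suc.IH chain_rel_sym by (auto dest: symD)
  then show ?case by (meson relpow_Suc_I2)
qed

lemma chain_pow_in:
  assumes "(u, v) \<in> chain_rel Z ^^ n" "u \<in> Z" shows "v \<in> Z"
  using assms by (cases n) (auto simp: chain_rel_def)

text \<open>Halving the chain costs one thin triangle, so a chain of length \<open>2 ^ k\<close> costs only \<open>k\<close> of them.\<close>

lemma chain_log_bound:
  assumes "(u, v) \<in> chain_rel Z ^^ (2 ^ k)" "u \<in> Z" "Z \<subseteq> Y" "m \<in> seg u v"
  shows "\<exists>z\<in>Z. d m z \<le> (2 * A * \<delta> + A) * real k + A"
  using assms
proof (induction k arbitrary: u v m)
  case 0
  then have uv: "(u, v) \<in> chain_rel Z" by simp
  have "d m u \<le> A"
  proof (cases "u = v")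
    case True
    then have "D u m + D m u = 0" using 0 by (auto simp: seg_def subset_iff)
    then have "D u m = 0" using commute[of m u] by simp
    then have "m = u" using 0 zero[of u m] by (auto simp: seg_def)
    then show ?thesis using d_refl[of u] 0 A_ge1 by (auto simp: seg_def)
  next
    case False
    then show ?thesis using 0 uv unfolding chain_rel_def link_def by auto
  qed
  then show ?case using 0 by auto
next
  case (Suc k)
  have "(u, v) \<in> chain_rel Z ^^ (2 ^ k + 2 ^ k)" using Suc.prems by (simp add: mult_2)
  then obtain w where w: "(u, w) \<in> chain_rel Z ^^ (2 ^ k)" "(w, v) \<in> chain_rel Z ^^ (2 ^ k)"
    by (subst (asm) relpow_add) auto
  have Z: "w \<in> Z" "v \<in> Z" using w Suc.prems chain_pow_in by auto
  obtain m' where m': "m' \<in> seg u w \<union> seg w v" "D m m' \<le> 2 * \<delta>"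
    using seg_thin[of u w v m] Suc.prems Z by auto
  have "\<exists>z\<in>Z. d m' z \<le> (2 * A * \<delta> + A) * real k + A"
    using m'(1) Suc.IH[OF w(1)] Suc.IH[OF w(2)] Suc.prems Z by blast
  then obtain z where z: "z \<in> Z" "d m' z \<le> (2 * A * \<delta> + A) * real k + A" by blast
  have mY: "m \<in> Y" "m' \<in> Y" "z \<in> Y" using m' z Suc.prems by (auto simp: seg_def)
  have "d m m' \<le> A * D m m' + A" using d_le mY by auto
  also have "\<dots> \<le> A * (2 * \<delta>) + A" using m'(2) A_ge1 by (intro add_right_mono mult_left_mono) auto
  finally have "d m z \<le> (A * (2 * \<delta>) + A) + ((2 * A * \<delta> + A) * real k + A)"
    using d_triangle[OF mY] z by linarith
  also have "\<dots> = (2 * A * \<delta> + A) * real (Suc k) + A" by (simp add: algebra_simps)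
  finally show ?case using z by blast
qed

text \<open>Walk back along \<open>c\<close> in steps of length 1. One step changes the
  \<open>d\<close>-distance by at most 2A, so the first time it reaches W it is at most W + 2A; if
  this never happens, the start of \<open>c\<close> serves. Discrete steps are taken because
  \<open>d\<close> need not be continuous.\<close>

lemma escape_point:
  assumes c: "geod Y D c L" and t: "t \<in> {0..L}" and W: "W \<ge> 0"
  shows "\<exists>s\<in>{0..t}. d (c t) (c s) \<le> W + 2 * A \<and> (s = 0 \<or> d (c t) (c s) \<ge> W)"
proof -
  define P where "P k \<longleftrightarrow> t - real k < 0 \<or> d (c t) (c (t - real k)) \<ge> W" for k
  have "P (nat \<lceil>t\<rceil> + 1)" unfolding P_def using t by (auto simp: le_nat_iff) linarith
  define k where "k = (LEAST k. P k)"
  have Pk: "P k" unfolding k_def using \<open>P (nat \<lceil>t\<rceil> + 1)\<close> by (rule LeastI)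
  define s where "s = max 0 (t - real k)"
  have s: "s \<in> {0..t}" using t by (auto simp: s_def)
  have cY: "c t \<in> Y" "c s \<in> Y" using geod_in[OF c] s t by auto
  have "d (c t) (c s) \<le> W + 2 * A"
  proof (cases k)
    case 0
    then have "s = t" using t by (simp add: s_def)
    then show ?thesis using d_refl[OF cY(1)] W A_ge1 by simp
  next
    case (Suc j)
    then have "\<not> P j" unfolding k_def by (metis not_less_Least lessI)
    then have j: "t - real j \<ge> 0" "d (c t) (c (t - real j)) < W" by (auto simp: P_def)
    have "D (c (t - real j)) (c s) = \<bar>t - real j - s\<bar>"
      using geod_dist[OF c, of "t - real j" s] j s t by auto
    also have "\<dots> \<le> 1" using j Suc by (auto simp: s_def)
    finally have D1: "D (c (t - real j)) (c s) \<le> 1" .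
    have jY: "c (t - real j) \<in> Y" using geod_in[OF c] j t by auto
    have "d (c (t - real j)) (c s) \<le> A * D (c (t - real j)) (c s) + A" using d_le jY cY by auto
    also have "\<dots> \<le> A * 1 + A" using D1 A_ge1 by (intro add_right_mono mult_left_mono) auto
    finally show ?thesis using d_triangle[OF cY(1) jY cY(2)] j by linarith
  qed
  moreover have "s = 0 \<or> d (c t) (c s) \<ge> W" using Pk by (auto simp: P_def s_def max_def)
  ultimately show ?thesis using s by blast
qed

end

text \<open>Besides having linear length, the chain must stay in a \<open>d\<close>-ball about its
  start. This is what lets \<open>endpoint_chain\<close> keep it away from a distant point.\<close>

locale coarse_geodesic = coarse_paths +
  assumes connect: "\<lbrakk>x\<in>Y; y\<in>Y\<rbrakk> \<Longrightarrow>
    \<exists>n. real n \<le> A * d x y + A \<and> (x, y) \<in> chain_rel {z\<in>Y. d x z \<le> d x y + A} ^^ n"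
begin

text \<open>Only the lower quasigeodesic bound is written out: \<open>link\<close> already bounds
  each step by A, since an interval contains its ends.\<close>

definition quasi_path :: "(nat \<Rightarrow> 'a) \<Rightarrow> nat \<Rightarrow> bool" where
  "quasi_path p n \<longleftrightarrow> (\<forall>i\<le>n. p i \<in> Y) \<and> (\<forall>i<n. link (p i) (p (Suc i))) \<and>
     (\<forall>i\<le>n. \<forall>j\<le>n. \<bar>real i - real j\<bar> \<le> A * d (p i) (p j) + A)"

lemma quasi_path_chain:
  assumes "quasi_path p n" "\<And>i. i \<le> n \<Longrightarrow> p i \<in> Z" "i \<le> j" "j \<le> n"
  shows "(p i, p j) \<in> chain_rel Z ^^ (j - i)"
  using assms(3,4)
proof (induction "j - i" arbitrary: j)
  case 0 then show ?case by simp
next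
  case (Suc k)
  then obtain j' where j': "j = Suc j'" "j' \<ge> i" "k = j' - i" by (cases j) auto
  have "(p i, p j') \<in> chain_rel Z ^^ k" using Suc.hyps(1)[of j'] j' Suc.prems by auto
  moreover have "(p j', p j) \<in> chain_rel Z"
    using assms(1,2) j' Suc.prems unfolding chain_rel_def quasi_path_def by auto
  ultimately show ?case using Suc.hyps(2) by (metis relpow_Suc_I)
qed

text \<open>A bridge from the geodesic to the path. It stays within h + 1 + A of \<open>a\<close>,
  and \<open>a\<close> is at least 2h + 1 + A away from \<open>x\<close>, so it avoids the h-ball
  about \<open>x\<close>. At an end of the geodesic \<open>a\<close> is on the path already and the
  bridge is empty.\<close>

lemma endpoint_chain:
  assumes p: "quasi_path p n" and x: "x \<in> Y" and a: "a \<in> Y" and i: "i \<le> n"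
    and far: "\<And>k. k \<le> n \<Longrightarrow> d x (p k) \<ge> h" and h: "h \<ge> 0"
    and alt: "a = p i \<or> d x a \<ge> 2 * h + 1 + A" and ai: "d a (p i) \<le> h + 1"
  shows "\<exists>k. real k \<le> A * (h + 1) + A \<and> (a, p i) \<in> chain_rel {z\<in>Y. d x z \<ge> h} ^^ k"
proof (cases "a = p i")
  case True
  then show ?thesis using A_ge1 h by (intro exI[of _ 0]) auto
next
  case False
  then have xa: "d x a \<ge> 2 * h + 1 + A" using alt by blast
  have pY: "p i \<in> Y" using p i by (auto simp: quasi_path_def)
  obtain k where k: "real k \<le> A * d a (p i) + A" "(a, p i) \<in> chain_rel {z\<in>Y. d a z \<le> d a (p i) + A} ^^ k"
    using connect[OF a pY] by blast
  have "{z\<in>Y. d a z \<le> d a (p i) + A} \<subseteq> {z\<in>Y. d x z \<ge> h}"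
  proof safe
    fix z assume z: "z \<in> Y" "d a z \<le> d a (p i) + A"
    have "d x a \<le> d x z + d z a" by (rule d_triangle) (use x z a in auto)
    then show "d x z \<ge> h" using z xa ai d_sym[of a z] by linarith
  qed
  then have "chain_rel {z\<in>Y. d a z \<le> d a (p i) + A} \<subseteq> chain_rel {z\<in>Y. d x z \<ge> h}"
    unfolding chain_rel_def by auto
  then have "(a, p i) \<in> chain_rel {z\<in>Y. d x z \<ge> h} ^^ k"
    using k(2) relpow_subset by blast
  moreover have "A * d a (p i) \<le> A * (h + 1)" using ai A_ge1 by (intro mult_left_mono) auto
  ultimately show ?thesis using k(1) by (intro exI[of _ k]) auto
qed

text \<open>\<open>c t\<close> almost maximizes the distance to the path, which is between h and h +
  1 there. Leave \<open>c t\<close> in both directions until the distance is about 2h or the end is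
  reached, cross over to the path and follow it. This chain avoids the h-ball about
  \<open>c t\<close> and has length O(h), while \<open>c t\<close> lies in the interval between its
  ends, so \<open>chain_log_bound\<close> applies.\<close>

lemma log_bound_at_extremal:
  assumes p: "quasi_path p n" and c: "geod Y D c L" "c 0 = p 0" "c L = p n" "L \<ge> 0"
    and t: "t \<in> {0..L}" and h: "h \<ge> 0"
    and far: "\<And>k. k \<le> n \<Longrightarrow> d (c t) (p k) \<ge> h"
    and near: "\<And>s. s \<in> {0..L} \<Longrightarrow> \<exists>i\<le>n. d (c s) (p i) \<le> h + 1"
    and N: "2 * (A * (h + 1) + A) + (A * (6 * h + 4 + 6 * A) + A) \<le> 2 ^ k"
  shows "h \<le> (2 * A * \<delta> + A) * real k + A"
proof -
  let ?Z = "{z\<in>Y. d (c t) z \<ge> h}" and ?W = "2 * h + 1 + A"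
  have pY: "p i \<in> Y" if "i \<le> n" for i using p that by (auto simp: quasi_path_def)
  have pZ: "p i \<in> ?Z" if "i \<le> n" for i using pY far that by auto
  have x: "c t \<in> Y" using geod_in[OF c(1) t] .
  have W0: "?W \<ge> 0" using h A_ge1 by auto
  obtain s where s: "s \<in> {0..t}" "d (c t) (c s) \<le> ?W + 2 * A" "s = 0 \<or> d (c t) (c s) \<ge> ?W"
    using escape_point[OF c(1) t W0] by blast
  have t': "L - t \<in> {0..L}" using t by auto
  have "\<exists>r\<in>{0..L - t}. d (c t) (c (L - r)) \<le> ?W + 2 * A \<and> (r = 0 \<or> d (c t) (c (L - r)) \<ge> ?W)"
    using escape_point[OF geod_reverse[OF c(1)] t' W0] by simp
  then obtain r where r: "r \<in> {0..L - t}" "d (c t) (c (L - r)) \<le> ?W + 2 * A"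
    "r = 0 \<or> d (c t) (c (L - r)) \<ge> ?W" by blast
  define u where "u = L - r"
  have u: "u \<in> {t..L}" "d (c t) (c u) \<le> ?W + 2 * A" "u = L \<or> d (c t) (c u) \<ge> ?W"
    using r unfolding u_def by auto
  have sY: "c s \<in> Y" "c u \<in> Y" using geod_in[OF c(1)] s u t by auto
  have "\<exists>i\<le>n. d (c s) (p i) \<le> h + 1 \<and> (c s = p i \<or> d (c t) (c s) \<ge> ?W)"
  proof (cases "s = 0")
    case True then show ?thesis using c d_refl[OF pY[of 0]] h by (intro exI[of _ 0]) auto
  next
    case False then show ?thesis using near[of s] s t by auto
  qed
  then obtain i where i: "i \<le> n" "d (c s) (p i) \<le> h + 1" "c s = p i \<or> d (c t) (c s) \<ge> ?W" by blast
  have "\<exists>j\<le>n. d (c u) (p j) \<le> h + 1 \<and> (c u = p j \<or> d (c t) (c u) \<ge> ?W)"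
  proof (cases "u = L")
    case True then show ?thesis using c d_refl[OF pY[of n]] h by (intro exI[of _ n]) auto
  next
    case False then show ?thesis using near[of u] u t by auto
  qed
  then obtain j where j: "j \<le> n" "d (c u) (p j) \<le> h + 1" "c u = p j \<or> d (c t) (c u) \<ge> ?W" by blast
  obtain k1 where k1: "real k1 \<le> A * (h + 1) + A" "(c s, p i) \<in> chain_rel ?Z ^^ k1"
    using endpoint_chain[OF p x sY(1) i(1) far h i(3,2)] by blast
  obtain k2 where k2: "real k2 \<le> A * (h + 1) + A" "(c u, p j) \<in> chain_rel ?Z ^^ k2"
    using endpoint_chain[OF p x sY(2) j(1) far h j(3,2)] by blast
  define k3 where "k3 = (if i \<le> j then j - i else i - j)"
  have ij: "(p i, p j) \<in> chain_rel ?Z ^^ k3"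
    using quasi_path_chain[OF p pZ, of i j] chain_pow_sym[OF quasi_path_chain[OF p pZ, of j i]] i j
    unfolding k3_def by auto
  \<comment> \<open>Two bridges of length h + 1 and two escapes of length at most 2h + 1 + 3A add up
    to 6h + 4 + 6A.\<close>
  have "d (p i) (p j) \<le> d (p i) (c s) + d (c s) (c t) + d (c t) (c u) + d (c u) (p j)"
    using d_triangle[OF pY[OF i(1)] sY(1) pY[OF j(1)]] d_triangle[OF sY(1) x pY[OF j(1)]]
      d_triangle[OF x sY(2) pY[OF j(1)]] by linarith
  also have "\<dots> \<le> 6 * h + 4 + 6 * A"
    using i j s u d_sym[of "p i" "c s"] d_sym[of "c s" "c t"] by linarith
  finally have "A * d (p i) (p j) \<le> A * (6 * h + 4 + 6 * A)" using A_ge1 by (intro mult_left_mono) auto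
  moreover have "real k3 = \<bar>real i - real j\<bar>" unfolding k3_def by auto
  moreover have "\<bar>real i - real j\<bar> \<le> A * d (p i) (p j) + A" using p i j by (auto simp: quasi_path_def)
  ultimately have k3: "real k3 \<le> A * (6 * h + 4 + 6 * A) + A" by linarith
  have "(c s, c u) \<in> chain_rel ?Z ^^ (k1 + (k3 + k2))"
    using k1(2) ij chain_pow_sym[OF k2(2)] by (auto simp: relpow_add)
  moreover have csZ: "c s \<in> ?Z" "c u \<in> ?Z"
    using chain_pow_in[OF chain_pow_sym[OF k1(2)]] chain_pow_in[OF chain_pow_sym[OF k2(2)]] pZ i j by auto
  moreover have "real (k1 + (k3 + k2)) \<le> 2 ^ k" using k1(1) k2(1) k3 N by auto
  then have "k1 + (k3 + k2) \<le> 2 ^ k" by (metis of_nat_le_iff of_nat_numeral of_nat_power)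
  ultimately have "(c s, c u) \<in> chain_rel ?Z ^^ (2 ^ k)" using chain_pow_mono by blast
  moreover have "c t \<in> seg (c s) (c u)" using geod_seg[OF c(1)] s u by auto
  ultimately obtain z where "z \<in> ?Z" "d (c t) z \<le> (2 * A * \<delta> + A) * real k + A"
    using chain_log_bound[of "c s" "c u" k ?Z "c t"] csZ by blast
  then show ?thesis by auto
qed

text \<open>The distance from the geodesic to the path need not attain its supremum, as
  \<open>d\<close> need not be continuous. A point within 1 of the supremum is taken instead, which
  is the origin of the terms h + 1 above.\<close>

theorem morse:
  "\<exists>H\<ge>0. \<forall>p n c L. quasi_path p n \<and> geod Y D c L \<and> c 0 = p 0 \<and> c L = p n \<and> L \<ge> 0 \<longrightarrow>
     (\<forall>t\<in>{0..L}. \<exists>i\<le>n. d (c t) (p i) \<le> H)"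
proof -
  define B where "B = 2 * A * \<delta> + A"
  have B: "B > 0" unfolding B_def using A_ge1 delta_nonneg by (simp add: add_nonneg_pos)
  \<comment> \<open>The total chain length of \<open>log_bound_at_extremal\<close>, collected as
    \<open>a * h + b\<close>.\<close>
  define a b where "a = 8 * A" and "b = 2 * (A + A) + (A * (4 + 6 * A) + A)"
  have ab: "a > 0" "b \<ge> 1" unfolding a_def b_def using A_ge1
    by (auto simp: algebra_simps) (smt (verit) mult_nonneg_nonneg)
  obtain H where H: "\<forall>h\<ge>0. h \<le> B * log 2 (a * h + b) + (B + A) \<longrightarrow> h \<le> H"
    using log_dominated_bound[of a b B] ab B by auto
  have main: "\<exists>i\<le>n. d (c t) (p i) \<le> max 0 H + 1"
    if p: "quasi_path p n" and c: "geod Y D c L" "c 0 = p 0" "c L = p n" "L \<ge> 0" and t: "t \<in> {0..L}"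
    for p n c L t
  proof -
    define f where "f t = Min ((\<lambda>i. d (c t) (p i)) ` {..n})" for t
    have f_le: "f s \<le> d (c s) (p i)" if "i \<le> n" for s i
      unfolding f_def by (rule Min_le) (use that in auto)
    have f_att: "\<exists>i\<le>n. d (c s) (p i) = f s" for s
    proof -
      have "f s \<in> (\<lambda>i. d (c s) (p i)) ` {..n}" unfolding f_def by (rule Min_in) auto
      then show ?thesis by auto
    qed
    have f0: "f s \<ge> 0" if "s \<in> {0..L}" for s
      using f_att[of s] d_nonneg geod_in[OF c(1) that] p unfolding quasi_path_def by metis
    have fL: "f s \<le> A * L + A" if "s \<in> {0..L}" for s
    proof -
      have "f s \<le> d (c s) (c 0)" using f_le[of 0 s] c by auto
      also have "\<dots> \<le> A * D (c s) (c 0) + A" using geod_in[OF c(1)] that c(4) by (intro d_le) auto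
      also have "\<dots> \<le> A * L + A" using geod_dist[OF c(1), of s 0] that A_ge1 by (auto intro!: mult_left_mono)
      finally show ?thesis .
    qed
    have bdd: "bdd_above (f ` {0..L})" using fL by (intro bdd_aboveI[of _ "A * L + A"]) auto
    have ne: "f ` {0..L} \<noteq> {}" using t by auto
    define Sf where "Sf = Sup (f ` {0..L})"
    have "\<exists>y\<in>f ` {0..L}. Sf - 1 < y" unfolding Sf_def
      using less_cSup_iff[OF ne bdd, of "Sf - 1"] unfolding Sf_def by simp
    then obtain t1 where t1: "t1 \<in> {0..L}" "Sf - 1 < f t1" by auto
    have fS: "f s \<le> Sf" if "s \<in> {0..L}" for s
      unfolding Sf_def by (rule cSup_upper[OF _ bdd]) (use that in auto)
    define h where "h = f t1"
    have h: "h \<ge> 0" unfolding h_def by (rule f0[OF t1(1)])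
    have far: "d (c t1) (p k) \<ge> h" if "k \<le> n" for k using f_le[OF that] unfolding h_def .
    have near: "\<exists>i\<le>n. d (c s) (p i) \<le> h + 1" if "s \<in> {0..L}" for s
    proof -
      have "f s \<le> h + 1" using fS[OF that] t1 unfolding h_def by linarith
      then show ?thesis using f_att[of s] by metis
    qed
    define x where "x = a * h + b"
    have x: "x \<ge> 1" unfolding x_def using ab h by (smt (verit) mult_nonneg_nonneg)
    define k where "k = nat \<lceil>log 2 x\<rceil>"
    have l0: "log 2 x \<ge> 0" using x by simp
    then have k: "log 2 x \<le> real k" "real k \<le> log 2 x + 1" unfolding k_def by linarith+
    have "x \<le> 2 powr real k" using k(1) x by (simp add: log_le_iff)
    then have "x \<le> 2 ^ k" by (simp add: powr_realpow)
    moreover have "2 * (A * (h + 1) + A) + (A * (6 * h + 4 + 6 * A) + A) = x"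
      unfolding x_def a_def b_def by (simp add: algebra_simps)
    ultimately have "h \<le> B * real k + A"
      unfolding B_def using log_bound_at_extremal[OF p c t1(1) h far near] by auto
    also have "\<dots> \<le> B * (log 2 x + 1) + A" using k B by (intro add_right_mono mult_left_mono) auto
    finally have "h \<le> B * log 2 (a * h + b) + (B + A)" unfolding x_def by (simp add: algebra_simps)
    then have "h \<le> H" using H h by blast
    then show ?thesis using near[OF t] by force
  qed
  show ?thesis by (intro exI[of _ "max 0 H + 1"]) (use main in auto)
qed

end

section \<open>Betweenness and hyperbolicity pass from \<open>D\<close> to a distance that it
  coarsely dominates\<close>

context geodesic_hyperbolic
begin

text \<open>Coarse betweenness for \<open>D\<close> puts \<open>m\<close> near a point of a
  \<open>D\<close>-geodesic, where \<open>B\<close> applies; \<open>d_le\<close> converts the error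
  K + \<delta>, which is paid once on each side of \<open>m\<close>.\<close>

lemma coarse_between_transfer:
  assumes d_sym: "\<And>x y. d x y = d y x"
    and d_tri: "\<And>x y z. \<lbrakk>x\<in>Y; y\<in>Y; z\<in>Y\<rbrakk> \<Longrightarrow> d x z \<le> d x y + d y z"
    and d_le: "\<And>x y. \<lbrakk>x\<in>Y; y\<in>Y\<rbrakk> \<Longrightarrow> d x y \<le> A * D x y + A" and A: "A \<ge> 0"
    and B: "\<And>c L t. \<lbrakk>geod Y D c L; t \<in> {0..L}\<rbrakk> \<Longrightarrow> d (c 0) (c t) + d (c t) (c L) \<le> d (c 0) (c L) + H"
    and xyz: "x \<in> Y" "m \<in> Y" "y \<in> Y" and K: "D x m + D m y \<le> D x y + K"
  shows "d x m + d m y \<le> d x y + (H + 2 * (A * (K + \<delta>) + A))"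
proof -
  obtain c where c: "geod Y D c (D x y)" "c 0 = x" "c (D x y) = y" using geod_exists xyz by blast
  obtain t where t: "t \<in> {0..D x y}" "D m (c t) \<le> K + \<delta>"
    using near_geodesic[OF c(1), of m K] c xyz K by auto
  have ct: "c t \<in> Y" using geod_in[OF c(1) t(1)] .
  define q where "q = A * (K + \<delta>) + A"
  have "A * D m (c t) \<le> A * (K + \<delta>)" using t A by (intro mult_left_mono) auto
  then have "d m (c t) \<le> q" using d_le[OF xyz(2) ct] unfolding q_def by (smt (verit))
  moreover have "d x (c t) + d (c t) y \<le> d x y + H" using B[OF c(1) t(1)] c by auto
  ultimately show ?thesis
    using d_tri[OF xyz(1) ct xyz(2)] d_tri[OF xyz(2) ct xyz(3)] d_sym[of m "c t"]
    unfolding q_def[symmetric] by linarith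
qed

text \<open>The centre \<open>m\<close> of a \<open>D\<close>-triangle \<open>x z w\<close> is also coarsely a centre for \<open>d\<close>, and it lies
  coarsely between \<open>x, y\<close> or between \<open>y, z\<close>.\<close>

lemma gromov_hyperbolic_transfer:
  assumes d_sym: "\<And>x y. d x y = d y x"
    and d_tri: "\<And>x y z. \<lbrakk>x\<in>Y; y\<in>Y; z\<in>Y\<rbrakk> \<Longrightarrow> d x z \<le> d x y + d y z"
    and btw: "\<And>x m y. \<lbrakk>x\<in>Y; m\<in>Y; y\<in>Y; D x m + D m y \<le> D x y + \<delta>\<rbrakk> \<Longrightarrow> d x m + d m y \<le> d x y + C"
    and C: "C \<ge> 0"
  shows "gromov_hyperbolic Y d"
  unfolding gromov_hyperbolic_def
proof (intro exI[of _ "2 * C"] conjI ballI)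
  show "0 \<le> 2 * C" using C by simp
  fix x y z w assume Y: "x \<in> Y" "y \<in> Y" "z \<in> Y" "w \<in> Y"
  obtain c where c: "geod Y D c (D x z)" "c 0 = x" "c (D x z) = z" using geod_exists Y by blast
  \<comment> \<open>The Gromov product of \<open>z\<close> and \<open>w\<close> seen from
    \<open>x\<close>: at \<open>m\<close> the geodesics from \<open>x\<close> to \<open>z\<close>
    and to \<open>w\<close> separate.\<close>
  define t where "t = (D x z + D x w - D z w) / 2"
  have t: "t \<in> {0..D x z}"
    using triangle[OF Y(3,1,4)] triangle[OF Y(1,3,4)] commute[of z x] unfolding t_def by auto
  define m where "m = c t"
  have m: "m \<in> Y" unfolding m_def by (rule geod_in[OF c(1) t])
  have D: "D x m = t" "D m z = D x z - t"
    using geod_dist[OF c(1), of 0 t] geod_dist[OF c(1), of t "D x z"] c t unfolding m_def by auto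
  have mseg: "m \<in> seg x z" using m D by (auto simp: seg_def)
  have "D w m + D x z \<le> max (D w x + D m z) (D w z + D x m) + \<delta>"
    using four_point[OF Y(4,1) m Y(3)] .
  then have wm: "D w m \<le> (D w x + D w z - D x z) / 2 + \<delta>"
    using D commute[of w x] commute[of w z] unfolding t_def by (simp add: field_simps)
  have "D w m + D m x \<le> D w x + \<delta>" "D w m + D m z \<le> D w z + \<delta>"
    using wm D commute[of m x] commute[of w x] commute[of w z] unfolding t_def by (auto simp: field_simps)
  then have b: "d w m + d m x \<le> d w x + C" "d w m + d m z \<le> d w z + C"
    using btw[OF Y(4) m Y(1)] btw[OF Y(4) m Y(3)] by auto
  \<comment> \<open>All three Gromov products at \<open>w\<close> are now compared with the single
    number \<open>d w m\<close>: this one is at least \<open>d w m - C\<close>, and one of the other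
    two is at most \<open>d w m + C\<close>.\<close>
  have xz: "gromov_product d w x z \<ge> d w m - C"
    using b d_tri[OF Y(1) m Y(3)] d_sym[of x w] d_sym[of z w] d_sym[of x m]
    unfolding gromov_product_def by simp
  have "d x m + d m y \<le> d x y + C \<or> d y m + d m z \<le> d y z + C"
    using seg_triangle_between[OF Y(1,2,3) mseg] btw[OF Y(1) m Y(2)] btw[OF Y(2) m Y(3)] by auto
  then have "gromov_product d w x y \<le> d w m + C \<or> gromov_product d w y z \<le> d w m + C"
    using d_tri[OF Y(1) m Y(4)] d_tri[OF Y(2) m Y(4)] d_tri[OF Y(3) m Y(4)]
      d_sym[of m w] d_sym[of m y] d_sym[of m z] C
    unfolding gromov_product_def by auto
  then show "min (gromov_product d w x y) (gromov_product d w y z) - 2 * C \<le> gromov_product d w x z"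
    using xz by linarith
qed

end

section \<open>The hyperbolic plane\<close>

abbreviation hD :: "complex \<Rightarrow> complex \<Rightarrow> real" where "hD \<equiv> hyp_dist"

lemma hyp_planeI [simp]: "z \<in> hyp_plane \<longleftrightarrow> Im z > 0"
  by (simp add: hyp_plane_def)

lemma open_hyp_plane: "open hyp_plane"
  unfolding hyp_plane_def by (rule open_halfspace_Im_gt)

lemma convex_hyp_plane: "convex hyp_plane"
  unfolding hyp_plane_def by (rule convex_halfspace_Im_gt)

lemma hyp_arg_ge_1:
  assumes "Im z > 0" "Im w > 0"
  shows "1 + (cmod (z - w))\<^sup>2 / (2 * Im z * Im w) \<ge> 1"
  using assms by simp

lemma cosh_hyp_dist:
  assumes "Im z > 0" "Im w > 0"
  shows "cosh (hD z w) = 1 + (cmod (z - w))\<^sup>2 / (2 * Im z * Im w)"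
  unfolding hyp_dist_def by (rule cosh_arcosh_real) (rule hyp_arg_ge_1[OF assms])

lemma hyp_dist_nonneg: "Im z > 0 \<Longrightarrow> Im w > 0 \<Longrightarrow> hD z w \<ge> 0"
  unfolding hyp_dist_def by (rule arcosh_nonneg_real) (rule hyp_arg_ge_1)

lemma hyp_dist_self [simp]: "hD z z = 0"
  by (simp add: hyp_dist_def)

lemma hyp_dist_commute: "hD z w = hD w z"
  unfolding hyp_dist_def by (simp add: norm_minus_commute mult.commute mult.left_commute)

lemma hyp_dist_eqI:
  assumes "Im z > 0" "Im w > 0" "r \<ge> 0" "1 + (cmod (z - w))\<^sup>2 / (2 * Im z * Im w) = cosh r"
  shows "hD z w = r"
  unfolding hyp_dist_def assms(4) using assms(3) by (simp add: arcosh_cosh_real)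

lemma hyp_dist_eq_0_iff: "Im z > 0 \<Longrightarrow> Im w > 0 \<Longrightarrow> hD z w = 0 \<longleftrightarrow> z = w"
proof
  assume "Im z > 0" "Im w > 0" "hD z w = 0"
  then have "(cmod (z - w))\<^sup>2 / (2 * Im z * Im w) = 0" using cosh_hyp_dist[of z w] by simp
  then show "z = w" using \<open>Im z > 0\<close> \<open>Im w > 0\<close> by simp
qed (simp add: hyp_dist_def)

lemma cosh_ln_diff:
  assumes "a > 0" "b > (0::real)"
  shows "cosh (ln a - ln b) = 1 + (a - b)\<^sup>2 / (2 * a * b)"
proof -
  have "cosh (ln a - ln b) = (a / b + b / a) / 2"
    using assms by (simp add: cosh_def exp_diff exp_minus)
  then show ?thesis using assms by (simp add: field_simps power2_eq_square)
qed

lemma hyp_dist_ge_ln_Im: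
  assumes "Im z > 0" "Im w > 0"
  shows "\<bar>ln (Im z) - ln (Im w)\<bar> \<le> hD z w"
proof -
  have "(Im z - Im w)\<^sup>2 \<le> (cmod (z - w))\<^sup>2"
    by (simp add: cmod_power2)
  then have "cosh \<bar>ln (Im z) - ln (Im w)\<bar> \<le> cosh (hD z w)"
    using assms by (simp add: cosh_hyp_dist cosh_ln_diff divide_right_mono)
  then show ?thesis using hyp_dist_nonneg[OF assms] by (subst (asm) cosh_real_nonneg_le_iff) auto
qed

lemma Im_le_exp_hyp_dist:
  assumes "Im z > 0" "Im w > 0"
  shows "Im w \<le> exp (hD z w) * Im z"
proof -
  have "ln (Im w) \<le> hD z w + ln (Im z)" using hyp_dist_ge_ln_Im[OF assms] by linarith
  then have "exp (ln (Im w)) \<le> exp (hD z w + ln (Im z))" by simp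
  then show ?thesis using assms by (simp add: exp_add)
qed

text \<open>A hyperbolic ball of fixed radius has Euclidean size proportional to the height of its
  centre. This gives the comparison of topologies, and later the convergence of neighbourhoods of a
  line to its ends.\<close>

lemma cmod_le_hyp_dist:
  assumes "Im z > 0" "Im w > 0" "hD z w \<le> K"
  shows "(cmod (z - w))\<^sup>2 \<le> 2 * exp K * (cosh K - 1) * (Im z)\<^sup>2"
proof -
  have D0: "hD z w \<ge> 0" using hyp_dist_nonneg assms by auto
  then have cK: "cosh (hD z w) \<le> cosh K" using assms by (subst cosh_real_nonneg_le_iff) auto
  have "(cmod (z - w))\<^sup>2 = 2 * Im z * Im w * (cosh (hD z w) - 1)"
    using assms by (simp add: cosh_hyp_dist)
  also have "\<dots> \<le> 2 * Im z * (exp K * Im z) * (cosh K - 1)"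
  proof (intro mult_mono mult_nonneg_nonneg)
    have "Im w \<le> exp (hD z w) * Im z" using Im_le_exp_hyp_dist assms by auto
    also have "\<dots> \<le> exp K * Im z" using assms by auto
    finally show "Im w \<le> exp K * Im z" .
  qed (use assms cK cosh_real_ge_1[of "hD z w"] in auto)
  finally show ?thesis by (simp add: power2_eq_square mult_ac)
qed

lemma continuous_on_hyp_dist: "z \<in> hyp_plane \<Longrightarrow> continuous_on hyp_plane (hD z)"
  unfolding hyp_dist_def
  by (rule continuous_on_compose2[OF continuous_on_arcosh[OF order.refl]])
    (auto intro!: continuous_intros)

lemma hyp_dist_small:
  assumes "Im z > 0" "e > 0"
  shows "\<exists>\<delta>>0. \<forall>w. Im w > 0 \<and> hD z w < \<delta> \<longrightarrow> cmod (z - w) < e"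
proof -
  have "((\<lambda>K. 2 * exp K * (cosh K - 1) * (Im z)\<^sup>2) \<longlongrightarrow> 2 * exp 0 * (cosh 0 - 1) * (Im z)\<^sup>2) (at_right (0::real))"
    by (intro tendsto_intros)
  then have "\<forall>\<^sub>F K in at_right (0::real). 2 * exp K * (cosh K - 1) * (Im z)\<^sup>2 < e\<^sup>2"
    using assms by (intro order_tendstoD) auto
  then obtain b where b: "b > 0" "\<forall>K>0. K < b \<longrightarrow> 2 * exp K * (cosh K - 1) * (Im z)\<^sup>2 < e\<^sup>2"
    unfolding eventually_at_right_field by auto
  have "cmod (z - w) < e" if "Im w > 0" "hD z w < b / 2" for w
  proof -
    have "(cmod (z - w))\<^sup>2 \<le> 2 * exp (b/2) * (cosh (b/2) - 1) * (Im z)\<^sup>2"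
      using cmod_le_hyp_dist[of z w "b/2"] assms that by auto
    also have "\<dots> < e\<^sup>2" using b by auto
    finally show ?thesis using assms by (simp add: power2_less_imp_less)
  qed
  then show ?thesis using b by (intro exI[of _ "b/2"]) auto
qed

definition hball :: "complex \<Rightarrow> real \<Rightarrow> complex set" where
  "hball q r = {w\<in>hyp_plane. hD q w < r}"

lemma open_hball: "q \<in> hyp_plane \<Longrightarrow> open (hball q r)"
proof -
  assume q: "q \<in> hyp_plane"
  have "openin (top_of_set hyp_plane) (hyp_plane \<inter> hD q -` {..<r})"
    by (intro continuous_openin_preimage_gen continuous_on_hyp_dist[OF q]) auto
  moreover have "hyp_plane \<inter> hD q -` {..<r} = hball q r" by (auto simp: hball_def)
  ultimately show ?thesis using openin_open_eq[OF open_hyp_plane] by simp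
qed

text \<open>Three points on a horizontal Euclidean line suffice: the second difference of the
  squared distances yields \<open>Im a = Im b\<close>, then the first difference yields the real
  parts. Charts are compared through this in \<open>chart_agree\<close>.\<close>

lemma hyp_dist_determines:
  assumes "Im a > 0" "Im b > 0" "open V" "V \<noteq> {}" "V \<subseteq> hyp_plane" "\<And>u. u \<in> V \<Longrightarrow> hD a u = hD b u"
  shows "a = b"
proof -
  obtain u0 where u0: "u0 \<in> V" using assms by blast
  obtain e where e: "e > 0" "ball u0 e \<subseteq> V" using assms u0 openE by blast
  define h where "h = e / 2"
  have h: "h > 0" unfolding h_def using e by simp
  have V: "u0 + of_real h \<in> V" "u0 - of_real h \<in> V"
    using e h by (auto intro!: subsetD[OF e(2)] simp: dist_norm h_def)
  have eq: "Im b * (cmod (a - u))\<^sup>2 = Im a * (cmod (b - u))\<^sup>2" if "u \<in> V" for u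
  proof -
    have u: "Im u > 0" using that assms by auto
    have "(cmod (a - u))\<^sup>2 / (2 * Im a * Im u) = (cmod (b - u))\<^sup>2 / (2 * Im b * Im u)"
      using cosh_hyp_dist[of a u] cosh_hyp_dist[of b u] assms that u by simp
    then show ?thesis using u assms by (simp add: field_simps)
  qed
  have e1: "Im b * ((Re a - Re u0)\<^sup>2 + (Im a - Im u0)\<^sup>2) = Im a * ((Re b - Re u0)\<^sup>2 + (Im b - Im u0)\<^sup>2)"
    and e2: "Im b * ((Re a - Re u0 - h)\<^sup>2 + (Im a - Im u0)\<^sup>2) = Im a * ((Re b - Re u0 - h)\<^sup>2 + (Im b - Im u0)\<^sup>2)"
    and e3: "Im b * ((Re a - Re u0 + h)\<^sup>2 + (Im a - Im u0)\<^sup>2) = Im a * ((Re b - Re u0 + h)\<^sup>2 + (Im b - Im u0)\<^sup>2)"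
    using eq[OF u0] eq[OF V(1)] eq[OF V(2)] by (simp_all add: cmod_power2 algebra_simps)
  have "Im b * (2 * h\<^sup>2) = Im a * (2 * h\<^sup>2)"
    using e1 e2 e3 by algebra
  then have Im: "Im a = Im b" using h by simp
  then have "(Re a - Re u0 - h)\<^sup>2 - (Re a - Re u0 + h)\<^sup>2 = (Re b - Re u0 - h)\<^sup>2 - (Re b - Re u0 + h)\<^sup>2"
    using e2 e3 assms by simp
  then have "4 * h * (Re a - Re b) = 0" by algebra
  then show ?thesis using h Im by (simp add: complex_eq_iff)
qed

subsection \<open>Moebius transformations\<close>

definition mob :: "real \<Rightarrow> real \<Rightarrow> real \<Rightarrow> real \<Rightarrow> complex \<Rightarrow> complex" where
  "mob a b c d z = (of_real a * z + of_real b) / (of_real c * z + of_real d)"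

definition is_mob :: "(complex \<Rightarrow> complex) \<Rightarrow> bool" where
  "is_mob f \<longleftrightarrow> (\<exists>a b c d. a * d - b * c > 0 \<and> (\<forall>z\<in>hyp_plane. f z = mob a b c d z))"

text \<open>The full isometry group, including reflections, which occur as holonomy of
  non-orientable surfaces.\<close>

definition hyp_isom :: "(complex \<Rightarrow> complex) \<Rightarrow> bool" where
  "hyp_isom f \<longleftrightarrow> bij_betw f hyp_plane hyp_plane \<and> (\<forall>z\<in>hyp_plane. \<forall>w\<in>hyp_plane. hD (f z) (f w) = hD z w)"

lemma mob_denom_nz:
  assumes "a * d - b * c > 0" "Im z > 0"
  shows "of_real c * z + of_real d \<noteq> (0::complex)"
proof
  assume "of_real c * z + of_real d = (0::complex)"
  then have "c * Im z = 0" "c * Re z + d = 0" by (auto simp: complex_eq_iff)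
  then show False using assms by auto
qed

lemma mob_frac:
  assumes "Z \<noteq> 0"
  shows "mob a b c d (N / Z) = (of_real a * N + of_real b * Z) / (of_real c * N + of_real d * Z)"
proof -
  have "of_real a * (N / Z) + of_real b = (of_real a * N + of_real b * Z) / Z"
    "of_real c * (N / Z) + of_real d = (of_real c * N + of_real d * Z) / Z"
    using assms by (simp_all add: add_divide_distrib)
  then show ?thesis using assms unfolding mob_def by simp
qed

lemma mob_Re_Im:
  shows "Im (mob a b c d z) = (a * d - b * c) * Im z / (cmod (of_real c * z + of_real d))\<^sup>2"
    and "Re (mob a b c d z) = (a * c * (cmod z)\<^sup>2 + (a * d + b * c) * Re z + b * d) / (cmod (of_real c * z + of_real d))\<^sup>2"
proof -
  have cm: "cmod z * cmod z = Re z * Re z + Im z * Im z"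
    using cmod_power2[of z] by (simp add: power2_eq_square)
  show "Im (mob a b c d z) = (a * d - b * c) * Im z / (cmod (of_real c * z + of_real d))\<^sup>2"
    "Re (mob a b c d z) = (a * c * (cmod z)\<^sup>2 + (a * d + b * c) * Re z + b * d) / (cmod (of_real c * z + of_real d))\<^sup>2"
    unfolding mob_def complex_div_cnj[of "of_real a * z + of_real b"]
    by (simp_all add: Im_divide_of_real Re_divide_of_real algebra_simps power2_eq_square cm
        flip: of_real_power)
qed

lemma mob_in: "a * d - b * c > 0 \<Longrightarrow> Im z > 0 \<Longrightarrow> Im (mob a b c d z) > 0"
  using mob_denom_nz[of a d b c z] by (simp add: mob_Re_Im)

lemma mob_dist:
  assumes "a * d - b * c > 0" "Im z > 0" "Im w > 0"
  shows "hD (mob a b c d z) (mob a b c d w) = hD z w"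
proof -
  let ?z = "of_real c * z + of_real d" and ?w = "of_real c * w + of_real d :: complex"
  note nz = mob_denom_nz[OF assms(1,2)] mob_denom_nz[OF assms(1,3)]
  have "mob a b c d z - mob a b c d w = of_real (a * d - b * c) * (z - w) / (?z * ?w)"
    unfolding mob_def using nz by (simp add: field_simps)
  then have m: "(cmod (mob a b c d z - mob a b c d w))\<^sup>2 =
    (a * d - b * c)\<^sup>2 * (cmod (z - w))\<^sup>2 / ((cmod ?z)\<^sup>2 * (cmod ?w)\<^sup>2)"
    using assms(1) by (simp add: norm_divide norm_mult power_divide power_mult_distrib del: of_real_diff of_real_mult)
  have x: "(D\<^sup>2 * m / (u * v)) / (2 * (D * p / u) * (D * q / v)) = m / (2 * p * q)"
    if "D > 0" "u > 0" "v > 0" "p > 0" "q > 0" for D m u v p q :: real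
    using that by (simp add: field_simps power2_eq_square)
  show ?thesis unfolding hyp_dist_def m mob_Re_Im
    by (subst x) (use assms nz in auto)
qed

lemma mob_inverse:
  assumes "a * d - b * c > 0" "Im z > 0"
  shows "mob d (-b) (-c) a (mob a b c d z) = z"
proof -
  let ?z = "of_real c * z + of_real d"
  note nz = mob_denom_nz[OF assms]
  have "mob d (-b) (-c) a (mob a b c d z) =
      (of_real d * (of_real a * z + of_real b) + of_real (- b) * ?z) /
      (of_real (- c) * (of_real a * z + of_real b) + of_real a * ?z)"
    unfolding mob_def[of a b c d] by (rule mob_frac[OF nz])
  also have "\<dots> = (of_real (a * d - b * c) * z) / of_real (a * d - b * c)"
    by (simp add: algebra_simps)
  also have "\<dots> = z" using assms by (simp del: of_real_diff of_real_mult)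
  finally show ?thesis .
qed

lemma hyp_isom_comp: "hyp_isom f \<Longrightarrow> hyp_isom g \<Longrightarrow> hyp_isom (\<lambda>z. g (f z))"
  unfolding hyp_isom_def
  using bij_betw_trans[of f hyp_plane hyp_plane g hyp_plane] bij_betwE[of f hyp_plane hyp_plane]
  by (simp add: comp_def)

lemma hyp_isom_in: "hyp_isom f \<Longrightarrow> Im z > 0 \<Longrightarrow> Im (f z) > 0"
  unfolding hyp_isom_def bij_betw_def by force

lemma hyp_isom_dist: "hyp_isom f \<Longrightarrow> Im z > 0 \<Longrightarrow> Im w > 0 \<Longrightarrow> hD (f z) (f w) = hD z w"
  unfolding hyp_isom_def by simp

lemma hyp_isom_inverse:
  assumes "hyp_isom f"
  obtains g where "hyp_isom g" "\<And>z. Im z > 0 \<Longrightarrow> g (f z) = z" "\<And>z. Im z > 0 \<Longrightarrow> f (g z) = z"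
proof
  let ?g = "inv_into hyp_plane f"
  have b: "bij_betw f hyp_plane hyp_plane" using assms by (simp add: hyp_isom_def)
  show 1: "?g (f z) = z" "f (?g z) = z" if "Im z > 0" for z
    using bij_betw_inv_into_left[OF b, of z] bij_betw_inv_into_right[OF b, of z] that by simp_all
  have "bij_betw ?g hyp_plane hyp_plane" using b by (rule bij_betw_inv_into)
  moreover have "hD (?g z) (?g w) = hD z w" if "z \<in> hyp_plane" "w \<in> hyp_plane" for z w
  proof -
    have "?g z \<in> hyp_plane" "?g w \<in> hyp_plane" using calculation that bij_betwE by blast+
    then show ?thesis using hyp_isom_dist[OF assms, of "?g z" "?g w"] 1 that by simp
  qed
  ultimately show "hyp_isom ?g" unfolding hyp_isom_def by blast
qed

lemma hyp_isom_mob: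
  assumes "is_mob f" shows "hyp_isom f"
proof -
  obtain a b c d where abcd: "a * d - b * c > 0" "\<forall>z\<in>hyp_plane. f z = mob a b c d z"
    using assms unfolding is_mob_def by blast
  have 2: "d * a - (- b) * (- c) > 0" using abcd by (simp add: mult.commute)
  have "bij_betw (mob a b c d) hyp_plane hyp_plane"
  proof (rule bij_betw_byWitness[of _ "mob d (-b) (-c) a"])
    show "\<forall>z\<in>hyp_plane. mob d (- b) (- c) a (mob a b c d z) = z" using mob_inverse abcd by auto
    show "\<forall>z\<in>hyp_plane. mob a b c d (mob d (- b) (- c) a z) = z" using mob_inverse[OF 2] by auto
    show "mob a b c d ` hyp_plane \<subseteq> hyp_plane" using mob_in[OF abcd(1)] by auto
    show "mob d (- b) (- c) a ` hyp_plane \<subseteq> hyp_plane" using mob_in[OF 2] by auto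
  qed
  then have "bij_betw f hyp_plane hyp_plane" using bij_betw_cong[of hyp_plane f] abcd by auto
  then show ?thesis unfolding hyp_isom_def using mob_dist[OF abcd(1)] abcd by auto
qed

lemma is_mob_comp:
  assumes "is_mob f" "is_mob g" shows "is_mob (\<lambda>z. g (f z))"
proof -
  obtain a b c d where 1: "a * d - b * c > 0" "\<forall>z\<in>hyp_plane. f z = mob a b c d z"
    using assms unfolding is_mob_def by blast
  obtain a' b' c' d' where 2: "a' * d' - b' * c' > 0" "\<forall>z\<in>hyp_plane. g z = mob a' b' c' d' z"
    using assms unfolding is_mob_def by blast
  have "g (f z) = mob (a' * a + b' * c) (a' * b + b' * d) (c' * a + d' * c) (c' * b + d' * d) z" if "z \<in> hyp_plane" for z
  proof -
    have z: "Im z > 0" "Im (mob a b c d z) > 0" using that mob_in 1 by auto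
    note nz = mob_denom_nz[OF 1(1) z(1)] mob_denom_nz[OF 2(1) z(2)]
    have "g (f z) = mob a' b' c' d' (mob a b c d z)" using 1 2 z by simp
    also have "\<dots> = (of_real a' * (of_real a * z + of_real b) + of_real b' * (of_real c * z + of_real d)) /
       (of_real c' * (of_real a * z + of_real b) + of_real d' * (of_real c * z + of_real d))"
      unfolding mob_def[of a b c d] by (rule mob_frac[OF nz(1)])
    also have "\<dots> = mob (a' * a + b' * c) (a' * b + b' * d) (c' * a + d' * c) (c' * b + d' * d) z"
      unfolding mob_def by (simp add: algebra_simps)
    finally show ?thesis .
  qed
  moreover have "(a' * a + b' * c) * (c' * b + d' * d) - (a' * b + b' * d) * (c' * a + d' * c) = (a' * d' - b' * c') * (a * d - b * c)"
    by algebra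
  ultimately show ?thesis unfolding is_mob_def using 1(1) 2(1) by (metis mult_pos_pos)
qed

lemma hyp_isom_reflect: "hyp_isom (\<lambda>z. - cnj z)"
proof -
  have "bij_betw (\<lambda>z. - cnj z) hyp_plane hyp_plane"
    by (rule bij_betw_byWitness[of _ "\<lambda>z. - cnj z"]) auto
  moreover have "cmod (- cnj z - - cnj w) = cmod (z - w)" for z w
    by (metis complex_cnj_diff complex_mod_cnj minus_diff_minus norm_minus_cancel)
  ultimately show ?thesis unfolding hyp_isom_def hyp_dist_def by auto
qed

section \<open>The imaginary axis as model geodesic, normal forms, and hyperbolicity of the
  plane\<close>

definition vert :: "real \<Rightarrow> complex" where "vert t = Complex 0 (exp t)"

lemma vert_simps [simp]: "Re (vert t) = 0" "Im (vert t) = exp t"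
  by (simp_all add: vert_def)

lemma vert_dist: "hD (vert s) (vert t) = \<bar>s - t\<bar>"
proof (rule hyp_dist_eqI)
  show "1 + (cmod (vert s - vert t))\<^sup>2 / (2 * Im (vert s) * Im (vert t)) = cosh \<bar>s - t\<bar>"
    using cosh_ln_diff[of "exp s" "exp t"] by (simp add: cmod_power2)
qed auto

lemma cosh_dist_vert:
  assumes "Im w > 0"
  shows "cosh (hD (vert s) w) = ((cmod w)\<^sup>2 * exp (- s) + exp s) / (2 * Im w)"
proof -
  have "cosh (hD (vert s) w) = 1 + ((Re w)\<^sup>2 + (exp s - Im w)\<^sup>2) / (2 * exp s * Im w)"
    using assms by (simp add: cosh_hyp_dist cmod_power2)
  then show ?thesis unfolding cmod_power2 exp_minus using assms
    by (simp add: field_simps power2_eq_square)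
qed

text \<open>By \<open>cosh_dist_vert\<close> each distance condition is an equation linear in |w|^2
  and \<open>Im w\<close>. Subtracting the two leaves \<open>Im w = exp t\<close>, and then |w| =
  \<open>exp t\<close> forces the real part to vanish.\<close>

lemma vert_unique:
  assumes w: "Im w > 0" and ss: "s \<noteq> s'" and d: "hD (vert s) w = \<bar>t - s\<bar>" "hD (vert s') w = \<bar>t - s'\<bar>"
  shows "w = vert t"
proof -
  have eq: "(cmod w)\<^sup>2 + (exp s)\<^sup>2 = Im w * (exp t + (exp s)\<^sup>2 / exp t)" if "hD (vert s) w = \<bar>t - s\<bar>" for s
  proof -
    have 1: "(cmod w)\<^sup>2 / exp s + exp s = Im w * (2 * cosh (t - s))"
      using cosh_dist_vert[OF w, of s] w unfolding that cosh_real_abs exp_minus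
      by (simp add: field_simps)
    have 2: "2 * cosh (t - s) = exp t / exp s + exp s / exp t"
      by (simp add: cosh_field_def exp_diff mult.commute)
    have x: "c + a\<^sup>2 = I * (b + a\<^sup>2 / b)" if "c / a + a = I * (b / a + a / b)" "a > 0" "b > 0" for a b c I :: real
    proof -
      have "(c / a + a) * a = I * (b / a + a / b) * a" using that by simp
      then show ?thesis using that by (simp add: algebra_simps power2_eq_square)
    qed
    show ?thesis by (rule x) (use 1 2 in auto)
  qed
  have "(exp s)\<^sup>2 \<noteq> (exp s')\<^sup>2" using ss by simp
  moreover have "((exp s)\<^sup>2 - (exp s')\<^sup>2) * exp t = Im w * ((exp s)\<^sup>2 - (exp s')\<^sup>2)"
    using eq[OF d(1)] eq[OF d(2)] by (simp add: field_simps)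
  ultimately have Im: "Im w = exp t" by (simp add: mult.commute)
  then have "(cmod w)\<^sup>2 = (exp t)\<^sup>2" using eq[OF d(1)] by (simp add: field_simps power2_eq_square)
  then have "Re w = 0" using Im by (simp add: cmod_power2)
  then show ?thesis using Im by (simp add: complex_eq_iff)
qed

lemma mob_to_i:
  assumes "Im x > 0" shows "\<exists>f. is_mob f \<and> f x = \<i>"
proof -
  have "is_mob (mob 1 (- Re x) 0 (Im x))" unfolding is_mob_def using assms
    by (intro exI[of _ 1] exI[of _ "- Re x"] exI[of _ 0] exI[of _ "Im x"]) auto
  moreover have "mob 1 (- Re x) 0 (Im x) x = \<i>" unfolding mob_def
    using assms by (simp add: complex_eq_iff)
  ultimately show ?thesis by blast
qed

lemma mob_rotate_to_vert:
  assumes y: "Im y > 0" "y \<noteq> \<i>"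
  shows "\<exists>f. is_mob f \<and> f \<i> = \<i> \<and> Re (f y) = 0"
proof -
  \<comment> \<open>The rotation about \<open>\<i>\<close> with matrix (p, q; -q, p) sends
    \<open>y\<close> to the imaginary axis when (p + iq)^2 = v; the complex square root thus
    supplies the half angle.\<close>
  define v where "v = Complex (((cmod y)\<^sup>2 - 1) / 2) (Re y)"
  have "v \<noteq> 0"
  proof
    assume "v = 0"
    then have "Re y = 0" "(cmod y)\<^sup>2 = 1" by (auto simp: v_def complex_eq_iff)
    then have "Im y = 1" using y by (auto simp: cmod_power2 power2_eq_1_iff)
    then show False using y \<open>Re y = 0\<close> by (auto simp: complex_eq_iff)
  qed
  define u where "u = csqrt v"
  have uu: "u * u = v" unfolding u_def using power2_csqrt[of v] by (simp add: power2_eq_square)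
  define p q where "p = Re u" and "q = Im u"
  have pq: "p * p - q * q = ((cmod y)\<^sup>2 - 1) / 2" "2 * p * q = Re y"
    using arg_cong[OF uu, of Re] arg_cong[OF uu, of Im] unfolding v_def p_def q_def by (auto simp: mult_ac)
  have pos: "p * p + q * q > 0"
  proof -
    have "u \<noteq> 0" using uu \<open>v \<noteq> 0\<close> by auto
    then show ?thesis unfolding p_def q_def by (simp add: sum_squares_gt_zero_iff complex_eq_iff)
  qed
  let ?f = "mob p q (- q) p"
  have "is_mob ?f" unfolding is_mob_def using pos
    by (intro exI[of _ p] exI[of _ q] exI[of _ "-q"] exI[of _ p]) auto
  moreover have "?f \<i> = \<i>"
  proof -
    have "of_real (-q) * \<i> + of_real p \<noteq> (0::complex)" using pos by (auto simp: complex_eq_iff)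
    then show ?thesis unfolding mob_def by (simp add: field_simps)
  qed
  moreover have "p * (- q) * (cmod y)\<^sup>2 + (p * p + q * (- q)) * Re y + q * p = 0"
    using pq by algebra
  then have "Re (?f y) = 0" by (simp add: mob_Re_Im)
  ultimately show ?thesis by blast
qed

lemma mob_normal_form:
  assumes "Im x > 0" "Im y > 0"
  shows "\<exists>f. is_mob f \<and> f x = vert 0 \<and> f y = vert (hD x y)"
proof -
  have i: "\<i> = vert 0" by (simp add: complex_eq_iff)
  obtain f1 where f1: "is_mob f1" "f1 x = \<i>" using mob_to_i assms by blast
  note g1 = hyp_isom_mob[OF f1(1)]
  show ?thesis
  proof (cases "x = y")
    case True
    then show ?thesis using f1 by (intro exI[of _ f1]) (simp add: i)
  next
    case False
    then have "f1 y \<noteq> \<i>"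
      using hyp_isom_dist[OF g1 assms] f1(2) hyp_dist_eq_0_iff[OF assms] by auto
    then obtain f2 where f2: "is_mob f2" "f2 \<i> = \<i>" "Re (f2 (f1 y)) = 0"
      using mob_rotate_to_vert[of "f1 y"] hyp_isom_in[OF g1 assms(2)] by blast
    define f3 where "f3 z = f2 (f1 z)" for z
    have f3: "is_mob f3" unfolding f3_def using is_mob_comp f1 f2 by blast
    note g3 = hyp_isom_mob[OF f3]
    define t where "t = ln (Im (f3 y))"
    have y3: "f3 y = vert t" using f2(3) hyp_isom_in[OF g3 assms(2)] unfolding t_def f3_def
      by (simp add: complex_eq_iff)
    have x3: "f3 x = vert 0" using f2 f1 i by (simp add: f3_def)
    have t: "\<bar>t\<bar> = hD x y" using hyp_isom_dist[OF g3 assms] x3 y3 vert_dist by simp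
    show ?thesis
    proof (cases "t \<ge> 0")
      case True
      then show ?thesis using f3 x3 y3 t by auto
    next
      case False
      \<comment> \<open>The half turn z -> -1/z about \<open>\<i>\<close> moves the image of
        \<open>y\<close> to the upper side.\<close>
      have m: "is_mob (mob 0 (-1) 1 0)" unfolding is_mob_def
        by (intro exI[of _ 0] exI[of _ "-1"] exI[of _ 1] exI[of _ 0]) auto
      have "mob 0 (-1) 1 0 (vert s) = vert (- s)" for s
        by (simp add: mob_def complex_eq_iff Re_divide Im_divide exp_minus power2_eq_square field_simps)
      then show ?thesis using is_mob_comp[OF f3 m] x3 y3 t False
        by (intro exI[of _ "\<lambda>z. mob 0 (-1) 1 0 (f3 z)"]) auto
    qed
  qed
qed

text \<open>ln Im is 1-Lipschitz for \<open>hD\<close> and measures distances exactly on the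
  imaginary axis, to which \<open>x\<close> and \<open>z\<close> can be moved.\<close>

lemma hyp_dist_triangle:
  assumes "Im x > 0" "Im y > 0" "Im z > 0"
  shows "hD x z \<le> hD x y + hD y z"
proof -
  obtain f where f: "is_mob f" "f x = vert 0" "f z = vert (hD x z)"
    using mob_normal_form assms by blast
  note g = hyp_isom_mob[OF f(1)]
  have "\<bar>ln (Im (f x)) - ln (Im (f y))\<bar> \<le> hD x y" "\<bar>ln (Im (f y)) - ln (Im (f z))\<bar> \<le> hD y z"
    using hyp_dist_ge_ln_Im[of "f x" "f y"] hyp_dist_ge_ln_Im[of "f y" "f z"]
      hyp_isom_in[OF g] hyp_isom_dist[OF g] assms by simp_all
  then show ?thesis using f by simp
qed

lemma exp_half_hyp_dist:
  assumes "Im x > 0" "Im y > 0"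
  shows "exp (hD x y / 2) - exp (- (hD x y / 2)) = cmod (x - y) / sqrt (Im x * Im y)"
proof -
  let ?h = "hD x y / 2"
  have "cosh (2 * ?h) = 1 + (cmod (x - y))\<^sup>2 / (2 * Im x * Im y)"
    using cosh_hyp_dist[OF assms] by simp
  moreover have "cosh (2 * ?h) = 2 * (sinh ?h)\<^sup>2 + 1"
    using cosh_double[of ?h] by (simp add: cosh_square_eq)
  ultimately have "(2 * sinh ?h)\<^sup>2 = (cmod (x - y))\<^sup>2 / (Im x * Im y)"
    by (simp add: power_mult_distrib)
  also have "\<dots> = (cmod (x - y) / sqrt (Im x * Im y))\<^sup>2"
    using assms by (simp add: power_divide)
  finally have "2 * sinh ?h = cmod (x - y) / sqrt (Im x * Im y)"
    using assms hyp_dist_nonneg[OF assms] by (subst (asm) power2_eq_iff_nonneg) auto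
  moreover have "2 * sinh ?h = exp ?h - exp (- ?h)" by (simp add: sinh_field_def)
  ultimately show ?thesis by simp
qed

text \<open>Ptolemy's inequality for the function \<open>2 sinh (d / 2)\<close>.\<close>

lemma hyp_four_point:
  assumes "Im x > 0" "Im y > 0" "Im z > 0" "Im w > 0"
  shows "hD x z + hD y w \<le> max (hD x y + hD z w) (hD x w + hD y z) + 2 * ln 5"
proof -
  define s where "s a b = cmod (a - b) / sqrt (Im a * Im b)" for a b
  have s: "s a b = exp (hD a b / 2) - exp (- (hD a b / 2))" "s a b \<le> exp (hD a b / 2)"
    "exp (hD a b / 2) \<le> s a b + 1" "s a b \<ge> 0" if "Im a > 0" "Im b > 0" for a b
  proof -
    show 1: "s a b = exp (hD a b / 2) - exp (- (hD a b / 2))"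
      using exp_half_hyp_dist[OF that] unfolding s_def by simp
    have "exp (- (hD a b / 2)) \<le> 1" using hyp_dist_nonneg[OF that] by simp
    moreover have "exp (- (hD a b / 2)) > 0" by simp
    ultimately show "s a b \<le> exp (hD a b / 2)" "exp (hD a b / 2) \<le> s a b + 1"
      unfolding 1 by linarith+
    show "s a b \<ge> 0" unfolding s_def using that by simp
  qed
  define M where "M = max (hD x y + hD z w) (hD x w + hD y z)"
  have M0: "M \<ge> 0" unfolding M_def using hyp_dist_nonneg assms by (simp add: le_max_iff_disj)
  have xz: "hD x z \<le> M"
    using hyp_dist_triangle[of x y z] hyp_dist_triangle[of x w z] assms hyp_dist_commute[of z w]
    unfolding M_def by linarith
  have yw: "hD y w \<le> M"
    using hyp_dist_triangle[of y x w] hyp_dist_triangle[of y z w] assms hyp_dist_commute[of y x]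
    unfolding M_def by linarith
  have pt: "s x z * s y w \<le> s x y * s z w + s x w * s y z"
  proof -
    have "(x - z) * (y - w) = (x - y) * (z - w) + (x - w) * (y - z)" by algebra
    then have "cmod (x - z) * cmod (y - w) \<le> cmod (x - y) * cmod (z - w) + cmod (x - w) * cmod (y - z)"
      by (metis norm_mult norm_triangle_ineq)
    then have "cmod (x - z) * cmod (y - w) / sqrt (Im x * Im y * Im z * Im w) \<le>
      (cmod (x - y) * cmod (z - w) + cmod (x - w) * cmod (y - z)) / sqrt (Im x * Im y * Im z * Im w)"
      by (intro divide_right_mono) (use assms in auto)
    then show ?thesis unfolding s_def using assms
      by (simp add: real_sqrt_mult add_divide_distrib mult_ac)
  qed
  have e: "exp (hD a b / 2) * exp (hD c d / 2) \<le> exp (M / 2)" if "hD a b + hD c d \<le> M" for a b c d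
    using that by (simp flip: exp_add add_divide_distrib)
  have "s x y * s z w \<le> exp (hD x y / 2) * exp (hD z w / 2)"
    "s x w * s y z \<le> exp (hD x w / 2) * exp (hD y z / 2)"
    using s assms by (auto intro!: mult_mono)
  moreover have "exp (hD x y / 2) * exp (hD z w / 2) \<le> exp (M / 2)"
    "exp (hD x w / 2) * exp (hD y z / 2) \<le> exp (M / 2)"
    using e unfolding M_def by auto
  ultimately have "s x z * s y w \<le> 2 * exp (M / 2)" using pt by linarith
  moreover have "s x z \<le> exp (M / 2)" "s y w \<le> exp (M / 2)"
  proof -
    have "exp (hD x z / 2) \<le> exp (M / 2)" "exp (hD y w / 2) \<le> exp (M / 2)" using xz yw by auto
    then show "s x z \<le> exp (M / 2)" "s y w \<le> exp (M / 2)"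
      using s(2)[of x z] s(2)[of y w] assms by linarith+
  qed
  moreover have "1 \<le> exp (M / 2)" using M0 by simp
  moreover have "(s x z + 1) * (s y w + 1) = s x z * s y w + s x z + s y w + 1" by (simp add: algebra_simps)
  \<comment> \<open>5 = 2 + 1 + 1 + 1: the product contributes 2 by Ptolemy, the remaining three
    terms 1 each. After taking logarithms and doubling this is the constant 2 ln 5.\<close>
  ultimately have "(s x z + 1) * (s y w + 1) \<le> 5 * exp (M / 2)" by linarith
  moreover have "exp (hD x z / 2) * exp (hD y w / 2) \<le> (s x z + 1) * (s y w + 1)"
    using s(3,4)[of x z] s(3,4)[of y w] assms by (intro mult_mono) auto
  ultimately have "exp ((hD x z + hD y w) / 2) \<le> exp (ln 5 + M / 2)"
    by (simp add: exp_add add_divide_distrib)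
  then show ?thesis unfolding M_def[symmetric] by simp
qed

subsection \<open>Geodesic lines\<close>

definition hyp_line :: "(real \<Rightarrow> complex) \<Rightarrow> bool" where
  "hyp_line J \<longleftrightarrow> (\<forall>t. Im (J t) > 0) \<and> (\<forall>s t. hD (J s) (J t) = \<bar>s - t\<bar>)"

lemma hyp_lineD: "hyp_line J \<Longrightarrow> Im (J t) > 0" "hyp_line J \<Longrightarrow> hD (J s) (J t) = \<bar>s - t\<bar>"
  by (auto simp: hyp_line_def)

lemma hyp_line_vert: "hyp_line vert"
  by (simp add: hyp_line_def vert_dist)

lemma hyp_line_isom: "hyp_line J \<Longrightarrow> hyp_isom f \<Longrightarrow> hyp_line (\<lambda>t. f (J t))"
  unfolding hyp_line_def using hyp_isom_in hyp_isom_dist by auto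

lemma hyp_line_shift: "hyp_line J \<Longrightarrow> hyp_line (\<lambda>t. J (t + a))"
  unfolding hyp_line_def by auto

lemma hyp_line_through:
  assumes "Im x > 0" "Im y > 0"
  shows "\<exists>J. hyp_line J \<and> J 0 = x \<and> J (hD x y) = y"
proof -
  obtain f where f: "is_mob f" "f x = vert 0" "f y = vert (hD x y)" using mob_normal_form assms by blast
  obtain g where g: "hyp_isom g" "\<And>z. Im z > 0 \<Longrightarrow> g (f z) = z"
    using hyp_isom_inverse[OF hyp_isom_mob[OF f(1)]] by metis
  show ?thesis
    by (intro exI[of _ "\<lambda>t. g (vert t)"]) (use hyp_line_isom[OF hyp_line_vert g(1)] g(2) f assms in metis)
qed

lemma hyp_line_normalize:
  assumes "hyp_line J" shows "\<exists>f. is_mob f \<and> (\<forall>t. f (J t) = vert t)"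
proof -
  note J = hyp_lineD[OF assms]
  obtain f where f: "is_mob f" "f (J 0) = vert 0" "f (J 1) = vert 1"
    using mob_normal_form[OF J(1) J(1), of 0 1] J(2)[of 0 1] by auto
  note g = hyp_isom_mob[OF f(1)]
  have "f (J t) = vert t" for t
  proof (rule vert_unique[of _ 0 1])
    show "Im (f (J t)) > 0" by (rule hyp_isom_in[OF g J(1)])
    show "hD (vert 0) (f (J t)) = \<bar>t - 0\<bar>" "hD (vert 1) (f (J t)) = \<bar>t - 1\<bar>"
      using hyp_isom_dist[OF g J(1) J(1)] f(2,3) J(2) by (metis abs_minus_commute)+
  qed simp
  then show ?thesis using f by blast
qed

lemma hyp_line_unique:
  assumes J: "hyp_line J" and w: "Im w > 0" and "s \<noteq> s'"
    and "hD (J s) w = \<bar>t - s\<bar>" "hD (J s') w = \<bar>t - s'\<bar>"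
  shows "w = J t"
proof -
  obtain f where f: "is_mob f" "\<forall>t. f (J t) = vert t" using hyp_line_normalize[OF J] by blast
  note g = hyp_isom_mob[OF f(1)]
  have "f w = vert t"
    by (rule vert_unique[of _ s s'])
      (use assms f hyp_isom_in[OF g w] hyp_isom_dist[OF g hyp_lineD(1)[OF J] w] in metis)+
  then have "hD w (J t) = 0" using hyp_isom_dist[OF g w hyp_lineD(1)[OF J], of t] f by simp
  then show ?thesis using hyp_dist_eq_0_iff[OF w hyp_lineD(1)[OF J]] by blast
qed

text \<open>The set of times near which \<open>c\<close> coincides with one fixed line is open; it
  is closed because two nearby times of agreement determine the line by
  \<open>hyp_line_unique\<close>; it contains 0. Connectedness of the real line does the
  rest.\<close>

lemma local_geodesic_hyp_line:
  assumes H: "\<And>t. Im (c t) > 0"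
    and loc: "\<And>t. \<exists>e>0. \<forall>s\<in>{t - e<..<t + e}. \<forall>s'\<in>{t - e<..<t + e}. hD (c s) (c s') = \<bar>s - s'\<bar>"
  shows "hyp_line c"
proof -
  obtain e where e: "e > 0" "\<forall>s\<in>{0 - e<..<0 + e}. \<forall>s'\<in>{0 - e<..<0 + e}. hD (c s) (c s') = \<bar>s - s'\<bar>"
    using loc[of 0] by blast
  obtain J0 where J0: "hyp_line J0" "J0 0 = c 0" "J0 (hD (c 0) (c (e/2))) = c (e/2)"
    using hyp_line_through H by blast
  have J0e: "J0 (e/2) = c (e/2)" using J0(3) e by auto
  define A where "A = {t. \<exists>d>0. \<forall>s\<in>{t - d<..<t + d}. c s = J0 s}"
  have "c s = J0 s" if "s\<in>{0 - e<..<0 + e}" for s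
    by (rule hyp_line_unique[OF J0(1) H, of 0 "e/2"]) (use e that J0(2) J0e in auto)
  then have A0: "0 \<in> A" unfolding A_def using e(1) by blast
  have "open A" unfolding open_dist
  proof
    fix t assume "t \<in> A"
    then obtain d where d: "d > 0" "\<forall>s\<in>{t - d<..<t + d}. c s = J0 s" unfolding A_def by blast
    have "y \<in> A" if "dist y t < d" for y
      unfolding A_def using d that
      by (intro CollectI exI[of _ "d - dist y t"]) (auto simp: dist_real_def abs_if split: if_splits)
    then show "\<exists>e>0. \<forall>y. dist y t < e \<longrightarrow> y \<in> A" using d by blast
  qed
  moreover have "closed A" unfolding closed_sequential_limits
  proof (intro allI impI, elim conjE)
    fix x t assume x: "\<forall>n. x n \<in> A" "x \<longlonglongrightarrow> (t::real)"
    obtain d where d: "d > 0" "\<forall>s\<in>{t - d<..<t + d}. \<forall>s'\<in>{t - d<..<t + d}. hD (c s) (c s') = \<bar>s - s'\<bar>"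
      using loc[of t] by blast
    obtain n where n: "dist (x n) t < d" using x(2) d(1) by (meson metric_LIMSEQ_D order_refl)
    obtain d' where d': "d' > 0" "\<forall>s\<in>{x n - d'<..<x n + d'}. c s = J0 s" using x(1) unfolding A_def by blast
    define m where "m = min d' (d - dist (x n) t) / 2"
    have m: "m > 0" "m < d'" "m < d - dist (x n) t" unfolding m_def using d' n by auto
    have "c s = J0 s" if "s\<in>{t - d<..<t + d}" for s
    proof (rule hyp_line_unique[OF J0(1) H, of "x n" "x n + m"])
      have c: "c (x n) = J0 (x n)" "c (x n + m) = J0 (x n + m)" using d' m by auto
      have "x n \<in> {t - d<..<t + d}" "x n + m \<in> {t - d<..<t + d}"
        using m n by (auto simp: dist_real_def)
      then show "hD (J0 (x n)) (c s) = \<bar>s - x n\<bar>" "hD (J0 (x n + m)) (c s) = \<bar>s - (x n + m)\<bar>"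
        unfolding c[symmetric] using d(2) that by (metis abs_minus_commute)+
    qed (use m in auto)
    then show "t \<in> A" unfolding A_def using d(1) by blast
  qed
  ultimately have "A = UNIV" using clopen A0 by blast
  then have "c t = J0 t" for t
  proof -
    have "t \<in> A" using \<open>A = UNIV\<close> by simp
    then obtain d where "d > 0" "\<forall>s\<in>{t - d<..<t + d}. c s = J0 s" unfolding A_def by blast
    then show ?thesis by auto
  qed
  then show ?thesis using J0(1) by presburger
qed

lemma hyp_geod_exists:
  assumes "x \<in> hyp_plane" "y \<in> hyp_plane"
  shows "\<exists>c. geod hyp_plane hD c (hD x y) \<and> c 0 = x \<and> c (hD x y) = y"
proof -
  obtain J where "hyp_line J" "J 0 = x" "J (hD x y) = y" using hyp_line_through assms by auto
  then show ?thesis unfolding geod_def by (intro exI[of _ J]) (auto simp: hyp_lineD)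
qed

global_interpretation hyp: geodesic_hyperbolic hyp_plane hyp_dist "2 * ln 5"
  by unfold_locales
    (auto intro: hyp_dist_nonneg hyp_dist_triangle hyp_four_point hyp_geod_exists[simplified]
      simp: hyp_dist_eq_0_iff hyp_dist_commute)

lemma seg_subset_line:
  assumes J: "hyp_line J" and m: "m \<in> hyp.seg (J s) (J t)"
  shows "m \<in> range J"
proof -
  have mm: "Im m > 0" "hD (J s) m + hD m (J t) = \<bar>s - t\<bar>" using m hyp_lineD[OF J] by (auto simp: hyp.seg_def)
  define a where "a = hD (J s) m"
  have a: "a \<ge> 0" "hD m (J t) = \<bar>s - t\<bar> - a" "a \<le> \<bar>s - t\<bar>"
    using mm hyp_dist_nonneg[OF hyp_lineD(1)[OF J] mm(1)] hyp_dist_nonneg[OF mm(1) hyp_lineD(1)[OF J]]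
    unfolding a_def by (auto simp: algebra_simps) (smt (verit))
  show ?thesis
  proof (cases "s = t")
    case True
    then have "hD (J s) m = 0" using a unfolding a_def by auto
    then show ?thesis using hyp_dist_eq_0_iff[OF hyp_lineD(1)[OF J] mm(1)] by auto
  next
    case False
    define u where "u = s + sgn (t - s) * a"
    have "m = J u"
    proof (rule hyp_line_unique[OF J mm(1) False])
      show "hD (J s) m = \<bar>u - s\<bar>" using a False unfolding a_def[symmetric] u_def by (auto simp: sgn_if)
      show "hD (J t) m = \<bar>u - t\<bar>" using a False hyp_dist_commute[of m "J t"] unfolding u_def by (auto simp: sgn_if)
    qed
    then show ?thesis by blast
  qed
qed

text \<open>On the normalized line cosh of the distance is k/x + x up to a factor, with x = e^t and
  k = |w|^2; this function first decreases and then increases. So hyperbolic discs are convex, which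
  \<open>developed_extend\<close> relies on.\<close>

lemma hyp_dist_line_quasiconvex:
  assumes J: "hyp_line J" and z: "Im z > 0" and "s \<le> t" "t \<le> u"
  shows "hD z (J t) \<le> max (hD z (J s)) (hD z (J u))"
proof -
  obtain f where f: "is_mob f" "\<forall>t. f (J t) = vert t" using hyp_line_normalize[OF J] by blast
  note g = hyp_isom_mob[OF f(1)]
  define w where "w = f z"
  have w: "Im w > 0" unfolding w_def by (rule hyp_isom_in[OF g z])
  have D: "hD z (J t) = hD (vert t) w" for t
    using hyp_isom_dist[OF g z hyp_lineD(1)[OF J]] f hyp_dist_commute unfolding w_def by metis
  define F where "F x = (cmod w)\<^sup>2 / x + x" for x
  have cosh: "cosh (hD z (J t)) = F (exp t) / (2 * Im w)" for t
    unfolding D cosh_dist_vert[OF w] F_def by (simp only: exp_minus divide_inverse)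
  have "F b \<le> F a \<or> F b \<le> F c" if "0 < a" "a \<le> b" "b \<le> c" for a b c
  proof (rule ccontr)
    assume n: "\<not> (F b \<le> F a \<or> F b \<le> F c)"
    let ?k = "(cmod w)\<^sup>2"
    have "F b - F a = (b - a) * (a * b - ?k) / (a * b)" "F c - F b = (c - b) * (b * c - ?k) / (b * c)"
      unfolding F_def using that by (simp_all add: field_simps)
    then have "(b - a) * (a * b - ?k) / (a * b) > 0" "(c - b) * (b * c - ?k) / (b * c) < 0"
      using n by linarith+
    moreover have "a * b > 0" "b * c > 0" using that by auto
    ultimately have "(b - a) * (a * b - ?k) > 0" "(c - b) * (b * c - ?k) < 0"
      by (auto simp only: zero_less_divide_iff divide_less_0_iff)
    then have "a * b > ?k" "b * c < ?k" using that by (auto simp: zero_less_mult_iff mult_less_0_iff)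
    moreover have "a * b \<le> b * c" using that by (simp add: mult.commute mult_left_mono)
    ultimately show False by linarith
  qed
  then have "F (exp t) \<le> F (exp s) \<or> F (exp t) \<le> F (exp u)" using assms by auto
  then have "cosh (hD z (J t)) \<le> cosh (hD z (J s)) \<or> cosh (hD z (J t)) \<le> cosh (hD z (J u))"
    unfolding cosh using w by (auto intro: divide_right_mono)
  then show ?thesis
    using hyp_dist_nonneg[OF z hyp_lineD(1)[OF J]] cosh_real_nonneg_le_iff by (auto simp: le_max_iff_disj)
qed

subsection \<open>Extending partial isometries\<close>

lemma vert_two_dist:
  assumes "Im v > 0" "Im w > 0" "s \<noteq> s'" "hD (vert s) v = hD (vert s) w" "hD (vert s') v = hD (vert s') w"
  shows "w = v \<or> w = - cnj v"
proof -
  have eq: "((cmod v)\<^sup>2 + (exp s)\<^sup>2) * Im w = ((cmod w)\<^sup>2 + (exp s)\<^sup>2) * Im v" if "hD (vert s) v = hD (vert s) w" for s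
  proof -
    have "((cmod v)\<^sup>2 / exp s + exp s) / (2 * Im v) = ((cmod w)\<^sup>2 / exp s + exp s) / (2 * Im w)"
      using cosh_dist_vert[OF assms(1), of s] cosh_dist_vert[OF assms(2), of s] that
      by (simp only: exp_minus divide_inverse)
    then have "((cmod v)\<^sup>2 / exp s + exp s) * Im w * exp s = ((cmod w)\<^sup>2 / exp s + exp s) * Im v * exp s"
      using assms by (simp add: frac_eq_eq)
    then show ?thesis by (simp add: algebra_simps power2_eq_square)
  qed
  have "(exp s)\<^sup>2 \<noteq> (exp s')\<^sup>2" using assms(3) by simp
  moreover have "((exp s)\<^sup>2 - (exp s')\<^sup>2) * (Im w - Im v) = 0"
    using eq[OF assms(4)] eq[OF assms(5)] by (simp add: algebra_simps)
  ultimately have Im: "Im w = Im v" by simp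
  then have "(cmod v)\<^sup>2 = (cmod w)\<^sup>2" using eq[OF assms(4)] assms by simp
  then have "(Re v)\<^sup>2 = (Re w)\<^sup>2" using Im by (simp add: cmod_power2)
  then show ?thesis using Im by (auto simp: complex_eq_iff power2_eq_iff)
qed

lemma reflect_dist_neq:
  assumes "Im v > 0" "Im w > 0" "Re v \<noteq> 0" "hD (- cnj w) v = hD w v"
  shows "Re w = 0"
proof -
  have "(cmod (- cnj w - v))\<^sup>2 = (cmod (w - v))\<^sup>2"
    using cosh_hyp_dist[of "- cnj w" v] cosh_hyp_dist[of w v] assms by (simp add: field_simps)
  then have "(Re w + Re v)\<^sup>2 = (Re w - Re v)\<^sup>2" unfolding cmod_power2 by (simp add: power2_eq_square algebra_simps)
  then have "Re w * Re v = 0" by (simp add: power2_eq_square algebra_simps)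
  then show ?thesis using assms by simp
qed

text \<open>Distances to two points of the axis determine a point up to reflection. The choice is
  the same everywhere, since reflecting only one of two points off the axis changes their
  distance.\<close>

lemma partial_isometry_fixing_vert:
  assumes A: "A \<subseteq> hyp_plane" and f: "\<And>z. z \<in> A \<Longrightarrow> Im (f z) > 0"
    and iso: "\<And>z w. z \<in> A \<Longrightarrow> w \<in> A \<Longrightarrow> hD (f z) (f w) = hD z w"
    and ax: "s \<noteq> s'" "vert s \<in> A" "vert s' \<in> A" "f (vert s) = vert s" "f (vert s') = vert s'"
  shows "(\<forall>z\<in>A. f z = z) \<or> (\<forall>z\<in>A. f z = - cnj z)"
proof -
  have two: "f z = z \<or> f z = - cnj z" if "z \<in> A" for z
    by (rule vert_two_dist[of z "f z" s s'])
      (use assms that in auto, metis iso ax(2,4), metis iso ax(3,5))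
  show ?thesis
  proof (rule ccontr)
    assume n: "\<not> ?thesis"
    then obtain z w where zw: "z \<in> A" "f z \<noteq> z" "w \<in> A" "f w \<noteq> - cnj w" by blast
    then have e: "f z = - cnj z" "f w = w" using two by blast+
    then have "hD (- cnj z) w = hD z w" using iso zw by metis
    moreover have "Re w \<noteq> 0" "Re z \<noteq> 0" using zw e by (auto simp: complex_eq_iff)
    moreover have "Im z > 0" "Im w > 0" using A zw(1,3) by auto
    ultimately show False using reflect_dist_neq[of w z] by blast
  qed
qed

text \<open>Normal forms before and after \<open>f\<close> reduce the claim to a map fixing two
  points of the axis. It is used to extend the transition map of two charts from their overlap to
  the whole plane.\<close>

lemma partial_isometry_extends:
  assumes A: "A \<subseteq> hyp_plane" and f: "\<And>z. z \<in> A \<Longrightarrow> Im (f z) > 0"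
    and iso: "\<And>z w. z \<in> A \<Longrightarrow> w \<in> A \<Longrightarrow> hD (f z) (f w) = hD z w"
    and qu: "q \<in> A" "u \<in> A" "q \<noteq> u"
  shows "\<exists>F. hyp_isom F \<and> (\<forall>z\<in>A. F z = f z)"
proof -
  have H: "Im q > 0" "Im u > 0" "Im (f q) > 0" "Im (f u) > 0" using A qu f by auto
  obtain g where g: "is_mob g" "g q = vert 0" "g u = vert (hD q u)" using mob_normal_form[OF H(1,2)] by blast
  obtain h where h: "is_mob h" "h (f q) = vert 0" "h (f u) = vert (hD q u)"
    using mob_normal_form[OF H(3,4)] iso[OF qu(1,2)] by auto
  note gi = hyp_isom_mob[OF g(1)] and hi = hyp_isom_mob[OF h(1)]
  obtain g' where g': "hyp_isom g'" "\<And>z. Im z > 0 \<Longrightarrow> g' (g z) = z" "\<And>z. Im z > 0 \<Longrightarrow> g (g' z) = z"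
    using hyp_isom_inverse[OF gi] by metis
  obtain h' where h': "hyp_isom h'" "\<And>z. Im z > 0 \<Longrightarrow> h' (h z) = z" "\<And>z. Im z > 0 \<Longrightarrow> h (h' z) = z"
    using hyp_isom_inverse[OF hi] by metis
  have AI: "Im z > 0" if "z \<in> A" for z using A that by auto
  have d: "(0::real) \<noteq> hD q u" using hyp_dist_eq_0_iff[OF H(1,2)] qu by auto
  let ?k = "\<lambda>z. h (f (g' z))"
  have "(\<forall>z\<in>g ` A. ?k z = z) \<or> (\<forall>z\<in>g ` A. ?k z = - cnj z)"
  proof (rule partial_isometry_fixing_vert[OF _ _ _ d])
    show "g ` A \<subseteq> hyp_plane" using hyp_isom_in[OF gi] AI by auto
    show "Im (?k z) > 0" if "z \<in> g ` A" for z
      using that g'(2) AI f hyp_isom_in[OF hi] by auto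
    show "hD (?k z) (?k w) = hD z w" if "z \<in> g ` A" "w \<in> g ` A" for z w
      using that g'(2) AI f iso by (auto simp: hyp_isom_dist[OF hi] hyp_isom_dist[OF gi])
    show "vert 0 \<in> g ` A" "vert (hD q u) \<in> g ` A" using g qu by (metis imageI)+
    show "?k (vert 0) = vert 0" using g(2) g'(2)[OF H(1)] h(2) by simp
    show "?k (vert (hD q u)) = vert (hD q u)" using g(3) g'(2)[OF H(2)] h(3) by simp
  qed
  then have "(\<forall>z\<in>A. h (f z) = g z) \<or> (\<forall>z\<in>A. h (f z) = - cnj (g z))" using g'(2) AI by auto
  then have "(\<forall>z\<in>A. h' (g z) = f z) \<or> (\<forall>z\<in>A. h' (- cnj (g z)) = f z)" using h'(2) f by metis
  moreover have "hyp_isom (\<lambda>z. h' (g z))" by (rule hyp_isom_comp[OF gi h'(1)])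
  moreover have "hyp_isom (\<lambda>z. h' (- cnj (g z)))"
    using hyp_isom_comp[OF hyp_isom_comp[OF gi hyp_isom_reflect] h'(1)] .
  ultimately show ?thesis by blast
qed

section \<open>The developing map\<close>

text \<open>Charts run from the plane to the surface, inverse to those in
  \<open>closed_hyperbolic_surface\<close>, so that the developing map is itself a chart around
  every point.\<close>

definition chart :: "'a::metric_space set \<Rightarrow> real \<Rightarrow> complex \<Rightarrow> (complex \<Rightarrow> 'a) \<Rightarrow> bool" where
  "chart S r q \<phi> \<longleftrightarrow> Im q > 0 \<and> r > 0 \<and> \<phi> ` hball q r = S \<inter> ball (\<phi> q) r \<and>
     (\<forall>u\<in>hball q r. \<forall>v\<in>hball q r. dist (\<phi> u) (\<phi> v) = hD u v)"

lemma in_hball [simp]: "w \<in> hball q r \<longleftrightarrow> Im w > 0 \<and> hD q w < r"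
  by (simp add: hball_def)

lemma chartD:
  assumes "chart S r q \<phi>"
  shows "Im q > 0" "r > 0" "q \<in> hball q r"
    and "u \<in> hball q r \<Longrightarrow> \<phi> u \<in> S"
    and "u \<in> hball q r \<Longrightarrow> v \<in> hball q r \<Longrightarrow> dist (\<phi> u) (\<phi> v) = hD u v"
    and "y \<in> S \<Longrightarrow> dist (\<phi> q) y < r \<Longrightarrow> \<exists>u\<in>hball q r. \<phi> u = y"
proof -
  have im: "\<phi> ` hball q r = S \<inter> ball (\<phi> q) r" using assms unfolding chart_def by blast
  show "Im q > 0" "r > 0" using assms unfolding chart_def by blast+
  then show "q \<in> hball q r" by simp
  show "u \<in> hball q r \<Longrightarrow> \<phi> u \<in> S" using im by blast
  show "u \<in> hball q r \<Longrightarrow> v \<in> hball q r \<Longrightarrow> dist (\<phi> u) (\<phi> v) = hD u v"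
    using assms unfolding chart_def by blast
  assume "y \<in> S" "dist (\<phi> q) y < r"
  then have "y \<in> \<phi> ` hball q r" unfolding im by simp
  then show "\<exists>u\<in>hball q r. \<phi> u = y" by blast
qed

lemma chart_inj:
  assumes "chart S r q \<phi>" "u \<in> hball q r" "v \<in> hball q r" "\<phi> u = \<phi> v"
  shows "u = v"
proof -
  have "hD u v = 0" using chartD(5)[OF assms(1-3)] assms(4) by simp
  then show ?thesis using assms hyp_dist_eq_0_iff by simp
qed

lemma chartI:
  assumes "Im q > 0" "r > 0" "\<And>u. u \<in> hball q r \<Longrightarrow> \<phi> u \<in> S"
    and iso: "\<And>u v. u \<in> hball q r \<Longrightarrow> v \<in> hball q r \<Longrightarrow> dist (\<phi> u) (\<phi> v) = hD u v"
    and surj: "\<And>y. y \<in> S \<Longrightarrow> dist (\<phi> q) y < r \<Longrightarrow> \<exists>u\<in>hball q r. \<phi> u = y"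
  shows "chart S r q \<phi>"
  unfolding chart_def
proof (intro conjI ballI)
  show "\<phi> ` hball q r = S \<inter> ball (\<phi> q) r"
  proof
    show "\<phi> ` hball q r \<subseteq> S \<inter> ball (\<phi> q) r"
    proof
      fix y assume "y \<in> \<phi> ` hball q r"
      then obtain u where u: "u \<in> hball q r" "y = \<phi> u" by blast
      moreover have "dist (\<phi> q) (\<phi> u) = hD q u" by (rule iso) (use assms(1,2) u in auto)
      ultimately show "y \<in> S \<inter> ball (\<phi> q) r" using assms(3)[OF u(1)] by simp
    qed
    show "S \<inter> ball (\<phi> q) r \<subseteq> \<phi> ` hball q r" using surj by force
  qed
qed (use assms in blast)+

lemma chart_comp_isom:
  assumes c: "chart S r q \<phi>" and F: "hyp_isom F" "F q' = q" and q': "Im q' > 0"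
  shows "chart S r q' (\<lambda>z. \<phi> (F z))"
proof -
  obtain G where G: "hyp_isom G" "\<And>z. Im z > 0 \<Longrightarrow> G (F z) = z" "\<And>z. Im z > 0 \<Longrightarrow> F (G z) = z"
    using hyp_isom_inverse[OF F(1)] by metis
  have ball: "F u \<in> hball q r" if "u \<in> hball q' r" for u
    using that hyp_isom_in[OF F(1)] hyp_isom_dist[OF F(1) q', of u] F(2) by auto
  show ?thesis
  proof (rule chartI)
    show "\<phi> (F u) \<in> S" if "u \<in> hball q' r" for u using chartD(4)[OF c] ball that by blast
    show "dist (\<phi> (F u)) (\<phi> (F v)) = hD u v" if "u \<in> hball q' r" "v \<in> hball q' r" for u v
      using chartD(5)[OF c ball[OF that(1)] ball[OF that(2)]] hyp_isom_dist[OF F(1), of u v] that by auto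
    show "\<exists>u\<in>hball q' r. \<phi> (F u) = y" if y: "y \<in> S" "dist (\<phi> (F q')) y < r" for y
    proof -
      obtain u where u: "u \<in> hball q r" "\<phi> u = y" using chartD(6)[OF c] y F by metis
      then have "Im (G u) > 0" "F (G u) = u" using hyp_isom_in[OF G(1)] G(3) by auto
      moreover have "hD q' (G u) < r" using hyp_isom_dist[OF F(1) q' calculation(1)] calculation u F by auto
      ultimately show ?thesis using u by (intro bexI[of _ "G u"]) auto
    qed
  qed (use chartD[OF c] q' in auto)
qed

lemma chart_shrink:
  assumes c: "chart S r q \<phi>" and q': "Im q' > 0" and r': "0 < r'" "r' + hD q q' \<le> r"
  shows "chart S r' q' \<phi>"
proof -
  have ball: "u \<in> hball q r" if "u \<in> hball q' r'" for u
    using that hyp_dist_triangle[OF chartD(1)[OF c] q', of u] r' by auto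
  have q'b: "q' \<in> hball q r" using q' r' by auto
  show ?thesis
  proof (rule chartI)
    show "\<phi> u \<in> S" if "u \<in> hball q' r'" for u using chartD(4)[OF c] ball that by blast
    show "dist (\<phi> u) (\<phi> v) = hD u v" if "u \<in> hball q' r'" "v \<in> hball q' r'" for u v
      using chartD(5)[OF c] ball that by blast
    show "\<exists>u\<in>hball q' r'. \<phi> u = y" if y: "y \<in> S" "dist (\<phi> q') y < r'" for y
    proof -
      have "dist (\<phi> q) y \<le> hD q q' + dist (\<phi> q') y"
        using dist_triangle[of "\<phi> q" y "\<phi> q'"] chartD(5)[OF c chartD(3)[OF c] q'b] by simp
      then have "dist (\<phi> q) y < r" using y r' by linarith
      then obtain u where u: "u \<in> hball q r" "\<phi> u = y" using chartD(6)[OF c] y(1) by blast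
      then show ?thesis using chartD(5)[OF c q'b u(1)] that by (intro bexI[of _ u]) auto
    qed
  qed (use q' r' in auto)
qed

lemma chart_cong:
  assumes c: "chart S r q \<phi>" and "\<And>u. u \<in> hball q r \<Longrightarrow> \<psi> u = \<phi> u"
  shows "chart S r q \<psi>"
proof -
  have "\<psi> ` hball q r = \<phi> ` hball q r" using assms(2) by (rule image_cong[OF refl])
  moreover have "\<psi> q = \<phi> q" using assms(2) chartD(3)[OF c] by blast
  ultimately show ?thesis using c assms(2) unfolding chart_def by auto
qed

lemma closed_surface_chart:
  assumes S: "closed_hyperbolic_surface S" and x: "x \<in> S"
  shows "\<exists>r q \<phi>. chart S r q \<phi> \<and> \<phi> q = x"
proof -
  obtain r f z where r: "r > 0" and z: "z \<in> hyp_plane"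
    and bij: "bij_betw f (S \<inter> ball x r) {w \<in> hyp_plane. hD z w < r}"
    and iso: "\<forall>u\<in>S \<inter> ball x r. \<forall>v\<in>S \<inter> ball x r. hD (f u) (f v) = dist u v"
    using S x unfolding closed_hyperbolic_surface_def by blast
  have bij': "bij_betw f (S \<inter> ball x r) (hball z r)" using bij unfolding hball_def by simp
  define \<phi> where "\<phi> = inv_into (S \<inter> ball x r) f"
  have fin: "f u \<in> hball z r" if "u \<in> S \<inter> ball x r" for u using bij_betwE[OF bij'] that by blast
  have \<phi>f: "\<phi> (f u) = u" if "u \<in> S \<inter> ball x r" for u
    unfolding \<phi>_def using bij_betw_inv_into_left[OF bij' that] .
  have f\<phi>: "f (\<phi> w) = w" if "w \<in> hball z r" for w
    unfolding \<phi>_def using bij_betw_inv_into_right[OF bij' that] .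
  have \<phi>in: "\<phi> w \<in> S \<inter> ball x r" if "w \<in> hball z r" for w
    using bij_betwE[OF bij_betw_inv_into[OF bij']] that unfolding \<phi>_def by blast
  have xb: "x \<in> S \<inter> ball x r" using x r by auto
  define q where "q = f x"
  have q: "Im q > 0" "hD z q < r" using fin[OF xb] unfolding q_def by auto
  \<comment> \<open>The given coordinate need not send \<open>x\<close> to the centre
    \<open>z\<close> of its disc; the disc is re-centred at \<open>f x\<close> and shrunk
    accordingly.\<close>
  define \<rho> where "\<rho> = r - hD z q"
  have \<rho>: "\<rho> > 0" "\<rho> \<le> r" using q z hyp_dist_nonneg[of z q] unfolding \<rho>_def by auto
  have sub: "u \<in> hball z r" if "u \<in> hball q \<rho>" for u
    using that hyp_dist_triangle[of z q u] z q unfolding \<rho>_def by auto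
  have "\<phi> q = x" unfolding q_def by (rule \<phi>f[OF xb])
  moreover have "chart S \<rho> q \<phi>"
  proof (rule chartI)
    show "dist (\<phi> u) (\<phi> v) = hD u v" if "u \<in> hball q \<rho>" "v \<in> hball q \<rho>" for u v
      using iso \<phi>in[OF sub[OF that(1)]] \<phi>in[OF sub[OF that(2)]] f\<phi> sub that by metis
    show "\<exists>u\<in>hball q \<rho>. \<phi> u = y" if "y \<in> S" "dist (\<phi> q) y < \<rho>" for y
    proof -
      have y: "y \<in> S \<inter> ball x r" using that \<rho> \<open>\<phi> q = x\<close> by auto
      have "hD q (f y) = dist x y" unfolding q_def using iso xb y by blast
      then show ?thesis using fin[OF y] \<phi>f[OF y] that \<open>\<phi> q = x\<close> by (intro bexI[of _ "f y"]) auto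
    qed
  qed (use q \<rho> \<phi>in sub in auto)
  ultimately show ?thesis by blast
qed

section \<open>Charts of a uniform radius and their analytic continuation\<close>

lemma hyp_isom_transitive:
  assumes "Im q > 0" "Im q' > 0" shows "\<exists>F. hyp_isom F \<and> F q = q'"
proof -
  obtain f g where f: "is_mob f" "f q = \<i>" and g: "is_mob g" "g q' = \<i>"
    using mob_to_i assms by metis
  obtain g' where g': "hyp_isom g'" "\<And>z. Im z > 0 \<Longrightarrow> g' (g z) = z"
    using hyp_isom_inverse[OF hyp_isom_mob[OF g(1)]] by metis
  have "hyp_isom (\<lambda>z. g' (f z))" by (rule hyp_isom_comp[OF hyp_isom_mob[OF f(1)] g'(1)])
  moreover have "g' (f q) = q'" using f g g'(2)[OF assms(2)] by simp
  ultimately show ?thesis by blast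
qed

text \<open>A Lebesgue number for a finite cover by half-size charts; the centre \<open>q\<close>
  can be prescribed because isometries act transitively on the plane.\<close>

lemma uniform_charts:
  assumes S: "closed_hyperbolic_surface S"
  shows "\<exists>\<rho>>0. \<forall>y\<in>S. \<forall>q. Im q > 0 \<longrightarrow> (\<exists>\<phi>. chart S \<rho> q \<phi> \<and> \<phi> q = y)"
proof -
  have "\<forall>x\<in>S. \<exists>r. r > 0 \<and> (\<exists>q \<phi>. chart S r q \<phi> \<and> \<phi> q = x)"
    using closed_surface_chart[OF S] chartD(2) by metis
  then obtain R where R: "\<And>x. x \<in> S \<Longrightarrow> R x > 0" "\<And>x. x \<in> S \<Longrightarrow> \<exists>q \<phi>. chart S (R x) q \<phi> \<and> \<phi> q = x" by metis
  have "compact S" "S \<noteq> {}" using S by (auto simp: closed_hyperbolic_surface_def)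
  have "S \<subseteq> (\<Union>x\<in>S. ball x (R x / 2))" using R(1) by force
  then obtain X where X: "X \<subseteq> S" "finite X" "S \<subseteq> (\<Union>x\<in>X. ball x (R x / 2))"
    using compactE_image[OF \<open>compact S\<close>, of S "\<lambda>x. ball x (R x / 2)"] by (metis open_ball)
  have "X \<noteq> {}" using X \<open>S \<noteq> {}\<close> by auto
  define \<rho> where "\<rho> = Min ((\<lambda>x. R x / 2) ` X)"
  have "\<rho> \<in> (\<lambda>x. R x / 2) ` X" unfolding \<rho>_def by (rule Min_in) (use X \<open>X \<noteq> {}\<close> in auto)
  then have "\<rho> > 0" using R(1) X(1) by auto
  moreover have "\<rho> \<le> R x / 2" if "x \<in> X" for x unfolding \<rho>_def by (rule Min_le) (use X that in auto)
  ultimately have \<rho>: "\<rho> > 0" "\<And>x. x \<in> X \<Longrightarrow> \<rho> \<le> R x / 2" by blast+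
  have "\<exists>\<phi>. chart S \<rho> q \<phi> \<and> \<phi> q = y" if y: "y \<in> S" and q: "Im q > 0" for y q
  proof -
    obtain x where x: "x \<in> X" "dist x y < R x / 2" using X y by auto
    then obtain q0 \<phi> where c: "chart S (R x) q0 \<phi>" "\<phi> q0 = x" using R(2)[of x] X(1) x(1) by blast
    have "R x > 0" using chartD(2)[OF c(1)] .
    then obtain u where u: "u \<in> hball q0 (R x)" "\<phi> u = y" using chartD(6)[OF c(1) y] c x by auto
    have "hD q0 u = dist x y" using chartD(5)[OF c(1) chartD(3)[OF c(1)] u(1)] c u by simp
    then have c': "chart S \<rho> u \<phi>" using chart_shrink[OF c(1), of u \<rho>] \<rho> x u by force
    obtain F where F: "hyp_isom F" "F q = u" using hyp_isom_transitive[OF q] u by auto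
    then show ?thesis using chart_comp_isom[OF c' F q] u by auto
  qed
  then show ?thesis using \<rho>(1) by blast
qed

text \<open>The distance bound places the point \<open>\<phi>1 w\<close> in the range of
  \<open>\<phi>2\<close>, say as the image of w'. Then w and w' have equal distances to all points
  of the open set V and coincide by \<open>hyp_dist_determines\<close>.\<close>

lemma chart_agree:
  assumes c1: "chart S r q1 \<phi>1" and c2: "chart S r q2 \<phi>2"
    and V: "open V" "x \<in> V" "V \<subseteq> hball q1 r" "V \<subseteq> hball q2 r" "\<And>u. u \<in> V \<Longrightarrow> \<phi>1 u = \<phi>2 u"
    and w: "w \<in> hball q1 r" and d: "hD w x + hD x q2 < r"
  shows "\<phi>1 w = \<phi>2 w"
proof -
  have H: "Im w > 0" "Im x > 0" "x \<in> hball q1 r" "x \<in> hball q2 r" using w V by auto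
  have "dist (\<phi>2 q2) (\<phi>1 w) \<le> dist (\<phi>2 q2) (\<phi>2 x) + dist (\<phi>1 x) (\<phi>1 w)"
    using dist_triangle[of "\<phi>2 q2" "\<phi>1 w" "\<phi>1 x"] V by simp
  also have "\<dots> = hD q2 x + hD x w" using chartD(5)[OF c1 H(3) w] chartD(5)[OF c2 chartD(3)[OF c2] H(4)] by simp
  finally have "dist (\<phi>2 q2) (\<phi>1 w) < r" using d by (simp add: hyp_dist_commute)
  then obtain w' where w': "w' \<in> hball q2 r" "\<phi>2 w' = \<phi>1 w" using chartD(6)[OF c2] chartD(4)[OF c1 w] by blast
  have "w' = w"
  proof (rule hyp_dist_determines)
    show "hD w' u = hD w u" if "u \<in> V" for u
      using chartD(5)[OF c2 w'(1), of u] chartD(5)[OF c1 w, of u] V that w' by (metis subsetD)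
  qed (use V w' w in auto)
  then show ?thesis using w' by simp
qed

locale uniform_surface =
  fixes S :: "'a::metric_space set" and \<rho> :: real
  assumes rho_pos: "\<rho> > 0"
    and charts: "\<lbrakk>y \<in> S; Im q > 0\<rbrakk> \<Longrightarrow> \<exists>\<phi>. chart S \<rho> q \<phi> \<and> \<phi> q = y"
begin

text \<open>One step of analytic continuation: a chart at \<open>q'\<close> exists, and the
  transition map on the overlap extends to an isometry, by which the new chart is corrected until it
  agrees with the old one.\<close>

lemma chart_recenter:
  assumes c: "chart S \<rho> q \<phi>" and q': "q' \<in> hball q \<rho>"
  shows "\<exists>\<phi>'. chart S \<rho> q' \<phi>' \<and> (\<forall>w\<in>hball q \<rho> \<inter> hball q' \<rho>. \<phi>' w = \<phi> w)"
proof -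
  have qI: "Im q' > 0" using q' by simp
  obtain \<psi> where \<psi>: "chart S \<rho> q' \<psi>" "\<psi> q' = \<phi> q'" using charts[OF chartD(4)[OF c q'] qI] by blast
  define A where "A = hball q \<rho> \<inter> hball q' \<rho>"
  have "\<exists>v\<in>hball q' \<rho>. \<psi> v = \<phi> w" if "w \<in> A" for w
    using chartD(6)[OF \<psi>(1), of "\<phi> w"] chartD(4)[OF c, of w] chartD(5)[OF c q', of w] that \<psi>(2)
    unfolding A_def by auto
  then obtain f where f: "\<And>w. w \<in> A \<Longrightarrow> f w \<in> hball q' \<rho>" "\<And>w. w \<in> A \<Longrightarrow> \<psi> (f w) = \<phi> w" by metis
  have q'A: "q' \<in> A" unfolding A_def using q' chartD(3)[OF \<psi>(1)] by blast
  have "q \<in> hyp_plane" "q' \<in> hyp_plane" using chartD(1)[OF c] qI by auto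
  then have "open A" unfolding A_def by (intro open_Int open_hball)
  then have "\<not> A \<subseteq> {q'}" using q'A not_open_singleton[of q'] by (metis empty_iff subset_singletonD)
  then obtain u where u: "u \<in> A" "u \<noteq> q'" by blast
  have "\<exists>F. hyp_isom F \<and> (\<forall>z\<in>A. F z = f z)"
  proof (rule partial_isometry_extends)
    show "A \<subseteq> hyp_plane" unfolding A_def by auto
    show "Im (f z) > 0" if "z \<in> A" for z using f(1)[OF that] by simp
    show "hD (f z) (f w) = hD z w" if "z \<in> A" "w \<in> A" for z w
      using chartD(5)[OF \<psi>(1) f(1)[OF that(1)] f(1)[OF that(2)]] chartD(5)[OF c, of z w] f(2) that
      unfolding A_def by simp
  qed (use u q'A in auto)
  then obtain F where F: "hyp_isom F" "\<forall>z\<in>A. F z = f z" by blast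
  have "f q' = q'" using chart_inj[OF \<psi>(1) f(1)[OF q'A] chartD(3)[OF \<psi>(1)]] f(2)[OF q'A] \<psi>(2) by simp
  then have "chart S \<rho> q' (\<lambda>z. \<psi> (F z))" using chart_comp_isom[OF \<psi>(1) F(1) _ qI] F q'A by auto
  then show ?thesis using F f unfolding A_def by (intro exI[of _ "\<lambda>z. \<psi> (F z)"]) auto
qed

text \<open>Agreement with a chart of radius \<rho> is required only at radius \<rho>/8. The
  remaining margin is the room in which charts at nearby centres are compared.\<close>

definition developed :: "real \<Rightarrow> (complex \<Rightarrow> 'a) \<Rightarrow> bool" where
  "developed R E \<longleftrightarrow> (\<forall>q\<in>hball \<i> R. \<exists>\<phi>. chart S \<rho> q \<phi> \<and> (\<forall>w\<in>hball q (\<rho>/8) \<inter> hball \<i> R. \<phi> w = E w))"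

text \<open>A point w of the new collar receives its value from the chart at a point
  \<open>Q w\<close> of the old disc less than 2e away. Any other chart of \<open>E\<close> near w
  gives the same value: the midpoint of the two centres lies in the old disc by convexity, and both
  charts equal \<open>E\<close> around it.\<close>

lemma developed_extend:
  assumes dev: "developed R E" and R: "R \<ge> \<rho> / 8"
  shows "\<exists>E'. developed (R + \<rho> / 64) E' \<and> (\<forall>w\<in>hball \<i> R. E' w = E w)"
proof -
  define r e where "r = \<rho> / 8" and "e = \<rho> / 64"
  have re: "r = 8 * e" "\<rho> = 64 * e" "e > 0" unfolding r_def e_def using rho_pos by auto
  have "\<exists>q \<phi>. q \<in> hball \<i> R \<and> hD q w < 2 * e \<and> chart S \<rho> q \<phi> \<and>
      (\<forall>w\<in>hball q r \<inter> hball \<i> R. \<phi> w = E w) \<and> (w \<in> hball \<i> R \<longrightarrow> q = w)" if w: "w \<in> hball \<i> (R + e)" for w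
  proof -
    have "\<exists>q\<in>hball \<i> R. hD q w < 2 * e \<and> (w \<in> hball \<i> R \<longrightarrow> q = w)"
    proof (cases "w \<in> hball \<i> R")
      case True
      then show ?thesis using re by auto
    next
      case False
      then have wR: "R \<le> hD \<i> w" "hD \<i> w < R + e" "Im w > 0" using w by auto
      obtain J where J: "hyp_line J" "J 0 = \<i>" "J (hD \<i> w) = w" using hyp_line_through[of \<i> w] wR by auto
      \<comment> \<open>Going back by 3/2 e ends inside the old disc, because w exceeds it by less
        than e, and is still shorter than 2e.\<close>
      define t where "t = hD \<i> w - 3/2 * e"
      have "hD \<i> (J t) = t" using hyp_lineD(2)[OF J(1), of 0 t] J wR R re unfolding t_def r_def[symmetric] by auto
      moreover have "hD (J t) w = 3/2 * e" using hyp_lineD(2)[OF J(1), of t "hD \<i> w"] J re unfolding t_def by auto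
      ultimately show ?thesis using False wR re hyp_lineD(1)[OF J(1)] unfolding t_def
        by (intro bexI[of _ "J t"]) (auto simp: t_def)
    qed
    then show ?thesis using dev unfolding developed_def r_def by meson
  qed
  then obtain Q \<Phi> where Q: "\<And>w. w \<in> hball \<i> (R + e) \<Longrightarrow> Q w \<in> hball \<i> R \<and> hD (Q w) w < 2 * e \<and> chart S \<rho> (Q w) (\<Phi> w) \<and>
      (\<forall>v\<in>hball (Q w) r \<inter> hball \<i> R. \<Phi> w v = E v) \<and> (w \<in> hball \<i> R \<longrightarrow> Q w = w)" by metis
  define E' where "E' w = \<Phi> w w" for w
  have ext: "E' w = E w" if w: "w \<in> hball \<i> R" for w
  proof -
    have "w \<in> hball \<i> (R + e)" using w re by auto
    from Q[OF this] show ?thesis unfolding E'_def using w re by auto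
  qed
  have claim: "\<phi> w = E' w"
    if q: "q \<in> hball \<i> R" and c: "chart S \<rho> q \<phi>" and ag: "\<forall>v\<in>hball q r \<inter> hball \<i> R. \<phi> v = E v"
      and w: "w \<in> hball \<i> (R + e)" and d: "hD q w < r + 2 * e" for q \<phi> w
  proof -
    note Qw = Q[OF w]
    have I: "Im q > 0" "Im w > 0" "Im (Q w) > 0" using q w Qw by auto
    obtain J where J: "hyp_line J" "J 0 = q" "J (hD q (Q w)) = Q w" using hyp_line_through I by blast
    \<comment> \<open>Half the distance of the centres is below 6e, hence below the agreement radius
      r = 8e of either chart.\<close>
    define t where "t = hD q (Q w) / 2"
    define x where "x = J t"
    have t0: "t \<ge> 0" unfolding t_def using hyp_dist_nonneg[OF I(1,3)] by simp
    have x: "Im x > 0" unfolding x_def by (rule hyp_lineD(1)[OF J(1)])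
    have "hD q (Q w) < r + 4 * e" using hyp_dist_triangle[OF I(1,2,3)] d Qw by (simp add: hyp_dist_commute)
    then have t: "t < 6 * e" unfolding t_def using re by simp
    have dx: "hD q x = t" "hD x (Q w) = t"
      using hyp_lineD(2)[OF J(1), of 0 t] hyp_lineD(2)[OF J(1), of t "2 * t"] J t0
      unfolding x_def t_def by auto
    have "hD \<i> x \<le> max (hD \<i> q) (hD \<i> (Q w))"
      using hyp_dist_line_quasiconvex[OF J(1), of \<i> 0 t "2 * t"] J t0 unfolding x_def t_def by auto
    then have xR: "hD \<i> x < R" using q Qw by auto
    let ?V = "hball q r \<inter> hball (Q w) r \<inter> hball \<i> R"
    show ?thesis unfolding E'_def
    proof (rule chart_agree[OF c, of "Q w" "\<Phi> w" ?V x w])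
      show "chart S \<rho> (Q w) (\<Phi> w)" using Qw by blast
      have "\<i> \<in> hyp_plane" "q \<in> hyp_plane" "Q w \<in> hyp_plane" using I by auto
      then show "open ?V" by (intro open_Int open_hball)
      show "x \<in> ?V" using x xR dx t re by (auto simp: hyp_dist_commute)
      show "?V \<subseteq> hball q \<rho>" "?V \<subseteq> hball (Q w) \<rho>" using re by auto
      show "\<phi> u = \<Phi> w u" if "u \<in> ?V" for u using ag Qw that by auto
      show "w \<in> hball q \<rho>" using d re I by auto
      have "hD w x \<le> hD w (Q w) + hD (Q w) x" using hyp_dist_triangle I x by blast
      then show "hD w x + hD x (Q w) < \<rho>"
        using Qw dx t re hyp_dist_commute[of w "Q w"] hyp_dist_commute[of x "Q w"] by linarith
    qed
  qed
  have "developed (R + e) E'" unfolding developed_def r_def[symmetric]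
  proof
    fix q' assume q': "q' \<in> hball \<i> (R + e)"
    note Qq = Q[OF q']
    have "q' \<in> hball (Q q') \<rho>" using Qq q' re by auto
    then obtain \<phi>' where \<phi>': "chart S \<rho> q' \<phi>'" "\<forall>w\<in>hball (Q q') \<rho> \<inter> hball q' \<rho>. \<phi>' w = \<Phi> q' w"
      using chart_recenter[of "Q q'" "\<Phi> q'" q'] Qq by blast
    have "\<phi>' w = E' w" if w: "w \<in> hball q' r" "w \<in> hball \<i> (R + e)" for w
    proof -
      have "hD (Q q') w \<le> hD (Q q') q' + hD q' w" using hyp_dist_triangle[of "Q q'" q' w] Qq q' w by simp
      then have d: "hD (Q q') w < r + 2 * e" using Qq w by simp
      then have "w \<in> hball (Q q') \<rho> \<inter> hball q' \<rho>" using w re by auto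
      then have "\<phi>' w = \<Phi> q' w" using \<phi>' by blast
      also have "\<dots> = E' w" using claim[of "Q q'" "\<Phi> q'" w] Qq w d by blast
      finally show ?thesis .
    qed
    then show "\<exists>\<phi>. chart S \<rho> q' \<phi> \<and> (\<forall>w\<in>hball q' r \<inter> hball \<i> (R + e). \<phi> w = E' w)" using \<phi>'(1) by blast
  qed
  then show ?thesis using ext unfolding e_def by blast
qed

text \<open>The radius grows by the fixed amount \<rho>/64 at every step, so the discs exhaust the
  plane. Extensions are made by dependent choice, and \<open>E w\<close> is read off at the first
  stage whose disc contains w.\<close>

lemma developing_map:
  assumes p: "p \<in> S"
  shows "\<exists>E. E \<i> = p \<and> (\<forall>q. Im q > 0 \<longrightarrow> chart S (\<rho> / 8) q E)"
proof -
  define rad where "rad n = \<rho> / 8 + real n * (\<rho> / 64)" for n :: nat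
  have rad_Suc: "rad (Suc n) = rad n + \<rho> / 64" for n unfolding rad_def of_nat_Suc by (simp add: field_simps)
  have rad_ge: "rad n \<ge> \<rho> / 8" for n unfolding rad_def using rho_pos by simp
  obtain \<phi>0 where \<phi>0: "chart S \<rho> \<i> \<phi>0" "\<phi>0 \<i> = p" using charts[OF p, of \<i>] by auto
  have dev0: "developed (\<rho> / 8) \<phi>0" unfolding developed_def
  proof
    fix q assume q: "q \<in> hball \<i> (\<rho> / 8)"
    then have "q \<in> hball \<i> \<rho>" using rho_pos by auto
    then obtain \<phi>' where \<phi>': "chart S \<rho> q \<phi>'" "\<forall>w\<in>hball \<i> \<rho> \<inter> hball q \<rho>. \<phi>' w = \<phi>0 w"
      using chart_recenter[OF \<phi>0(1)] by blast
    have "\<phi>' w = \<phi>0 w" if "w \<in> hball q (\<rho> / 8) \<inter> hball \<i> (\<rho> / 8)" for w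
      using \<phi>'(2) that rho_pos by auto
    then show "\<exists>\<phi>. chart S \<rho> q \<phi> \<and> (\<forall>w\<in>hball q (\<rho> / 8) \<inter> hball \<i> (\<rho> / 8). \<phi> w = \<phi>0 w)" using \<phi>'(1) by blast
  qed
  have "\<exists>f. \<forall>n. (developed (rad n) (f n) \<and> f n \<i> = p) \<and> (\<forall>w\<in>hball \<i> (rad n). f (Suc n) w = f n w)"
  proof (rule dependent_nat_choice)
    show "\<exists>E. developed (rad 0) E \<and> E \<i> = p" using dev0 \<phi>0 by (auto simp: rad_def)
    fix E n assume E: "developed (rad n) E \<and> E \<i> = p"
    have "\<i> \<in> hball \<i> (rad n)" using rad_ge[of n] rho_pos by simp
    moreover obtain E' where "developed (rad n + \<rho> / 64) E'" "\<forall>w\<in>hball \<i> (rad n). E' w = E w"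
      using developed_extend[of "rad n" E] E rad_ge[of n] by blast
    ultimately show "\<exists>E'. (developed (rad (Suc n)) E' \<and> E' \<i> = p) \<and> (\<forall>w\<in>hball \<i> (rad n). E' w = E w)"
      unfolding rad_Suc using E by (intro exI[of _ E']) simp
  qed
  then obtain f where f: "\<And>n. developed (rad n) (f n)" "\<And>n. f n \<i> = p"
    "\<And>n w. w \<in> hball \<i> (rad n) \<Longrightarrow> f (Suc n) w = f n w" by blast
  have rad_mono: "rad m \<le> rad n" if "m \<le> n" for m n unfolding rad_def using that rho_pos by (simp add: mult_right_mono)
  have stable: "f n w = f m w" if "m \<le> n" "w \<in> hball \<i> (rad m)" for m n w
    using that(1)
  proof (induction n rule: dec_induct)
    case (step n)
    then have "w \<in> hball \<i> (rad n)" using rad_mono[of m n] that(2) by auto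
    then show ?case using f(3) step by simp
  qed simp
  have ex: "\<exists>n. d < rad n" for d
  proof -
    obtain n where "d / (\<rho> / 64) < real n" using reals_Archimedean2 by blast
    then show ?thesis unfolding rad_def using rho_pos by (intro exI[of _ n]) (simp add: field_simps)
  qed
  define N where "N w = (LEAST n. hD \<i> w < rad n)" for w
  define E where "E w = f (N w) w" for w
  have E_eq: "E w = f n w" if "w \<in> hball \<i> (rad n)" for w n
  proof -
    have d: "hD \<i> w < rad n" using that by simp
    have "hD \<i> w < rad (N w)" "N w \<le> n"
      unfolding N_def using LeastI[of "\<lambda>n. hD \<i> w < rad n", OF d] Least_le[of "\<lambda>n. hD \<i> w < rad n", OF d] by auto
    then show ?thesis unfolding E_def using stable[of "N w" n w] that by auto
  qed
  have "chart S (\<rho> / 8) q E" if q: "Im q > 0" for q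
  proof -
    obtain n where n: "hD \<i> q + \<rho> / 8 < rad n" using ex by blast
    have "q \<in> hball \<i> (rad n)" using q n rho_pos by auto
    then obtain \<phi> where \<phi>: "chart S \<rho> q \<phi>" "\<forall>w\<in>hball q (\<rho>/8) \<inter> hball \<i> (rad n). \<phi> w = f n w"
      using f(1)[of n] unfolding developed_def by blast
    have "chart S (\<rho> / 8) q \<phi>" by (rule chart_shrink[OF \<phi>(1) q]) (use rho_pos in auto)
    then show ?thesis
    proof (rule chart_cong)
      fix u assume u: "u \<in> hball q (\<rho> / 8)"
      then have "u \<in> hball \<i> (rad n)" using hyp_dist_triangle[of \<i> q u] q n by auto
      then show "E u = \<phi> u" using E_eq \<phi>(2) u by auto
    qed
  qed
  moreover have "E \<i> = p" unfolding E_def by (rule f(2))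
  ultimately show ?thesis by blast
qed

end

theorem hyperbolic_developing_map:
  assumes "closed_hyperbolic_surface S" "p \<in> S"
  shows "\<exists>E r. r > 0 \<and> E \<i> = p \<and> (\<forall>q. Im q > 0 \<longrightarrow> chart S r q E)"
proof -
  obtain \<rho> where \<rho>: "\<rho> > 0" "\<forall>y\<in>S. \<forall>q. Im q > 0 \<longrightarrow> (\<exists>\<phi>. chart S \<rho> q \<phi> \<and> \<phi> q = y)"
    using uniform_charts[OF assms(1)] by blast
  then interpret uniform_surface S \<rho> by unfold_locales auto
  obtain E where "E \<i> = p" "\<forall>q. Im q > 0 \<longrightarrow> chart S (\<rho> / 8) q E"
    using developing_map[OF assms(2)] by blast
  then show ?thesis using rho_pos by (intro exI[of _ E] exI[of _ "\<rho> / 8"]) simp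
qed

section \<open>Lifting to the hyperbolic plane\<close>

lemma chart_map_cont:
  assumes E: "\<And>q. Im q > 0 \<Longrightarrow> chart S r q E"
  shows "continuous_on hyp_plane E"
  unfolding continuous_on_iff
proof (intro ballI allI impI)
  fix q e assume q: "q \<in> hyp_plane" and e: "(e::real) > 0"
  have qI: "Im q > 0" using q by simp
  note c = E[OF qI]
  have "open (hball q (min r e))" "q \<in> hball q (min r e)"
    using open_hball[OF q] chartD(2)[OF c] e qI by auto
  then obtain d where d: "d > 0" "ball q d \<subseteq> hball q (min r e)" by (meson openE)
  have "dist (E w) (E q) < e" if "dist w q < d" for w
  proof -
    have w: "w \<in> hball q (min r e)" using d that by (auto simp: dist_commute)
    then have "w \<in> hball q r" by simp
    from chartD(5)[OF c chartD(3)[OF c] this] w show ?thesis by (simp add: dist_commute)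
  qed
  then show "\<exists>d>0. \<forall>x'\<in>hyp_plane. dist x' q < d \<longrightarrow> dist (E x') (E q) < e" using d by blast
qed

text \<open>By the uniform radius, a point of S closer than r to the image belongs to it; so the
  image and its complement are both open in S.\<close>

lemma chart_map_surj:
  assumes E: "\<And>q. Im q > 0 \<Longrightarrow> chart S r q E" and S: "connected S"
  shows "E ` hyp_plane = S"
proof -
  have r: "r > 0" using chartD(2)[OF E[of \<i>]] by simp
  have sub: "E ` hyp_plane \<subseteq> S" using chartD(4)[OF E] chartD(3)[OF E] by fastforce
  have near: "y \<in> E ` hyp_plane" if y: "y \<in> S" "x \<in> E ` hyp_plane" "dist x y < r" for x y
  proof -
    obtain q where "Im q > 0" "x = E q" using y by auto
    then show ?thesis using chartD(6)[OF E[of q], of y] y by auto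
  qed
  have "openin (top_of_set S) (E ` hyp_plane)" unfolding openin_euclidean_subtopology_iff
    using sub near r by (metis dist_commute)
  moreover have "openin (top_of_set S) (S - E ` hyp_plane)" unfolding openin_euclidean_subtopology_iff
    using near r sub by (metis Diff_iff Diff_subset subsetD)
  then have "closedin (top_of_set S) (E ` hyp_plane)" using sub by (simp add: closedin_def)
  moreover have "E \<i> \<in> E ` hyp_plane" by simp
  ultimately show ?thesis using S unfolding connected_clopen by blast
qed

lemma chart_homeomorphism:
  assumes c: "chart S r q E" and s: "0 < s" "s \<le> r"
  shows "\<exists>g. homeomorphism (hball q s) (S \<inter> ball (E q) s) E g"
proof -
  have q: "Im q > 0" using chartD(1)[OF c] .
  have c': "chart S s q E" by (rule chart_shrink[OF c q]) (use s in auto)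
  define g where "g = inv_into (hball q s) E"
  have inj: "inj_on E (hball q s)" unfolding inj_on_def using chart_inj[OF c'] by blast
  have im: "E ` hball q s = S \<inter> ball (E q) s" using c' unfolding chart_def by blast
  have gE: "g (E u) = u" if "u \<in> hball q s" for u unfolding g_def using inj that by simp
  have Eg: "E (g y) = y" "g y \<in> hball q s" if "y \<in> S \<inter> ball (E q) s" for y
    using that unfolding im[symmetric] g_def by (auto simp: f_inv_into_f inv_into_into simp del: in_hball)
  have "continuous_on (hball q s) E" unfolding continuous_on_iff
  proof (intro ballI allI impI)
    fix u e assume u: "u \<in> hball q s" and e: "(e::real) > 0"
    have "open (hball u e)" "u \<in> hball u e" using open_hball[of u e] u e by auto
    then obtain d where d: "d > 0" "ball u d \<subseteq> hball u e" by (meson openE)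
    have "dist (E w) (E u) < e" if "w \<in> hball q s" "dist w u < d" for w
    proof -
      have "w \<in> hball u e" using d that by (auto simp: dist_commute)
      then show ?thesis using chartD(5)[OF c' that(1) u] by (simp add: hyp_dist_commute)
    qed
    then show "\<exists>d>0. \<forall>x'\<in>hball q s. dist x' u < d \<longrightarrow> dist (E x') (E u) < e" using d by blast
  qed
  moreover have "continuous_on (S \<inter> ball (E q) s) g" unfolding continuous_on_iff
  proof (intro ballI allI impI)
    fix y e assume y: "y \<in> S \<inter> ball (E q) s" and e: "(e::real) > 0"
    note gy = Eg[OF y]
    have "Im (g y) > 0" using gy by simp
    from hyp_dist_small[OF this e] obtain d where d: "d > 0" "\<forall>w. Im w > 0 \<and> hD (g y) w < d \<longrightarrow> cmod (g y - w) < e"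
      by blast
    have "dist (g y') (g y) < e" if y': "y' \<in> S \<inter> ball (E q) s" "dist y' y < d" for y'
    proof -
      note gy' = Eg[OF y'(1)]
      have "hD (g y) (g y') = dist y y'" using chartD(5)[OF c' gy(2) gy'(2)] gy gy' by simp
      then show ?thesis using d(2) gy'(2) y'(2) by (simp add: dist_norm norm_minus_commute dist_commute)
    qed
    then show "\<exists>d>0. \<forall>x'\<in>S \<inter> ball (E q) s. dist x' y < d \<longrightarrow> dist (g x') (g y) < e" using d by blast
  qed
  moreover have "g ` (S \<inter> ball (E q) s) = hball q s"
    using Eg(2) gE im by (auto simp: image_iff simp del: in_hball) (metis image_eqI)
  ultimately show ?thesis unfolding homeomorphism_def using gE Eg im by (intro exI[of _ g]) blast
qed

text \<open>Balls of radius r/2 are evenly covered by the discs about the preimages of the centre.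
  If a point w lies in two such discs, both centres lie in the disc of radius r about w, where
  \<open>E\<close> is injective.\<close>

lemma chart_covering_space:
  assumes E: "\<And>q. Im q > 0 \<Longrightarrow> chart S r q E" and S: "connected S"
  shows "covering_space hyp_plane E S"
  unfolding covering_space_def
proof (intro conjI ballI)
  show "continuous_on hyp_plane E" by (rule chart_map_cont[OF E])
  show im: "E ` hyp_plane = S" by (rule chart_map_surj[OF E S])
  have r: "r > 0" using chartD(2)[OF E[of \<i>]] by simp
  fix x assume x: "x \<in> S"
  define T where "T = S \<inter> ball x (r/2)"
  define v where "v = (\<lambda>q. hball q (r/2)) ` {q\<in>hyp_plane. E q = x}"
  have "\<Union>v = hyp_plane \<inter> E -` T"
  proof
    show "\<Union>v \<subseteq> hyp_plane \<inter> E -` T"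
    proof
      fix w assume "w \<in> \<Union>v"
      then obtain q where q: "Im q > 0" "E q = x" "w \<in> hball q (r/2)" unfolding v_def by auto
      note c = E[OF q(1)]
      have "w \<in> hball q r" using q r by auto
      then have "dist x (E w) = hD q w" "E w \<in> S" using chartD(5)[OF c chartD(3)[OF c]] chartD(4)[OF c] q by auto
      then show "w \<in> hyp_plane \<inter> E -` T" using q unfolding T_def by auto
    qed
    show "hyp_plane \<inter> E -` T \<subseteq> \<Union>v"
    proof
      fix w assume "w \<in> hyp_plane \<inter> E -` T"
      then have w: "Im w > 0" "dist (E w) x < r/2" unfolding T_def by (auto simp: dist_commute)
      note c = E[OF w(1)]
      obtain q where q: "q \<in> hball w r" "E q = x" using chartD(6)[OF c x] w r by auto
      have "hD w q = dist (E w) x" using chartD(5)[OF c chartD(3)[OF c] q(1)] q by simp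
      then have "w \<in> hball q (r/2)" using w by (simp add: hyp_dist_commute)
      then show "w \<in> \<Union>v" using q unfolding v_def by auto
    qed
  qed
  moreover have "\<forall>u\<in>v. openin (top_of_set hyp_plane) u"
    unfolding v_def using open_hball by (auto intro!: open_subset)
  moreover have "pairwise disjnt v"
  proof -
    have "q = q'" if q: "Im q > 0" "E q = x" "Im q' > 0" "E q' = x" and w: "w \<in> hball q (r/2)" "w \<in> hball q' (r/2)" for q q' w
    proof -
      have wI: "Im w > 0" using w by simp
      show ?thesis by (rule chart_inj[OF E[OF wI]]) (use q w r hyp_dist_commute[of w] in auto)
    qed
    then show ?thesis unfolding v_def pairwise_def disjnt_def by (auto simp del: in_hball simp: Int_def) 
  qed
  moreover have "\<forall>u\<in>v. \<exists>g. homeomorphism u T E g"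
    unfolding v_def T_def using chart_homeomorphism[OF E, of _ "r/2"] r by auto
  moreover have "x \<in> T" "openin (top_of_set S) T" unfolding T_def using x r by (auto simp: openin_open_Int)
  ultimately show "\<exists>T. x \<in> T \<and> openin (top_of_set S) T \<and> (\<exists>v. \<Union>v = hyp_plane \<inter> E -` T \<and>
      (\<forall>u\<in>v. openin (top_of_set hyp_plane) u) \<and> pairwise disjnt v \<and> (\<forall>u\<in>v. \<exists>q. homeomorphism u T E q))"
    by blast
qed

text \<open>The library lifts maps into normed spaces only; Kuratowski's isometric embedding reduces the
  general case to that one.\<close>

lemma kuratowski_embedding:
  "\<exists>\<iota> :: 'a::metric_space \<Rightarrow> ('a \<Rightarrow>\<^sub>C real). \<forall>x y. dist (\<iota> x) (\<iota> y) = dist x y"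
proof -
  fix p :: 'a
  have b: "(\<lambda>y. dist x y - dist p y) \<in> bcontfun" for x
  proof -
    have "\<bar>dist x y - dist p y\<bar> \<le> dist x p" for y
      using dist_triangle[of x y p] dist_triangle[of p y x] by (simp add: dist_commute)
    then have "bounded (range (\<lambda>y. dist x y - dist p y))" unfolding bounded_iff by auto
    then show ?thesis unfolding bcontfun_def by (auto intro!: continuous_intros)
  qed
  define \<iota> where "\<iota> x = Bcontfun (\<lambda>y. dist x y - dist p y)" for x
  have ap: "apply_bcontfun (\<iota> x) y = dist x y - dist p y" for x y
    unfolding \<iota>_def using Bcontfun_inverse[OF b] by simp
  have "dist (\<iota> x) (\<iota> y) = dist x y" for x y
  proof (rule antisym)
    show "dist (\<iota> x) (\<iota> y) \<le> dist x y"
    proof (rule dist_bound)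
      fix z
      show "dist (apply_bcontfun (\<iota> x) z) (apply_bcontfun (\<iota> y) z) \<le> dist x y"
        unfolding ap dist_real_def using dist_triangle[of x z y] dist_triangle[of y z x]
        by (simp add: dist_commute)
    qed
    have "dist x y = dist (apply_bcontfun (\<iota> x) y) (apply_bcontfun (\<iota> y) y)"
      unfolding ap dist_real_def by simp
    also have "\<dots> \<le> dist (\<iota> x) (\<iota> y)" by (rule dist_bounded)
    finally show "dist x y \<le> dist (\<iota> x) (\<iota> y)" .
  qed
  then show ?thesis by blast
qed

lemma hyp_line_cont:
  assumes "hyp_line J" shows "continuous_on X J"
proof -
  have "continuous_on UNIV J" unfolding continuous_on_iff
  proof (intro ballI allI impI)
    fix t e assume e: "(e::real) > 0"
    obtain d where d: "d > 0" "\<forall>w. Im w > 0 \<and> hD (J t) w < d \<longrightarrow> cmod (J t - w) < e"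
      using hyp_dist_small[OF hyp_lineD(1)[OF assms] e] by blast
    have "dist (J s) (J t) < e" if "dist s t < d" for s
      using d(2) hyp_lineD[OF assms] that by (simp add: dist_norm norm_minus_commute dist_real_def abs_minus_commute)
    then show "\<exists>d>0. \<forall>x'\<in>UNIV. dist x' t < d \<longrightarrow> dist (J x') (J t) < e" using d by blast
  qed
  then show ?thesis by (rule continuous_on_subset) simp
qed

lemma hyp_isom_cont: "hyp_isom h \<Longrightarrow> continuous_on hyp_plane h"
  unfolding continuous_on_iff
proof (intro ballI allI impI)
  fix z e assume h: "hyp_isom h" and z: "z \<in> hyp_plane" and e: "(e::real) > 0"
  have zI: "Im z > 0" using z by simp
  obtain d where d: "d > 0" "\<forall>w. Im w > 0 \<and> hD (h z) w < d \<longrightarrow> cmod (h z - w) < e"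
    using hyp_dist_small[OF hyp_isom_in[OF h zI] e] by blast
  have "open (hball z d)" "z \<in> hball z d" using open_hball[OF z] d zI by auto
  then obtain d' where d': "d' > 0" "ball z d' \<subseteq> hball z d" by (meson openE)
  have "dist (h w) (h z) < e" if "w \<in> hyp_plane" "dist w z < d'" for w
  proof -
    have "w \<in> ball z d'" using that by (simp add: dist_commute)
    then have w: "w \<in> hball z d" using d' by blast
    then have "cmod (h z - h w) < e" using d(2) hyp_isom_in[OF h] hyp_isom_dist[OF h zI] by simp
    then show ?thesis by (simp add: dist_norm norm_minus_commute)
  qed
  then show "\<exists>d>0. \<forall>x'\<in>hyp_plane. dist x' z < d \<longrightarrow> dist (h x') (h z) < e" using d' by blast
qed

locale developed_surface =
  fixes S :: "'a::metric_space set" and E :: "complex \<Rightarrow> 'a" and r :: real and p :: 'a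
  assumes E_chart: "Im q > 0 \<Longrightarrow> chart S r q E"
    and E_base: "E \<i> = p"
    and conn: "connected S"
    and comp: "compact S"
begin

lemma r_pos: "r > 0"
  using chartD(2)[OF E_chart[of \<i>]] by simp

lemma E_in: "Im q > 0 \<Longrightarrow> E q \<in> S"
  using chartD(4)[OF E_chart] chartD(3)[OF E_chart] by blast

lemma p_in: "p \<in> S"
  using E_in[of \<i>] E_base by simp

lemma E_local_isometry:
  assumes "Im q > 0" "u \<in> hball q r" "v \<in> hball q r"
  shows "dist (E u) (E v) = hD u v"
  using chartD(5)[OF E_chart[OF assms(1)]] assms by blast

lemma E_inj_near: "Im u > 0 \<Longrightarrow> Im v > 0 \<Longrightarrow> hD u v < r \<Longrightarrow> E u = E v \<Longrightarrow> u = v"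
  using chart_inj[OF E_chart[of u], of u v] r_pos by simp

lemma E_cont: "continuous_on hyp_plane E"
  by (rule chart_map_cont[OF E_chart])

lemma E_surj: "E ` hyp_plane = S"
  by (rule chart_map_surj[OF E_chart conn])

text \<open>A convex T covers paths, homotopy squares, whole lines and the plane itself. The lift is
  taken for the covering of the embedded copy of S and carried back by injectivity of the
  embedding.\<close>

lemma lift_exists:
  fixes f :: "'c::real_normed_vector \<Rightarrow> 'a"
  assumes T: "convex T" and f: "continuous_on T f" "\<And>x. x \<in> T \<Longrightarrow> f x \<in> S"
    and a: "a \<in> T" "Im z > 0" "E z = f a"
  shows "\<exists>g. continuous_on T g \<and> (\<forall>x\<in>T. Im (g x) > 0 \<and> E (g x) = f x) \<and> g a = z"
proof -
  obtain \<iota> :: "'a \<Rightarrow> ('a \<Rightarrow>\<^sub>C real)" where iso: "\<forall>x y. dist (\<iota> x) (\<iota> y) = dist x y"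
    using kuratowski_embedding by blast
  have \<iota>_cont: "continuous_on X \<iota>" for X
    unfolding continuous_on_iff using iso by metis
  have inj: "\<iota> x = \<iota> y \<longleftrightarrow> x = y" for x y using iso by (metis dist_eq_0_iff)
  have ch: "chart (\<iota> ` S) r q (\<iota> \<circ> E)" if q: "Im q > 0" for q
  proof (rule chartI)
    note c = E_chart[OF q]
    show "(\<iota> \<circ> E) u \<in> \<iota> ` S" if "u \<in> hball q r" for u using chartD(4)[OF c that] by simp
    show "dist ((\<iota> \<circ> E) u) ((\<iota> \<circ> E) v) = hD u v" if "u \<in> hball q r" "v \<in> hball q r" for u v
      using chartD(5)[OF c that] iso by simp
    show "\<exists>u\<in>hball q r. (\<iota> \<circ> E) u = y" if y: "y \<in> \<iota> ` S" "dist ((\<iota> \<circ> E) q) y < r" for y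
    proof -
      obtain x where x: "x \<in> S" "y = \<iota> x" using y by blast
      then have "dist (E q) x < r" using y iso by simp
      then show ?thesis using chartD(6)[OF c x(1)] x by auto
    qed
  qed (use q r_pos in auto)
  have "covering_space hyp_plane (\<iota> \<circ> E) (\<iota> ` S)"
    by (rule chart_covering_space[OF ch connected_continuous_image[OF \<iota>_cont conn]])
  moreover have "simply_connected T" "locally path_connected T"
    using T convex_imp_simply_connected convex_imp_locally_path_connected by blast+
  moreover have "continuous_on T (\<iota> \<circ> f)" by (rule continuous_on_compose[OF f(1) \<iota>_cont])
  moreover have "\<iota> \<circ> f \<in> T \<rightarrow> \<iota> ` S" using f(2) by auto
  ultimately obtain g where g: "continuous_on T g" "g \<in> T \<rightarrow> hyp_plane" "g a = z"
      "\<And>x. x \<in> T \<Longrightarrow> (\<iota> \<circ> E) (g x) = (\<iota> \<circ> f) x"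
    using covering_space_lift_strong[of hyp_plane "\<iota> \<circ> E" "\<iota> ` S" z a T "\<iota> \<circ> f"] a by auto
  then show ?thesis using inj by (intro exI[of _ g]) auto
qed

lemma lift_unique:
  assumes "connected T" "continuous_on T g1" "continuous_on T g2"
    and "\<And>x. x \<in> T \<Longrightarrow> Im (g1 x) > 0" "\<And>x. x \<in> T \<Longrightarrow> Im (g2 x) > 0"
    and "\<And>x. x \<in> T \<Longrightarrow> E (g1 x) = E (g2 x)" and "a \<in> T" "g1 a = g2 a" "x \<in> T"
  shows "g1 x = g2 x"
proof (rule covering_space_lift_unique[OF chart_covering_space[OF E_chart conn], of g1 a g2 T "E \<circ> g1"])
  show "continuous_on T (E \<circ> g1)"
    using assms by (intro continuous_on_compose continuous_on_subset[OF E_cont]) auto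
  show "E \<circ> g1 \<in> T \<rightarrow> S" using assms E_in by auto
qed (use assms in auto)

text \<open>\<open>E\<close> is isometric on the disc of radius r about \<open>J t\<close>, so
  \<open>J\<close> is a local geodesic of the plane, and these are lines.\<close>

lemma lift_local_geodesic:
  assumes J: "continuous_on UNIV J" "\<And>t. Im (J t) > 0"
    and loc: "\<And>t. \<exists>e>0. \<forall>s\<in>{t - e<..<t + e}. \<forall>s'\<in>{t - e<..<t + e}. dist (E (J s)) (E (J s')) = \<bar>s - s'\<bar>"
  shows "hyp_line J"
proof (rule local_geodesic_hyp_line[OF J(2)])
  fix t
  obtain e where e: "e > 0" "\<forall>s\<in>{t - e<..<t + e}. \<forall>s'\<in>{t - e<..<t + e}. dist (E (J s)) (E (J s')) = \<bar>s - s'\<bar>"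
    using loc by blast
  have "J t \<in> hyp_plane" using J(2) by simp
  then have "open (J -` hball (J t) r)" using open_hball J(1) by (metis continuous_on_open_vimage open_UNIV Int_UNIV_right)
  moreover have "t \<in> J -` hball (J t) r" using J(2) r_pos by simp
  ultimately obtain d where d: "d > 0" "ball t d \<subseteq> J -` hball (J t) r" by (meson openE)
  have "hD (J s) (J s') = \<bar>s - s'\<bar>" if "s \<in> {t - min d e<..<t + min d e}" "s' \<in> {t - min d e<..<t + min d e}" for s s'
  proof -
    have "s \<in> ball t d" "s' \<in> ball t d" using that by (auto simp: dist_real_def)
    then have "J s \<in> hball (J t) r" "J s' \<in> hball (J t) r" using d by blast+
    then have "hD (J s) (J s') = dist (E (J s)) (E (J s'))" using E_local_isometry[OF J(2)[of t]] by simp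
    moreover have "s \<in> {t - e<..<t + e}" "s' \<in> {t - e<..<t + e}" using that by auto
    ultimately show ?thesis using e by metis
  qed
  then show "\<exists>e>0. \<forall>s\<in>{t - e<..<t + e}. \<forall>s'\<in>{t - e<..<t + e}. hD (J s) (J s') = \<bar>s - s'\<bar>"
    using d e by (intro exI[of _ "min d e"]) auto
qed

lemma line_projects_local_geodesic:
  assumes "hyp_line J"
  shows "\<exists>e>0. \<forall>s\<in>{t - e<..<t + e}. \<forall>s'\<in>{t - e<..<t + e}. dist (E (J s)) (E (J s')) = \<bar>s - s'\<bar>"
proof (intro exI[of _ r] conjI ballI)
  fix s s' assume s: "s\<in>{t - r<..<t + r}" "s'\<in>{t - r<..<t + r}"
  have "J s \<in> hball (J t) r" "J s' \<in> hball (J t) r" using s hyp_lineD[OF assms] by auto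
  from E_local_isometry[OF hyp_lineD(1)[OF assms, of t] this]
  show "dist (E (J s)) (E (J s')) = \<bar>s - s'\<bar>" using hyp_lineD(2)[OF assms] by simp
qed (rule r_pos)

subsection \<open>Deck transformations\<close>

definition deck :: "(complex \<Rightarrow> complex) \<Rightarrow> bool" where
  "deck h \<longleftrightarrow> hyp_isom h \<and> (\<forall>z. Im z > 0 \<longrightarrow> E (h z) = E z)"

lemma deck_isom: "deck h \<Longrightarrow> hyp_isom h"
  and deck_E: "deck h \<Longrightarrow> Im z > 0 \<Longrightarrow> E (h z) = E z"
  unfolding deck_def by auto

lemma deck_in: "deck h \<Longrightarrow> Im z > 0 \<Longrightarrow> Im (h z) > 0"
  using deck_isom hyp_isom_in by blast

lemma deck_dist: "deck h \<Longrightarrow> Im z > 0 \<Longrightarrow> Im w > 0 \<Longrightarrow> hD (h z) (h w) = hD z w"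
  using deck_isom hyp_isom_dist by blast

lemma deck_cont: "deck h \<Longrightarrow> continuous_on hyp_plane h"
  by (rule hyp_isom_cont[OF deck_isom])

lemma deck_comp_cont:
  assumes "deck h" "continuous_on T g" "\<And>x. x \<in> T \<Longrightarrow> Im (g x) > 0"
  shows "continuous_on T (\<lambda>x. h (g x))"
  by (rule continuous_on_compose2[OF deck_cont[OF assms(1)] assms(2)]) (use assms(3) in auto)

lemma deck_unique:
  assumes "deck h" "deck k" "Im z > 0" "h z = k z" "Im w > 0"
  shows "h w = k w"
  by (rule lift_unique[of hyp_plane h k z])
    (use assms deck_cont deck_in deck_E convex_connected[OF convex_hyp_plane] in auto)

lemma deck_id: "deck (\<lambda>z. z)"
  unfolding deck_def hyp_isom_def by (auto simp: bij_betw_def)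

lemma deck_comp: "deck h \<Longrightarrow> deck k \<Longrightarrow> deck (\<lambda>z. h (k z))"
  unfolding deck_def using hyp_isom_comp hyp_isom_in by simp

lemma deck_inverse:
  assumes "deck h"
  obtains k where "deck k" "\<And>z. Im z > 0 \<Longrightarrow> k (h z) = z" "\<And>z. Im z > 0 \<Longrightarrow> h (k z) = z"
proof -
  obtain k where k: "hyp_isom k" "\<And>z. Im z > 0 \<Longrightarrow> k (h z) = z" "\<And>z. Im z > 0 \<Longrightarrow> h (k z) = z"
    using hyp_isom_inverse[OF deck_isom[OF assms]] by metis
  have "deck k" unfolding deck_def using k deck_E[OF assms] hyp_isom_in[OF k(1)] by metis
  then show ?thesis using that k by blast
qed

lemma deck_line: "deck h \<Longrightarrow> hyp_line J \<Longrightarrow> hyp_line (\<lambda>t. h (J t))"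
  using deck_isom hyp_line_isom by blast

text \<open>Lift \<open>E\<close> through itself so that z goes to w. The lift with z and w
  exchanged is an inverse by uniqueness of lifts. The map is isometric because it takes lines to
  curves with locally geodesic projection, hence to lines.\<close>

lemma deck_exists:
  assumes z: "Im z > 0" and w: "Im w > 0" and eq: "E z = E w"
  shows "\<exists>h. deck h \<and> h z = w"
proof -
  have lift: "\<exists>g. continuous_on hyp_plane g \<and> (\<forall>x\<in>hyp_plane. Im (g x) > 0 \<and> E (g x) = E x) \<and> g z = w"
    if "Im z > 0" "Im w > 0" "E z = E w" for z w
    by (rule lift_exists[OF convex_hyp_plane E_cont]) (use that E_in in auto)
  obtain g where g: "continuous_on hyp_plane g" "\<And>x. Im x > 0 \<Longrightarrow> Im (g x) > 0" "\<And>x. Im x > 0 \<Longrightarrow> E (g x) = E x" "g z = w"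
    using lift[OF z w eq] by auto
  obtain k where k: "continuous_on hyp_plane k" "\<And>x. Im x > 0 \<Longrightarrow> Im (k x) > 0" "\<And>x. Im x > 0 \<Longrightarrow> E (k x) = E x" "k w = z"
    using lift[OF w z eq[symmetric]] by auto
  note ch = convex_connected[OF convex_hyp_plane]
  have kg: "k (g x) = x" if "Im x > 0" for x
    by (rule lift_unique[OF ch, of "\<lambda>x. k (g x)" "\<lambda>x. x" z])
      (use g k z that in \<open>auto intro!: continuous_on_compose2[OF k(1) g(1)]\<close>)
  have gk: "g (k x) = x" if "Im x > 0" for x
    by (rule lift_unique[OF ch, of "\<lambda>x. g (k x)" "\<lambda>x. x" w])
      (use g k w that in \<open>auto intro!: continuous_on_compose2[OF g(1) k(1)]\<close>)
  have bij: "bij_betw g hyp_plane hyp_plane"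
    by (rule bij_betw_byWitness[of _ k]) (use kg gk g k in auto)
  have "hD (g x) (g y) = hD x y" if xy: "Im x > 0" "Im y > 0" for x y
  proof -
    obtain J where J: "hyp_line J" "J 0 = x" "J (hD x y) = y" using hyp_line_through[OF xy] by blast
    have "hyp_line (\<lambda>t. g (J t))"
    proof (rule lift_local_geodesic)
      show "continuous_on UNIV (\<lambda>t. g (J t))"
        by (rule continuous_on_compose2[OF g(1) hyp_line_cont[OF J(1)]]) (use hyp_lineD[OF J(1)] in auto)
    qed (use g line_projects_local_geodesic[OF J(1)] hyp_lineD[OF J(1)] in auto)
    from hyp_lineD(2)[OF this, of 0 "hD x y"] show ?thesis using J hyp_dist_nonneg[OF xy] by simp
  qed
  then have "deck g" unfolding deck_def hyp_isom_def using bij g by auto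
  then show ?thesis using g by blast
qed

text \<open>Finitely many balls of radius r cover S; after choosing one lift of each centre, every
  point of the plane is within r of a translate of a chosen lift.\<close>

lemma deck_cobounded: "\<exists>R. \<forall>z. Im z > 0 \<longrightarrow> (\<exists>h. deck h \<and> hD z (h \<i>) \<le> R)"
proof -
  have "S \<subseteq> (\<Union>x\<in>S. ball x r)" using r_pos by force
  then obtain X where X: "X \<subseteq> S" "finite X" "S \<subseteq> (\<Union>x\<in>X. ball x r)"
    using compactE_image[OF comp, of S "\<lambda>x. ball x r"] by (metis open_ball)
  have "\<forall>x\<in>X. \<exists>q. Im q > 0 \<and> E q = x" using E_surj X(1) by force
  then obtain Q where Q: "\<And>x. x \<in> X \<Longrightarrow> Im (Q x) > 0" "\<And>x. x \<in> X \<Longrightarrow> E (Q x) = x" by metis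
  define R where "R = r + Max (insert 0 ((\<lambda>x. hD (Q x) \<i>) ` X))"
  have "\<exists>h. deck h \<and> hD z (h \<i>) \<le> R" if z: "Im z > 0" for z
  proof -
    obtain x where x: "x \<in> X" "dist x (E z) < r" using X(3) E_in[OF z] by auto
    then obtain q where q: "q \<in> hball z r" "E q = x"
      using chartD(6)[OF E_chart[OF z], of x] X(1) by (metis dist_commute subsetD)
    have qI: "Im q > 0" using q by simp
    obtain h where h: "deck h" "h (Q x) = q" using deck_exists[OF Q(1)[OF x(1)] qI] Q(2)[OF x(1)] q by auto
    have "hD (h (Q x)) (h \<i>) = hD (Q x) \<i>" using deck_dist[OF h(1) Q(1)[OF x(1)], of \<i>] by simp
    also have "\<dots> \<le> Max (insert 0 ((\<lambda>x. hD (Q x) \<i>) ` X))" using X(2) x by (intro Max_ge) auto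
    finally have "hD q (h \<i>) \<le> R - r" unfolding R_def h(2) by simp
    moreover have "hD z (h \<i>) \<le> hD z q + hD q (h \<i>)"
      using hyp_dist_triangle[OF z qI deck_in[OF h(1), of \<i>]] by simp
    ultimately have "hD z (h \<i>) \<le> R" using q by simp
    then show ?thesis using h by blast
  qed
  then show ?thesis by blast
qed

end

section \<open>Holonomy\<close>

context developed_surface
begin

abbreviation G :: "(real \<Rightarrow> 'a) set monoid" where "G \<equiv> fundamental_group S p"

definition lifts :: "(real \<Rightarrow> 'a) \<Rightarrow> (real \<Rightarrow> complex) \<Rightarrow> bool" where
  "lifts \<gamma> g \<longleftrightarrow> continuous_on {0..1} g \<and> (\<forall>t\<in>{0..1}. Im (g t) > 0 \<and> E (g t) = \<gamma> t)"

lemma lift_path: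
  assumes "\<gamma> \<in> loops_at S p" "Im z > 0" "E z = p"
  shows "\<exists>g. lifts \<gamma> g \<and> g 0 = z"
proof -
  have "\<exists>g. continuous_on {0..1} g \<and> (\<forall>t\<in>{0..1}. Im (g t) > 0 \<and> E (g t) = \<gamma> t) \<and> g 0 = z"
    by (rule lift_exists)
      (use assms in \<open>auto simp: loops_at_def path_def path_image_def pathstart_def image_subset_iff\<close>)
  then show ?thesis unfolding lifts_def by blast
qed

lemma lifts_unique:
  assumes "lifts \<gamma> g" "lifts \<gamma> k" "g 0 = k 0" "t \<in> {0..1}"
  shows "g t = k t"
  by (rule lift_unique[of "{0..1}" g k 0]) (use assms in \<open>auto simp: lifts_def\<close>)

lemma lift_square:
  fixes h :: "real \<times> real \<Rightarrow> 'a"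
  assumes h: "continuous_on ({0..1} \<times> {0..1}) h" "h \<in> {0..1} \<times> {0..1} \<rightarrow> S"
    and z: "Im z > 0" "E z = h (0, 0)"
  obtains K where "continuous_on ({0..1} \<times> {0..1}) K" "K (0, 0) = z"
    "\<And>s t. s \<in> {0..1} \<Longrightarrow> t \<in> {0..1} \<Longrightarrow> Im (K (s, t)) > 0 \<and> E (K (s, t)) = h (s, t)"
proof -
  have "\<exists>K. continuous_on ({0..1} \<times> {0..1}) K \<and> (\<forall>x\<in>{0..1} \<times> {0..1}. Im (K x) > 0 \<and> E (K x) = h x) \<and> K (0, 0) = z"
    by (rule lift_exists) (use h z in \<open>auto intro: convex_Times\<close>)
  then show ?thesis using that by auto
qed

lemma square_slices:
  assumes K: "continuous_on ({0..1::real} \<times> {0..1::real}) (K :: real \<times> real \<Rightarrow> complex)" and s: "s \<in> {0..1}"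
  shows "continuous_on {0..1} (\<lambda>t. K (s, t))" "continuous_on {0..1} (\<lambda>t. K (t, s))"
  by (rule continuous_on_compose2[OF K]; use s in \<open>auto intro!: continuous_intros\<close>)+

text \<open>Lift the homotopy: two opposite sides of the square lift constant paths and are
  therefore constant.\<close>

lemma homotopic_lifts_end:
  assumes hom: "homotopic_paths S \<gamma> \<delta>" and g: "lifts \<gamma> g" and k: "lifts \<delta> k" and 0: "g 0 = k 0"
  shows "g 1 = k 1"
proof -
  obtain h where h: "continuous_on ({0..1} \<times> {0..1}) h" "h \<in> {0..1} \<times> {0..1} \<rightarrow> S"
    "\<forall>x\<in>{0..1}. h (0, x) = \<gamma> x" "\<forall>x\<in>{0..1}. h (1, x) = \<delta> x"
    "\<forall>t\<in>{0..1::real}. h (t, 0) = \<gamma> 0 \<and> h (t, 1) = \<gamma> 1"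
    using hom unfolding homotopic_paths by (auto simp: pathstart_def pathfinish_def)
  have g0: "Im (g 0) > 0" "E (g 0) = h (0, 0)" using g h(3) by (auto simp: lifts_def)
  obtain K where K: "continuous_on ({0..1} \<times> {0..1}) K" "K (0, 0) = g 0"
    "\<And>s t. s \<in> {0..1} \<Longrightarrow> t \<in> {0..1} \<Longrightarrow> Im (K (s, t)) > 0 \<and> E (K (s, t)) = h (s, t)"
    using lift_square[OF h(1,2) g0] by metis
  note sl = square_slices[OF K(1)]
  have const: "K (s, c) = K (0, c)" if "c \<in> {0, 1}" "s \<in> {0..1}" for s c
    by (rule lift_unique[of "{0..1}" "\<lambda>s. K (s, c)" "\<lambda>_. K (0, c)" 0])
      (use that sl(2)[of c] K(3) h(5) in auto)
  have "K (0, 1) = g 1"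
    by (rule lifts_unique[of \<gamma> "\<lambda>t. K (0, t)"]) (use sl(1)[of 0] K h(3) g in \<open>auto simp: lifts_def\<close>)
  moreover have "K (1, 1) = k 1"
    by (rule lifts_unique[of \<delta> "\<lambda>t. K (1, t)"])
      (use sl(1)[of 1] K h(4) k const[of 0 1] 0 in \<open>auto simp: lifts_def\<close>)
  ultimately show ?thesis using const[of 1 1] by simp
qed

lemma G_carrier: "carrier G = loop_class S ` loops_at S p"
  and G_mult: "A \<otimes>\<^bsub>G\<^esub> B = (\<Union>\<alpha>\<in>A. \<Union>\<beta>\<in>B. loop_class S (\<alpha> +++ \<beta>))"
  and G_one: "\<one>\<^bsub>G\<^esub> = loop_class S (\<lambda>_. p)"
  by (simp_all add: fundamental_group_def)

lemma loop_class_eq: "homotopic_paths S \<gamma> \<delta> \<Longrightarrow> loop_class S \<gamma> = loop_class S \<delta>"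
proof -
  assume h: "homotopic_paths S \<gamma> \<delta>"
  note h' = homotopic_paths_sym[OF h]
  have "homotopic_paths S \<gamma> x \<longleftrightarrow> homotopic_paths S \<delta> x" for x
    using homotopic_paths_trans[OF h, of x] homotopic_paths_trans[OF h', of x] by blast
  then show ?thesis unfolding loop_class_def by (intro Collect_cong)
qed

lemma loop_class_self: "\<gamma> \<in> loops_at S p \<Longrightarrow> \<gamma> \<in> loop_class S \<gamma>"
  by (simp add: loop_class_def loops_at_def)

lemma carrier_mem:
  assumes "A \<in> carrier G" "\<gamma> \<in> A"
  shows "\<gamma> \<in> loops_at S p" "A = loop_class S \<gamma>"
proof -
  obtain \<delta> where \<delta>: "\<delta> \<in> loops_at S p" "A = loop_class S \<delta>" using assms by (auto simp: G_carrier)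
  then have hom: "homotopic_paths S \<delta> \<gamma>" using assms by (simp add: loop_class_def)
  then show "A = loop_class S \<gamma>" using loop_class_eq \<delta> by simp
  show "\<gamma> \<in> loops_at S p"
    using \<delta>(1) homotopic_paths_imp_path[OF hom] homotopic_paths_imp_subset[OF hom]
      homotopic_paths_imp_pathstart[OF hom] homotopic_paths_imp_pathfinish[OF hom]
    by (simp add: loops_at_def)
qed

lemma carrier_obtain:
  assumes "A \<in> carrier G"
  obtains \<gamma> where "\<gamma> \<in> A" "\<gamma> \<in> loops_at S p" "A = loop_class S \<gamma>"
proof -
  obtain \<gamma> where \<gamma>: "\<gamma> \<in> loops_at S p" "A = loop_class S \<gamma>" using assms unfolding G_carrier by blast
  then show ?thesis using loop_class_self[OF \<gamma>(1)] that by blast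
qed

lemma join_in_loops: "\<alpha> \<in> loops_at S p \<Longrightarrow> \<beta> \<in> loops_at S p \<Longrightarrow> \<alpha> +++ \<beta> \<in> loops_at S p"
  by (auto simp: loops_at_def path_image_join)

lemma mult_loop_class:
  assumes "\<alpha> \<in> loops_at S p" "\<beta> \<in> loops_at S p"
  shows "loop_class S \<alpha> \<otimes>\<^bsub>G\<^esub> loop_class S \<beta> = loop_class S (\<alpha> +++ \<beta>)"
proof -
  have "loop_class S (\<alpha>' +++ \<beta>') = loop_class S (\<alpha> +++ \<beta>)" if "\<alpha>' \<in> loop_class S \<alpha>" "\<beta>' \<in> loop_class S \<beta>" for \<alpha>' \<beta>'
  proof -
    have "homotopic_paths S (\<alpha> +++ \<beta>) (\<alpha>' +++ \<beta>')"
      by (rule homotopic_paths_join) (use that assms in \<open>auto simp: loop_class_def loops_at_def\<close>)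
    then show ?thesis using loop_class_eq by simp
  qed
  then show ?thesis unfolding G_mult using loop_class_self assms by blast
qed

text \<open>The deck transformation that takes \<open>\<i>\<close> to the end of the lift at
  \<open>\<i>\<close> of a representing loop. The choice is determined on the half-plane only, so
  the identities for it carry \<open>Im z > 0\<close>.\<close>

definition holo :: "(real \<Rightarrow> 'a) set \<Rightarrow> complex \<Rightarrow> complex" where
  "holo A = (SOME h. deck h \<and> (\<exists>\<gamma> g. \<gamma> \<in> A \<and> lifts \<gamma> g \<and> g 0 = \<i> \<and> g 1 = h \<i>))"

lemma holo_deck: "A \<in> carrier G \<Longrightarrow> deck (holo A)"
  and holo_end: "\<lbrakk>A \<in> carrier G; \<gamma> \<in> A; lifts \<gamma> g; g 0 = \<i>\<rbrakk> \<Longrightarrow> g 1 = holo A \<i>"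
proof -
  have *: "deck (holo A) \<and> (\<exists>\<gamma> g. \<gamma> \<in> A \<and> lifts \<gamma> g \<and> g 0 = \<i> \<and> g 1 = holo A \<i>)" if A: "A \<in> carrier G" for A
  proof -
    obtain \<gamma> where \<gamma>: "\<gamma> \<in> A" "\<gamma> \<in> loops_at S p" using carrier_obtain[OF A] .
    obtain g where g: "lifts \<gamma> g" "g 0 = \<i>" using lift_path[OF \<gamma>(2), of \<i>] E_base by auto
    have "Im (g 1) > 0" "E \<i> = E (g 1)" using g \<gamma> E_base by (auto simp: lifts_def loops_at_def pathfinish_def)
    then obtain h where "deck h" "h \<i> = g 1" using deck_exists[of \<i>] by auto
    then have "\<exists>h. deck h \<and> (\<exists>\<gamma> g. \<gamma> \<in> A \<and> lifts \<gamma> g \<and> g 0 = \<i> \<and> g 1 = h \<i>)" using \<gamma> g by metis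
    then show ?thesis unfolding holo_def by (rule someI_ex)
  qed
  show "A \<in> carrier G \<Longrightarrow> deck (holo A)" using * by blast
  assume A: "A \<in> carrier G" "\<gamma> \<in> A" and g: "lifts \<gamma> g" "g 0 = \<i>"
  obtain \<delta> k where \<delta>: "\<delta> \<in> A" "lifts \<delta> k" "k 0 = \<i>" "k 1 = holo A \<i>" using * A by blast
  have "homotopic_paths S \<gamma> \<delta>" using carrier_mem(2)[OF A] \<delta>(1) by (simp add: loop_class_def)
  from homotopic_lifts_end[OF this g(1) \<delta>(2)] show "g 1 = holo A \<i>" using g \<delta> by simp
qed

lemma lifts_join:
  assumes g: "lifts \<alpha> g" and k: "lifts \<beta> k" and "g 1 = k 0"
  shows "lifts (\<alpha> +++ \<beta>) (g +++ k)"
proof -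
  have "path (g +++ k)" using assms by (auto simp: lifts_def path_def[symmetric] pathstart_def pathfinish_def)
  then show ?thesis using g k by (auto simp: lifts_def path_def joinpaths_def)
qed

text \<open>The lift of a product of loops is the lift of the first followed by the translate under
  \<open>holo A\<close> of the lift of the second.\<close>

lemma holo_mult_closed:
  assumes A: "A \<in> carrier G" and B: "B \<in> carrier G"
  shows "A \<otimes>\<^bsub>G\<^esub> B \<in> carrier G" "Im z > 0 \<Longrightarrow> holo (A \<otimes>\<^bsub>G\<^esub> B) z = holo A (holo B z)"
proof -
  obtain \<alpha> where \<alpha>: "\<alpha> \<in> A" "\<alpha> \<in> loops_at S p" "A = loop_class S \<alpha>" using carrier_obtain[OF A] .
  obtain \<beta> where \<beta>: "\<beta> \<in> B" "\<beta> \<in> loops_at S p" "B = loop_class S \<beta>" using carrier_obtain[OF B] .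
  have AB: "A \<otimes>\<^bsub>G\<^esub> B = loop_class S (\<alpha> +++ \<beta>)" using mult_loop_class \<alpha> \<beta> by simp
  show car: "A \<otimes>\<^bsub>G\<^esub> B \<in> carrier G" unfolding AB G_carrier using join_in_loops \<alpha> \<beta> by blast
  obtain g where g: "lifts \<alpha> g" "g 0 = \<i>" using lift_path[OF \<alpha>(2), of \<i>] E_base by auto
  obtain k where k: "lifts \<beta> k" "k 0 = \<i>" using lift_path[OF \<beta>(2), of \<i>] E_base by auto
  note dA = holo_deck[OF A] and dB = holo_deck[OF B]
  have "lifts \<beta> (\<lambda>t. holo A (k t))" 
    using k deck_comp_cont[OF dA, of "{0..1}" k] deck_in[OF dA] deck_E[OF dA]
    unfolding lifts_def by auto
  then have "lifts (\<alpha> +++ \<beta>) (g +++ (\<lambda>t. holo A (k t)))"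
    using lifts_join[OF g(1)] holo_end[OF A \<alpha>(1) g] k by simp
  moreover have "\<alpha> +++ \<beta> \<in> A \<otimes>\<^bsub>G\<^esub> B" unfolding AB using loop_class_self join_in_loops \<alpha> \<beta> by blast
  ultimately have "(g +++ (\<lambda>t. holo A (k t))) 1 = holo (A \<otimes>\<^bsub>G\<^esub> B) \<i>"
    using holo_end[OF car] g by (simp add: joinpaths_def)
  then have "holo (A \<otimes>\<^bsub>G\<^esub> B) \<i> = holo A (holo B \<i>)"
    using holo_end[OF B \<beta>(1) k] by (simp add: joinpaths_def)
  then show "holo (A \<otimes>\<^bsub>G\<^esub> B) z = holo A (holo B z)" if "Im z > 0"
    using deck_unique[OF holo_deck[OF car] deck_comp[OF dA dB], of \<i> z] that by simp
qed

text \<open>Lifts with common ends are homotopic in the simply connected half-plane, and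
  \<open>E\<close> projects the homotopy to S.\<close>

lemma holo_inj:
  assumes A: "A \<in> carrier G" and B: "B \<in> carrier G" and eq: "holo A \<i> = holo B \<i>"
  shows "A = B"
proof -
  obtain \<alpha> where \<alpha>: "\<alpha> \<in> A" "\<alpha> \<in> loops_at S p" "A = loop_class S \<alpha>" using carrier_obtain[OF A] .
  obtain \<beta> where \<beta>: "\<beta> \<in> B" "\<beta> \<in> loops_at S p" "B = loop_class S \<beta>" using carrier_obtain[OF B] .
  obtain g where g: "lifts \<alpha> g" "g 0 = \<i>" using lift_path[OF \<alpha>(2), of \<i>] E_base by auto
  obtain k where k: "lifts \<beta> k" "k 0 = \<i>" using lift_path[OF \<beta>(2), of \<i>] E_base by auto
  have fin: "g 1 = k 1" using holo_end[OF A \<alpha>(1) g] holo_end[OF B \<beta>(1) k] eq by simp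
  have pg: "path g" "path_image g \<subseteq> hyp_plane" "path k" "path_image k \<subseteq> hyp_plane"
    using g k by (auto simp: lifts_def path_def path_image_def)
  have "homotopic_paths hyp_plane g k"
    using convex_imp_simply_connected[OF convex_hyp_plane] pg fin g k
    unfolding simply_connected_eq_homotopic_paths by (auto simp: pathstart_def pathfinish_def)
  then have "homotopic_paths S (E \<circ> g) (E \<circ> k)"
    by (rule homotopic_paths_continuous_image[OF _ E_cont]) (use E_in in auto)
  moreover have "homotopic_paths S \<alpha> (E \<circ> g)" "homotopic_paths S \<beta> (E \<circ> k)"
    by (rule homotopic_paths_eq; use \<alpha> \<beta> g k in \<open>auto simp: loops_at_def lifts_def\<close>)+
  ultimately have "homotopic_paths S \<alpha> \<beta>" by (meson homotopic_paths_sym homotopic_paths_trans)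
  then show ?thesis using \<alpha> \<beta> loop_class_eq by simp
qed

lemma holo_surj:
  assumes h: "deck h" obtains A where "A \<in> carrier G" "\<And>z. Im z > 0 \<Longrightarrow> holo A z = h z"
proof -
  define \<gamma> where "\<gamma> = E \<circ> linepath \<i> (h \<i>)"
  have seg: "closed_segment \<i> (h \<i>) \<subseteq> hyp_plane"
    by (rule closed_segment_subset[OF _ _ convex_hyp_plane]) (use deck_in[OF h, of \<i>] in auto)
  have lp: "linepath \<i> (h \<i>) t \<in> hyp_plane" if "t \<in> {0..1}" for t
    using seg that linepath_in_path by blast
  have "path \<gamma>" unfolding \<gamma>_def
    by (rule path_continuous_image) (use seg E_cont in \<open>auto intro: continuous_on_subset\<close>)
  moreover have "path_image \<gamma> \<subseteq> S" unfolding \<gamma>_def path_image_def using lp E_in by auto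
  moreover have "\<gamma> 0 = p" "\<gamma> 1 = p"
    using E_base deck_E[OF h, of \<i>] by (auto simp: \<gamma>_def linepath_def)
  ultimately have \<gamma>: "\<gamma> \<in> loops_at S p" by (simp add: loops_at_def pathstart_def pathfinish_def)
  define A where "A = loop_class S \<gamma>"
  have A: "A \<in> carrier G" unfolding A_def G_carrier using \<gamma> by blast
  have "lifts \<gamma> (linepath \<i> (h \<i>))" unfolding lifts_def \<gamma>_def
    using lp continuous_on_linepath by auto
  then have "linepath \<i> (h \<i>) 1 = holo A \<i>"
    using holo_end[OF A, of \<gamma>] loop_class_self[OF \<gamma>] unfolding A_def by (simp add: linepath_def)
  then have "holo A \<i> = h \<i>" by (simp add: linepath_def)
  then have "holo A z = h z" if "Im z > 0" for z using deck_unique[OF holo_deck[OF A] h, of \<i> z] that by simp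
  then show ?thesis using A that by blast
qed

lemma G_one_closed: "\<one>\<^bsub>G\<^esub> \<in> carrier G"
  unfolding G_carrier G_one
  by (rule imageI) (use p_in in \<open>auto simp: loops_at_def path_def path_image_def pathstart_def pathfinish_def\<close>)

lemma holo_one: "Im z > 0 \<Longrightarrow> holo \<one>\<^bsub>G\<^esub> z = z"
proof -
  have "(\<lambda>_. p) \<in> \<one>\<^bsub>G\<^esub>" unfolding G_one
    by (rule loop_class_self) (use p_in in \<open>auto simp: loops_at_def path_def path_image_def pathstart_def pathfinish_def\<close>)
  moreover have "lifts (\<lambda>_. p) (\<lambda>_. \<i>)" using E_base by (auto simp: lifts_def)
  ultimately have "\<i> = holo \<one>\<^bsub>G\<^esub> \<i>" using holo_end[OF G_one_closed] by blast
  then show "Im z > 0 \<Longrightarrow> holo \<one>\<^bsub>G\<^esub> z = z" using deck_unique[OF holo_deck[OF G_one_closed] deck_id, of \<i> z] by simp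
qed

lemma holo_in: "A \<in> carrier G \<Longrightarrow> Im z > 0 \<Longrightarrow> Im (holo A z) > 0"
  using holo_deck deck_in by blast

text \<open>The group laws are read off from composition of deck transformations through
  \<open>holo_inj\<close>, in place of explicit reparametrizations of loops.\<close>

lemma group_G: "group G"
proof (rule groupI)
  show "x \<otimes>\<^bsub>G\<^esub> y \<in> carrier G" if "x \<in> carrier G" "y \<in> carrier G" for x y
    by (rule holo_mult_closed(1)[OF that])
  show "\<one>\<^bsub>G\<^esub> \<in> carrier G" by (rule G_one_closed)
  show "x \<otimes>\<^bsub>G\<^esub> y \<otimes>\<^bsub>G\<^esub> z = x \<otimes>\<^bsub>G\<^esub> (y \<otimes>\<^bsub>G\<^esub> z)" if "x \<in> carrier G" "y \<in> carrier G" "z \<in> carrier G" for x y z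
    by (rule holo_inj) (use that in \<open>simp_all add: holo_mult_closed holo_in\<close>)
  show "\<one>\<^bsub>G\<^esub> \<otimes>\<^bsub>G\<^esub> x = x" if "x \<in> carrier G" for x
    by (rule holo_inj) (use that in \<open>simp_all add: holo_mult_closed holo_one G_one_closed holo_in\<close>)
  show "\<exists>y\<in>carrier G. y \<otimes>\<^bsub>G\<^esub> x = \<one>\<^bsub>G\<^esub>" if x: "x \<in> carrier G" for x
  proof -
    obtain k where k: "deck k" "\<And>z. Im z > 0 \<Longrightarrow> k (holo x z) = z" using deck_inverse[OF holo_deck[OF x]] by metis
    obtain y where y: "y \<in> carrier G" "\<And>z. Im z > 0 \<Longrightarrow> holo y z = k z" using holo_surj[OF k(1)] by metis
    have "y \<otimes>\<^bsub>G\<^esub> x = \<one>\<^bsub>G\<^esub>"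
      by (rule holo_inj) (use x y k in \<open>simp_all add: holo_mult_closed holo_one G_one_closed holo_in\<close>)
    then show ?thesis using y by blast
  qed
qed

section \<open>Lifts of closed geodesics and the axis of an element\<close>

lemma closed_geodesic_cont:
  assumes "closed_geodesic S c l" shows "continuous_on X c"
proof -
  have "continuous_on UNIV c" unfolding continuous_on_iff
  proof (intro ballI allI impI)
    fix t e assume e: "(e::real) > 0"
    obtain d where d: "d > 0" "\<forall>s\<in>{t - d<..<t + d}. \<forall>s'\<in>{t - d<..<t + d}. dist (c s) (c s') = \<bar>s - s'\<bar>"
      using assms unfolding closed_geodesic_def by blast
    have "dist (c s) (c t) < e" if "dist s t < min d e" for s
    proof -
      have "s \<in> {t - d<..<t + d}" "t \<in> {t - d<..<t + d}" using that d(1) by (auto simp: dist_real_def)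
      then have "dist (c s) (c t) = \<bar>s - t\<bar>" using d(2) by blast
      then show ?thesis using that by (simp add: dist_real_def)
    qed
    then show "\<exists>d>0. \<forall>x'\<in>UNIV. dist x' t < d \<longrightarrow> dist (c x') (c t) < e"
      using d(1) e by (intro exI[of _ "min d e"]) auto
  qed
  then show ?thesis by (rule continuous_on_subset) simp
qed

lemma geodesic_lift:
  assumes c: "closed_geodesic S c l" and z: "Im z > 0" "E z = c 0"
  shows "\<exists>J. hyp_line J \<and> (\<forall>t. E (J t) = c t) \<and> J 0 = z"
proof -
  have cS: "c x \<in> S" for x using c unfolding closed_geodesic_def by blast
  have "\<exists>J. continuous_on UNIV J \<and> (\<forall>x\<in>UNIV. Im (J x) > 0 \<and> E (J x) = c x) \<and> J 0 = z"
    by (rule lift_exists) (use cS z closed_geodesic_cont[OF c] in auto)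
  then obtain J where J: "continuous_on UNIV J" "\<And>x. Im (J x) > 0" "\<And>x. E (J x) = c x" "J 0 = z" by auto
  have "hyp_line J"
  proof (rule lift_local_geodesic[OF J(1,2)])
    show "\<exists>e>0. \<forall>s\<in>{t - e<..<t + e}. \<forall>s'\<in>{t - e<..<t + e}. dist (E (J s)) (E (J s')) = \<bar>s - s'\<bar>" for t
      using c unfolding closed_geodesic_def J(3) by blast
  qed
  then show ?thesis using J by blast
qed

lemma line_lift_unique:
  assumes "hyp_line J" "hyp_line J'" "\<And>t. E (J t) = E (J' t)" "J s = J' s"
  shows "J t = J' t"
  by (rule lift_unique[of UNIV J J' s])
    (use assms hyp_line_cont hyp_lineD(1) in auto)

text \<open>Lift the free homotopy from the loop to the geodesic. The two tracks of the base point,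
  being lifts of one path, differ by \<open>holo A\<close>; the final side is a piece of a lift
  \<open>J\<close> of \<open>c\<close>. Hence \<open>holo A\<close> takes \<open>J 0\<close> to
  \<open>J l\<close>, and uniqueness of lifts gives the translation everywhere.\<close>

lemma holonomy_axis:
  assumes A: "A \<in> carrier G" and rep: "represents_geodesic S A c l"
  shows "\<exists>J. hyp_line J \<and> (\<forall>t. E (J t) = c t) \<and> (\<forall>t. holo A (J t) = J (t + l))"
proof -
  have c: "closed_geodesic S c l" using rep unfolding represents_geodesic_def by blast
  obtain \<gamma> where \<gamma>: "\<gamma> \<in> A" "homotopic_loops S \<gamma> (\<lambda>t. c (l * t))"
    using rep unfolding represents_geodesic_def by blast
  note \<gamma>l = carrier_mem(1)[OF A \<gamma>(1)]
  obtain h where h: "continuous_on ({0..1} \<times> {0..1}) h" "h \<in> {0..1} \<times> {0..1} \<rightarrow> S"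
    "\<forall>x\<in>{0..1}. h (0, x) = \<gamma> x" "\<forall>x\<in>{0..1}. h (1, x) = c (l * x)"
    "\<forall>t\<in>{0..1::real}. h (t, 1) = h (t, 0)"
    using \<gamma>(2) unfolding homotopic_loops by (auto simp: pathstart_def pathfinish_def)
  have i: "Im \<i> > 0" "E \<i> = h (0, 0)" using h(3) \<gamma>l E_base by (auto simp: loops_at_def pathstart_def)
  obtain K where K: "continuous_on ({0..1} \<times> {0..1}) K" "K (0, 0) = \<i>"
    "\<And>s t. s \<in> {0..1} \<Longrightarrow> t \<in> {0..1} \<Longrightarrow> Im (K (s, t)) > 0 \<and> E (K (s, t)) = h (s, t)"
    using lift_square[OF h(1,2) i] by metis
  note sl = square_slices[OF K(1)] and dA = holo_deck[OF A]
  have "K (0, 1) = holo A \<i>"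
    by (rule holo_end[OF A \<gamma>(1), of "\<lambda>t. K (0, t)"]) (use sl(1)[of 0] K h(3) in \<open>auto simp: lifts_def\<close>)
  then have K1: "K (s, 1) = holo A (K (s, 0))" if "s \<in> {0..1}" for s
    using lift_unique[of "{0..1}" "\<lambda>s. K (s, 1)" "\<lambda>s. holo A (K (s, 0))" 0 s]
      that sl(2)[of 0] sl(2)[of 1] K h(5) deck_in[OF dA] deck_E[OF dA]
      deck_comp_cont[OF dA sl(2)[of 0]] by simp
  have z: "Im (K (1, 0)) > 0" "E (K (1, 0)) = c 0" using K(3)[of 1 0] h(4) by auto
  obtain J where J: "hyp_line J" "\<forall>t. E (J t) = c t" "J 0 = K (1, 0)" using geodesic_lift[OF c z] by blast
  have "K (1, 1) = J (l * 1)"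
    by (rule lift_unique[of "{0..1}" "\<lambda>t. K (1, t)" "\<lambda>t. J (l * t)" 0 1])
      (use J K(3)[of 1] h(4) sl(1)[of 1] hyp_lineD(1)[OF J(1)] in
        \<open>auto intro!: continuous_on_compose2[OF hyp_line_cont[OF J(1), of UNIV]] continuous_intros\<close>)
  then have Jl: "holo A (J 0) = J (0 + l)" using K1[of 1] J by simp
  have per: "c (t + l) = c t" for t using c unfolding closed_geodesic_def has_period_def by blast
  have "holo A (J t) = J (t + l)" for t
    using line_lift_unique[OF deck_line[OF dA J(1)] hyp_line_shift[OF J(1), of l], of 0 t]
      J per Jl deck_E[OF dA hyp_lineD(1)[OF J(1)]] by simp
  then show ?thesis using J by blast
qed

end

section \<open>Crossing geodesics\<close>

lemma line_parametrization:
  assumes "hyp_line B"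
  shows "\<exists>a b c d. a * d - b * c > 0 \<and> (\<forall>s. B s = mob a b c d (vert s))"
proof -
  obtain f where f: "is_mob f" "\<forall>t. f (B t) = vert t" using hyp_line_normalize[OF assms] by blast
  obtain a b c d where abcd: "a * d - b * c > 0" "\<forall>z\<in>hyp_plane. f z = mob a b c d z"
    using f(1) unfolding is_mob_def by blast
  have "B s = mob d (-b) (-c) a (vert s)" for s
  proof -
    have "mob a b c d (B s) = vert s" using abcd(2) f(2) hyp_lineD(1)[OF assms, of s] by (metis hyp_planeI)
    then show ?thesis using mob_inverse[OF abcd(1) hyp_lineD(1)[OF assms, of s]] by metis
  qed
  moreover have "d * a - (- b) * (- c) > 0" using abcd by (simp add: mult.commute)
  ultimately show ?thesis by blast
qed

text \<open>The polynomial is the numerator of \<open>Re (f z)\<close> for the map \<open>f\<close>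
  normalizing the line; its discriminant is the square of the determinant of
  \<open>f\<close>.\<close>

lemma line_equation:
  assumes Q: "hyp_line Q"
  shows "\<exists>p q w. q\<^sup>2 > 4 * p * w \<and> (\<forall>z. Im z > 0 \<longrightarrow> (p * (cmod z)\<^sup>2 + q * Re z + w = 0 \<longleftrightarrow> z \<in> range Q))"
proof -
  obtain f where f: "is_mob f" "\<forall>t. f (Q t) = vert t" using hyp_line_normalize[OF Q] by blast
  note g = hyp_isom_mob[OF f(1)]
  obtain a b c d where abcd: "a * d - b * c > 0" "\<forall>z\<in>hyp_plane. f z = mob a b c d z"
    using f(1) unfolding is_mob_def by blast
  have "a * c * (cmod z)\<^sup>2 + (a * d + b * c) * Re z + b * d = 0 \<longleftrightarrow> z \<in> range Q" if z: "Im z > 0" for z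
  proof -
    have "a * c * (cmod z)\<^sup>2 + (a * d + b * c) * Re z + b * d = 0 \<longleftrightarrow> Re (f z) = 0"
      using abcd(2) z mob_denom_nz[OF abcd(1) z] by (simp add: mob_Re_Im)
    also have "\<dots> \<longleftrightarrow> z \<in> range Q"
    proof
      assume "Re (f z) = 0"
      then have "f z = vert (ln (Im (f z)))" using hyp_isom_in[OF g z] by (simp add: complex_eq_iff)
      then have "f z = f (Q (ln (Im (f z))))" using f(2) by simp
      then have "hD z (Q (ln (Im (f z)))) = 0"
        using hyp_isom_dist[OF g z hyp_lineD(1)[OF Q]] by (metis hyp_dist_self)
      then show "z \<in> range Q" using hyp_dist_eq_0_iff[OF z hyp_lineD(1)[OF Q]] by blast
    next
      assume "z \<in> range Q" then show "Re (f z) = 0" using f(2) by auto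
    qed
    finally show ?thesis .
  qed
  moreover have "(a * d + b * c)\<^sup>2 - 4 * (a * c) * (b * d) = (a * d - b * c)\<^sup>2" by algebra
  then have "(a * d + b * c)\<^sup>2 > 4 * (a * c) * (b * d)" using abcd(1) by (smt (verit) zero_less_power)
  ultimately show ?thesis by blast
qed

text \<open>The ends of \<open>B\<close> on the real line are a/c and b/d. Meeting the imaginary
  axis at time s1 means \<open>a * c * (exp s1)\<^sup>2 + b * d = 0\<close>; leaving the axis
  excludes ac = bd = 0, so the two ends have opposite signs.\<close>

lemma crossing_endpoints:
  assumes B: "hyp_line B" and cross: "Re (B s1) = 0" and trans: "Re (B u) \<noteq> 0"
  shows "\<exists>bp bm. bp * bm < 0 \<and> ((\<lambda>s. Im (B s)) \<longlongrightarrow> 0) at_top \<and> ((\<lambda>s. Im (B s)) \<longlongrightarrow> 0) at_bot \<and>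
    ((\<lambda>s. Re (B s)) \<longlongrightarrow> bp) at_top \<and> ((\<lambda>s. Re (B s)) \<longlongrightarrow> bm) at_bot"
proof -
  obtain a b c d where det: "a * d - b * c > 0" and Bs: "\<forall>s. B s = mob a b c d (vert s)"
    using line_parametrization[OF B] by blast
  have den: "(cmod (of_real c * vert s + of_real d))\<^sup>2 = c\<^sup>2 * (exp s)\<^sup>2 + d\<^sup>2" for s
    by (simp add: cmod_power2 power_mult_distrib)
  have cv: "(cmod (vert s))\<^sup>2 = (exp s)\<^sup>2" for s by (simp add: cmod_power2)
  have Re: "Re (B s) = (a * c * (exp s)\<^sup>2 + b * d) / (c\<^sup>2 * (exp s)\<^sup>2 + d\<^sup>2)"
    and Im: "Im (B s) = (a * d - b * c) * exp s / (c\<^sup>2 * (exp s)\<^sup>2 + d\<^sup>2)" for s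
    using Bs by (simp_all add: mob_Re_Im den cv)
  have pos: "c\<^sup>2 * (exp s)\<^sup>2 + d\<^sup>2 > 0" for s
    using det by (cases "c = 0") (auto simp: add_pos_nonneg)
  have cr: "a * c * (exp s1)\<^sup>2 + b * d = 0" using cross pos[of s1] unfolding Re by simp
  have tr: "a * c * (exp u)\<^sup>2 + b * d \<noteq> 0" using trans unfolding Re by auto
  have ac: "a * c \<noteq> 0" using cr tr by auto
  have bd: "b * d \<noteq> 0" using cr ac by auto
  have nz: "c \<noteq> 0" "d \<noteq> 0" using ac bd by auto
  have "(a / c) * (b / d) = (a * c) * (b * d) / (c\<^sup>2 * d\<^sup>2)" using nz by (simp add: field_simps power2_eq_square)
  also have "b * d = - (a * c * (exp s1)\<^sup>2)" using cr by simp
  also have "(a * c) * (- (a * c * (exp s1)\<^sup>2)) / (c\<^sup>2 * d\<^sup>2) = - ((a * c)\<^sup>2 * (exp s1)\<^sup>2 / (c\<^sup>2 * d\<^sup>2))"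
    by (simp add: power2_eq_square)
  also have "\<dots> < 0" using ac nz by simp
  finally have neg: "(a / c) * (b / d) < 0" .
  have e: "((\<lambda>s. exp s) \<longlongrightarrow> (0::real)) at_bot" by (rule exp_at_bot)
  have i: "((\<lambda>s. exp (- s)) \<longlongrightarrow> (0::real)) at_top"
    by (rule filterlim_compose[OF exp_at_bot filterlim_uminus_at_bot_at_top])
  have bot: "((\<lambda>s. Re (B s)) \<longlongrightarrow> (a * c * 0\<^sup>2 + b * d) / (c\<^sup>2 * 0\<^sup>2 + d\<^sup>2)) at_bot"
    "((\<lambda>s. Im (B s)) \<longlongrightarrow> (a * d - b * c) * 0 / (c\<^sup>2 * 0\<^sup>2 + d\<^sup>2)) at_bot"
    unfolding Re Im by (intro tendsto_intros e; use nz in simp)+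
  \<comment> \<open>Expansion by \<open>(exp (- s))\<^sup>2\<close>, which turns the limit at
    +infinity into one of a convergent expression.\<close>
  have Re': "Re (B s) = (a * c + b * d * (exp (- s))\<^sup>2) / (c\<^sup>2 + d\<^sup>2 * (exp (- s))\<^sup>2)"
    and Im': "Im (B s) = (a * d - b * c) * exp (- s) / (c\<^sup>2 + d\<^sup>2 * (exp (- s))\<^sup>2)" for s
  proof -
    define k where "k = (exp (- s))\<^sup>2"
    have k1: "(exp s)\<^sup>2 * k = 1"
      unfolding k_def by (simp add: exp_minus flip: power_mult_distrib)
    have k2: "exp s * k = exp (- s)" "k \<noteq> 0"
      unfolding k_def by (simp_all add: exp_minus power2_eq_square)
    note k = k1 k2
    have "(a * c * (exp s)\<^sup>2 + b * d) * k = a * c * ((exp s)\<^sup>2 * k) + b * d * k"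
      "(c\<^sup>2 * (exp s)\<^sup>2 + d\<^sup>2) * k = c\<^sup>2 * ((exp s)\<^sup>2 * k) + d\<^sup>2 * k"
      "(a * d - b * c) * exp s * k = (a * d - b * c) * (exp s * k)" by (simp_all add: algebra_simps)
    moreover have "Re (B s) = ((a * c * (exp s)\<^sup>2 + b * d) * k) / ((c\<^sup>2 * (exp s)\<^sup>2 + d\<^sup>2) * k)"
      "Im (B s) = ((a * d - b * c) * exp s * k) / ((c\<^sup>2 * (exp s)\<^sup>2 + d\<^sup>2) * k)"
      unfolding Re Im using k(3) by simp_all
    ultimately show "Re (B s) = (a * c + b * d * (exp (- s))\<^sup>2) / (c\<^sup>2 + d\<^sup>2 * (exp (- s))\<^sup>2)"
      "Im (B s) = (a * d - b * c) * exp (- s) / (c\<^sup>2 + d\<^sup>2 * (exp (- s))\<^sup>2)"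
      unfolding k(1,2) by (simp_all add: k_def)
  qed
  have top: "((\<lambda>s. Re (B s)) \<longlongrightarrow> (a * c + b * d * 0\<^sup>2) / (c\<^sup>2 + d\<^sup>2 * 0\<^sup>2)) at_top"
    "((\<lambda>s. Im (B s)) \<longlongrightarrow> (a * d - b * c) * 0 / (c\<^sup>2 + d\<^sup>2 * 0\<^sup>2)) at_top"
    unfolding Re' Im' by (intro tendsto_intros i; use nz in simp)+
  show ?thesis
    by (intro exI[of _ "a / c"] exI[of _ "b / d"]) (use neg bot top nz in \<open>simp add: power2_eq_square\<close>)
qed

text \<open>A line is the zero set of \<open>p |z|\<^sup>2 + q Re z + w\<close>; passing close to both ends of the imaginary
  axis forces \<open>p, w\<close> to be small against \<open>q\<close>, so the sign is that of \<open>q Re z\<close>.\<close>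

lemma sign_off_line:
  fixes p q w M m \<eta> :: real
  assumes disc: "q\<^sup>2 > 4 * p * w" and eta: "0 < \<eta>" "\<eta> \<le> 1/2" "2 * \<eta> * (M\<^sup>2 + 1) < m"
    and zm: "p * (cmod zm)\<^sup>2 + q * Re zm + w = 0" "cmod zm \<le> \<eta>"
    and zp: "p * (cmod zp)\<^sup>2 + q * Re zp + w = 0" "cmod zp \<ge> 1 / \<eta>"
    and P: "cmod P \<le> M" "\<bar>Re P\<bar> \<ge> m"
  shows "(p * (cmod P)\<^sup>2 + q * Re P + w) * (q * Re P) > 0"
proof -
  have "\<bar>w\<bar> \<le> \<bar>p * (cmod zm)\<^sup>2\<bar> + \<bar>q * Re zm\<bar>" using zm(1) by linarith
  also have "\<dots> \<le> \<bar>p\<bar> * \<eta>\<^sup>2 + \<bar>q\<bar> * \<eta>" unfolding abs_mult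
    using zm(2) abs_Re_le_cmod[of zm] by (intro add_mono mult_mono power_mono) auto
  finally have w1: "\<bar>w\<bar> \<le> \<bar>p\<bar> * \<eta>\<^sup>2 + \<bar>q\<bar> * \<eta>" .
  have zp0: "cmod zp > 0" using zp(2) eta(1) by (smt (verit) divide_pos_pos)
  have "1 / cmod zp \<le> \<eta>" using zp(2) eta(1) zp0 by (simp add: field_simps)
  have "p * (cmod zp)\<^sup>2 = - (q * Re zp) - w" using zp(1) by linarith
  then have "\<bar>p\<bar> * (cmod zp)\<^sup>2 \<le> \<bar>q * Re zp\<bar> + \<bar>w\<bar>"
    by (metis abs_mult abs_of_nonneg zero_le_power2 abs_triangle_ineq4 abs_minus_cancel)
  also have "\<dots> \<le> \<bar>q\<bar> * cmod zp + \<bar>w\<bar>" unfolding abs_mult using abs_Re_le_cmod[of zp] by (simp add: mult_left_mono)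
  finally have "\<bar>p\<bar> \<le> (\<bar>q\<bar> * cmod zp + \<bar>w\<bar>) / (cmod zp)\<^sup>2" using zp0 by (simp add: field_simps)
  also have "\<dots> = \<bar>q\<bar> * (1 / cmod zp) + \<bar>w\<bar> * (1 / cmod zp)\<^sup>2" using zp0 by (simp add: field_simps power2_eq_square)
  also have "\<dots> \<le> \<bar>q\<bar> * \<eta> + \<bar>w\<bar> * \<eta>\<^sup>2"
    using \<open>1 / cmod zp \<le> \<eta>\<close> zp0 by (intro add_mono mult_left_mono power_mono) auto
  finally have p1: "\<bar>p\<bar> \<le> \<bar>q\<bar> * \<eta> + \<bar>w\<bar> * \<eta>\<^sup>2" .
  \<comment> \<open>\<open>w1\<close> and \<open>p1\<close> each bound one coefficient partly by the
    other one; adding them and absorbing the \<eta>^2 term decouples them.\<close>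
  have "\<bar>p\<bar> + \<bar>w\<bar> \<le> 2 * \<bar>q\<bar> * \<eta> + (\<bar>p\<bar> + \<bar>w\<bar>) * \<eta>\<^sup>2" using w1 p1 by (simp add: algebra_simps)
  moreover have "\<eta>\<^sup>2 \<le> 1/4" using power_mono[OF eta(2), of 2] eta(1) by (simp add: power2_eq_square)
  then have "(\<bar>p\<bar> + \<bar>w\<bar>) * \<eta>\<^sup>2 \<le> (\<bar>p\<bar> + \<bar>w\<bar>) * (1/4)" by (intro mult_left_mono) auto
  moreover have "0 \<le> \<bar>q\<bar> * \<eta>" using eta(1) by simp
  moreover have "x \<le> 4 * y" if "x \<le> 2 * y + z" "z \<le> x * (1/4)" "0 \<le> y" for x y z :: real
    using that by linarith
  ultimately have pw: "\<bar>p\<bar> + \<bar>w\<bar> \<le> 4 * \<bar>q\<bar> * \<eta>" unfolding mult.assoc by blast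
  have wq: "\<bar>w\<bar> \<le> 2 * \<bar>q\<bar> * \<eta>" and pq: "\<bar>p\<bar> \<le> 2 * \<bar>q\<bar> * \<eta>"
  proof -
    have "\<bar>p\<bar> * \<eta>\<^sup>2 \<le> (4 * \<bar>q\<bar> * \<eta>) * (1/4)" "\<bar>w\<bar> * \<eta>\<^sup>2 \<le> (4 * \<bar>q\<bar> * \<eta>) * (1/4)"
    proof -
      have "\<bar>p\<bar> \<le> 4 * \<bar>q\<bar> * \<eta>" "\<bar>w\<bar> \<le> 4 * \<bar>q\<bar> * \<eta>" using pw by linarith+
      moreover have "0 \<le> 4 * \<bar>q\<bar> * \<eta>" using eta(1) by simp
      ultimately show "\<bar>p\<bar> * \<eta>\<^sup>2 \<le> (4 * \<bar>q\<bar> * \<eta>) * (1/4)" "\<bar>w\<bar> * \<eta>\<^sup>2 \<le> (4 * \<bar>q\<bar> * \<eta>) * (1/4)"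
        using mult_mono[OF _ \<open>\<eta>\<^sup>2 \<le> 1/4\<close>] zero_le_power2[of \<eta>] by blast+
    qed
    then show "\<bar>w\<bar> \<le> 2 * \<bar>q\<bar> * \<eta>" "\<bar>p\<bar> \<le> 2 * \<bar>q\<bar> * \<eta>" using w1 p1 by (simp_all add: mult.assoc)
  qed
  have q0: "q \<noteq> 0" using wq pq disc by auto
  have "\<bar>p * (cmod P)\<^sup>2 + w\<bar> \<le> \<bar>p\<bar> * (cmod P)\<^sup>2 + \<bar>w\<bar>" by (metis abs_mult abs_of_nonneg abs_triangle_ineq zero_le_power2)
  also have "\<dots> \<le> (2 * \<bar>q\<bar> * \<eta>) * M\<^sup>2 + 2 * \<bar>q\<bar> * \<eta>"
    using mult_mono[OF pq power_mono[OF P(1) norm_ge_zero, of 2]] wq eta(1) by (intro add_mono) simp_all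
  also have "\<dots> = \<bar>q\<bar> * (2 * \<eta> * (M\<^sup>2 + 1))" by (simp add: algebra_simps)
  also have "\<dots> < \<bar>q\<bar> * m" using eta(3) q0 by simp
  also have "\<dots> \<le> \<bar>q * Re P\<bar>" using P(2) by (simp add: abs_mult mult_left_mono)
  finally have lt: "\<bar>p * (cmod P)\<^sup>2 + w\<bar> < \<bar>q * Re P\<bar>" .
  have "(X + Y) * Y > 0" if "\<bar>X\<bar> < \<bar>Y\<bar>" for X Y :: real
  proof (cases "Y > 0")
    case True
    then have "X + Y > 0" using that by linarith
    then show ?thesis using True by (rule mult_pos_pos)
  next
    case False
    then have "X + Y < 0" "Y < 0" using that by linarith+
    then show ?thesis by (rule mult_neg_neg)
  qed
  from this[OF lt] show ?thesis by (simp add: algebra_simps)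
qed

text \<open>The K-neighbourhood of \<open>B s\<close> has Euclidean size at most a constant times
  \<open>Im (B s)\<close>, which tends to 0.\<close>

lemma near_line_end:
  assumes B: "hyp_line B" and lim: "((\<lambda>s. Im (B s)) \<longlongrightarrow> 0) F" "((\<lambda>s. Re (B s)) \<longlongrightarrow> b) F" and m: "m > 0"
  shows "\<forall>\<^sub>F s in F. \<forall>P. Im P > 0 \<and> hD (B s) P \<le> K \<longrightarrow> \<bar>Re P - b\<bar> < m \<and> cmod P < \<bar>b\<bar> + 2 * m"
proof -
  define C where "C = sqrt (2 * exp K * (cosh K - 1))"
  have C: "cmod (B s - P) \<le> C * Im (B s)" if "Im P > 0" "hD (B s) P \<le> K" for s P
  proof -
    have "(cmod (B s - P))\<^sup>2 \<le> 2 * exp K * (cosh K - 1) * (Im (B s))\<^sup>2"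
      by (rule cmod_le_hyp_dist[OF hyp_lineD(1)[OF B] that])
    also have "\<dots> = (C * Im (B s))\<^sup>2" unfolding C_def power_mult_distrib
      using cosh_real_ge_1[of K] by simp
    finally show ?thesis
      by (rule power2_le_imp_le)
        (use cosh_real_ge_1[of K] hyp_lineD(1)[OF B, of s] in \<open>simp add: C_def\<close>)
  qed
  have "((\<lambda>s. C * Im (B s)) \<longlongrightarrow> C * 0) F" by (intro tendsto_intros lim)
  then have "\<forall>\<^sub>F s in F. C * Im (B s) < m / 2" using m by (intro order_tendstoD(2)) auto
  moreover have "\<forall>\<^sub>F s in F. dist (Re (B s)) b < m / 2" using lim(2) m by (intro tendstoD) auto
  moreover have "\<forall>\<^sub>F s in F. Im (B s) < m / 2" using lim(1) m by (intro order_tendstoD(2)) auto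
  ultimately show ?thesis
  proof eventually_elim
    case (elim s)
    show ?case
    proof (intro allI impI)
      fix P assume P: "Im P > 0 \<and> hD (B s) P \<le> K"
      have "cmod (B s - P) < m / 2" using C[of P s] P elim by linarith
      then have 1: "\<bar>Re (B s) - Re P\<bar> < m / 2" "\<bar>Im (B s) - Im P\<bar> < m / 2"
        using abs_Re_le_cmod[of "B s - P"] abs_Im_le_cmod[of "B s - P"] by auto
      have r: "\<bar>Re P - b\<bar> < m" using 1 elim(2) unfolding dist_real_def by linarith
      have "cmod P \<le> \<bar>Re P\<bar> + \<bar>Im P\<bar>" by (rule cmod_le)
      also have "\<dots> < \<bar>b\<bar> + 2 * m" using r 1(2) elim(3) hyp_lineD(1)[OF B, of s] P by linarith
      finally show "\<bar>Re P - b\<bar> < m \<and> cmod P < \<bar>b\<bar> + 2 * m" using r by blast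
    qed
  qed
qed

text \<open>Crossing is an open condition on the ends at infinity. If \<open>Q\<close> follows the
  axis and \<open>Q'\<close> follows \<open>B\<close> far out on both sides, the equation of
  \<open>Q\<close> takes opposite signs at \<open>Pm\<close> and \<open>Pp\<close>, and the
  intermediate value theorem along \<open>Q'\<close> gives a common point. The extra claim that
  \<open>Pp\<close> is off \<open>Q\<close> rules out that both lines are the same set. L is uniform
  in \<open>Q\<close> and \<open>Q'\<close>.\<close>

lemma crossing_lines_stable:
  assumes B: "hyp_line B" and cross: "Re (B s1) = 0" and trans: "Re (B u0) \<noteq> 0" and K: "K \<ge> 0"
  obtains L where "L > 0"
    and "\<And>Q Q' zm zp Pm Pp sm sp s's s'p. \<lbrakk>hyp_line Q; hyp_line Q'; sm \<le> -L; sp \<ge> L; s's \<le> -L; s'p \<ge> L;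
     zm \<in> range Q; zp \<in> range Q; Pm \<in> range Q'; Pp \<in> range Q';
     hD (vert sm) zm \<le> K; hD (vert sp) zp \<le> K; hD (B s's) Pm \<le> K; hD (B s'p) Pp \<le> K\<rbrakk>
     \<Longrightarrow> (\<exists>u v. Q u = Q' v) \<and> Pp \<notin> range Q"
proof -
  obtain bp bm where b: "bp * bm < 0" "((\<lambda>s. Im (B s)) \<longlongrightarrow> 0) at_top" "((\<lambda>s. Im (B s)) \<longlongrightarrow> 0) at_bot"
    "((\<lambda>s. Re (B s)) \<longlongrightarrow> bp) at_top" "((\<lambda>s. Re (B s)) \<longlongrightarrow> bm) at_bot"
    using crossing_endpoints[OF B cross trans] by blast
  \<comment> \<open>Points within m of an end of \<open>B\<close> have the sign of that end and
    distance at least m from the imaginary axis; M bounds their modulus, and \<eta> is the closeness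
    that \<open>sign_off_line\<close> asks for these m and M.\<close>
  define m where "m = min \<bar>bp\<bar> \<bar>bm\<bar> / 2"
  have m: "m > 0" "2 * m \<le> \<bar>bp\<bar>" "2 * m \<le> \<bar>bm\<bar>" using b(1) unfolding m_def by auto
  define M where "M = \<bar>bp\<bar> + \<bar>bm\<bar> + 2 * m"
  define \<eta> where "\<eta> = min (1/2) (m / (4 * (M\<^sup>2 + 1)))"
  have M1: "M\<^sup>2 + 1 > 0" by (smt (verit) zero_le_power2)
  have eta: "0 < \<eta>" "\<eta> \<le> 1/2" "2 * \<eta> * (M\<^sup>2 + 1) < m"
  proof -
    show "\<eta> \<le> 1/2" unfolding \<eta>_def by (rule min.cobounded1)
    show "0 < \<eta>" unfolding \<eta>_def using m M1 by simp
    have "2 * \<eta> * (M\<^sup>2 + 1) \<le> 2 * (m / (4 * (M\<^sup>2 + 1))) * (M\<^sup>2 + 1)"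
      unfolding \<eta>_def using M1 by (intro mult_right_mono mult_left_mono) auto
    also have "\<dots> = m / 2" using M1 by (simp add: field_simps)
    finally show "2 * \<eta> * (M\<^sup>2 + 1) < m" using m by linarith
  qed
  define C where "C = sqrt (2 * exp K * (cosh K - 1))"
  have C0: "C \<ge> 0" unfolding C_def using cosh_real_ge_1[of K] by simp
  have "((\<lambda>s. (C + 1) * exp s) \<longlongrightarrow> (C + 1) * 0) (at_bot :: real filter)" by (intro tendsto_intros exp_at_bot)
  then have "\<forall>\<^sub>F s in (at_bot :: real filter). (C + 1) * exp s < \<eta>" using eta by (intro order_tendstoD(2)) auto
  then obtain L1 where L1: "\<forall>s\<le>L1. (C + 1) * exp s < \<eta>" unfolding eventually_at_bot_linorder by blast
  have "\<forall>\<^sub>F s in (at_top :: real filter). exp s > exp K / \<eta>"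
    using exp_at_top unfolding filterlim_at_top_dense by blast
  then obtain L2 where L2: "\<forall>s\<ge>L2. exp s > exp K / \<eta>" unfolding eventually_at_top_linorder by blast
  obtain L3 where L3: "\<forall>s\<ge>L3. \<forall>P. Im P > 0 \<and> hD (B s) P \<le> K \<longrightarrow> \<bar>Re P - bp\<bar> < m \<and> cmod P < \<bar>bp\<bar> + 2 * m"
    using near_line_end[OF B b(2,4) m(1)] unfolding eventually_at_top_linorder by blast
  obtain L4 where L4: "\<forall>s\<le>L4. \<forall>P. Im P > 0 \<and> hD (B s) P \<le> K \<longrightarrow> \<bar>Re P - bm\<bar> < m \<and> cmod P < \<bar>bm\<bar> + 2 * m"
    using near_line_end[OF B b(3,5) m(1)] unfolding eventually_at_bot_linorder by blast
  define L where "L = \<bar>L1\<bar> + \<bar>L2\<bar> + \<bar>L3\<bar> + \<bar>L4\<bar> + 1"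
  have main: "(\<exists>u v. Q u = Q' v) \<and> Pp \<notin> range Q"
    if Q: "hyp_line Q" and Q': "hyp_line Q'" and s: "sm \<le> -L" "sp \<ge> L" "s's \<le> -L" "s'p \<ge> L"
      and r: "zm \<in> range Q" "zp \<in> range Q" "Pm \<in> range Q'" "Pp \<in> range Q'"
      and d: "hD (vert sm) zm \<le> K" "hD (vert sp) zp \<le> K" "hD (B s's) Pm \<le> K" "hD (B s'p) Pp \<le> K"
    for Q Q' zm zp Pm Pp sm sp s's s'p
  proof -
    have I: "Im zm > 0" "Im zp > 0" "Im Pm > 0" "Im Pp > 0" using r hyp_lineD(1)[OF Q] hyp_lineD(1)[OF Q'] by auto
    obtain p q w where pqw: "q\<^sup>2 > 4 * p * w"
      "\<forall>z. Im z > 0 \<longrightarrow> (p * (cmod z)\<^sup>2 + q * Re z + w = 0 \<longleftrightarrow> z \<in> range Q)" using line_equation[OF Q] by blast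
    define F where "F z = p * (cmod z)\<^sup>2 + q * Re z + w" for z
    have "cmod zm \<le> \<eta>"
    proof -
      have "(cmod (vert sm - zm))\<^sup>2 \<le> 2 * exp K * (cosh K - 1) * (Im (vert sm))\<^sup>2"
        by (rule cmod_le_hyp_dist) (use I d in auto)
      also have "\<dots> = (C * exp sm)\<^sup>2" unfolding C_def power_mult_distrib using cosh_real_ge_1[of K] by simp
      finally have "cmod (vert sm - zm) \<le> C * exp sm" by (rule power2_le_imp_le) (use C0 in simp)
      moreover have "cmod (vert sm) = exp sm" by (simp add: cmod_def)
      moreover have "cmod zm \<le> cmod (vert sm) + cmod (vert sm - zm)"
        using norm_triangle_ineq4[of "vert sm" "vert sm - zm"] by simp
      moreover have "(C + 1) * exp sm < \<eta>" using L1 s(1) unfolding L_def by auto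
      ultimately show ?thesis by (simp add: algebra_simps)
    qed
    moreover have "cmod zp \<ge> 1 / \<eta>"
    proof -
      have "exp sp \<le> exp (hD zp (vert sp)) * Im zp" using Im_le_exp_hyp_dist[of zp "vert sp"] I by simp
      also have "\<dots> \<le> exp K * cmod zp"
        using d(2) hyp_dist_commute[of zp] abs_Im_le_cmod[of zp] I by (intro mult_mono) auto
      finally have "exp sp \<le> exp K * cmod zp" .
      moreover have "exp K / \<eta> < exp sp" using L2 s(2) unfolding L_def by auto
      ultimately have "exp K / \<eta> < exp K * cmod zp" by linarith
      then have "exp K * (1 / \<eta>) < exp K * cmod zp" by simp
      then have "1 / \<eta> < cmod zp" by (simp only: mult_less_cancel_left_pos exp_gt_zero)
      then show ?thesis by simp
    qed
    moreover have "F zm = 0" "F zp = 0" unfolding F_def using pqw(2) I r by blast+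
    ultimately have sgn: "F P * (q * Re P) > 0" if "cmod P \<le> M" "\<bar>Re P\<bar> \<ge> m" for P
      unfolding F_def using sign_off_line[OF pqw(1) eta] that by blast
    have "s'p \<ge> L3" "s's \<le> L4" using s(3,4) unfolding L_def by linarith+
    then have Pp: "\<bar>Re Pp - bp\<bar> < m" "cmod Pp < \<bar>bp\<bar> + 2 * m"
      and Pm: "\<bar>Re Pm - bm\<bar> < m" "cmod Pm < \<bar>bm\<bar> + 2 * m" using L3 L4 I d by blast+
    have sp: "F Pp * (q * Re Pp) > 0" by (rule sgn) (use Pp m in \<open>unfold M_def, linarith+\<close>)
    have sm: "F Pm * (q * Re Pm) > 0" by (rule sgn) (use Pm m in \<open>unfold M_def, linarith+\<close>)
    have "bp > 0 \<and> bm < 0 \<or> bp < 0 \<and> bm > 0" using b(1) by (simp add: mult_less_0_iff)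
    then have "Re Pp > 0 \<and> Re Pm < 0 \<or> Re Pp < 0 \<and> Re Pm > 0" using Pp(1) Pm(1) m by linarith
    then have "Re Pp * Re Pm < 0" by (simp add: mult_less_0_iff)
    have "q \<noteq> 0" using sp by auto
    have "F Pp * F Pm < 0"
    proof (rule ccontr)
      assume "\<not> F Pp * F Pm < 0"
      moreover have "(F Pp * F Pm) * (q\<^sup>2 * (Re Pp * Re Pm)) > 0"
        using mult_pos_pos[OF sp sm] by (simp add: power2_eq_square mult_ac)
      moreover have "q\<^sup>2 * (Re Pp * Re Pm) < 0" using \<open>q \<noteq> 0\<close> \<open>Re Pp * Re Pm < 0\<close> by (simp add: mult_pos_neg)
      ultimately show False using mult_nonneg_nonpos[of "F Pp * F Pm" "q\<^sup>2 * (Re Pp * Re Pm)"] by linarith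
    qed
    obtain vp vm where v: "Pp = Q' vp" "Pm = Q' vm" using r by blast
    have cont: "continuous_on X (\<lambda>v. F (Q' v))" for X
      unfolding F_def by (intro continuous_intros hyp_line_cont[OF Q'])
    have "\<exists>v. F (Q' v) = 0"
    proof -
      have "F Pp < 0 \<and> F Pm > 0 \<or> F Pp > 0 \<and> F Pm < 0" using \<open>F Pp * F Pm < 0\<close> by (auto simp: mult_less_0_iff)
      then have "0 \<in> (\<lambda>v. F (Q' v)) ` UNIV"
        using connectedD_interval[OF connected_continuous_image[OF cont connected_UNIV], of "F Pp" "F Pm" 0]
          connectedD_interval[OF connected_continuous_image[OF cont connected_UNIV], of "F Pm" "F Pp" 0] v
        by auto
      then show ?thesis by auto
    qed
    then obtain v where "F (Q' v) = 0" by blast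
    then have "Q' v \<in> range Q" using pqw(2) hyp_lineD(1)[OF Q'] unfolding F_def by blast
    moreover have "F Pp \<noteq> 0" using \<open>F Pp * F Pm < 0\<close> by auto
    then have "Pp \<notin> range Q" using pqw(2) I unfolding F_def by blast
    ultimately show ?thesis by (metis imageE)
  qed
  have L: "L > 0" unfolding L_def by linarith
  show thesis by (rule that[OF L main])
qed

section \<open>The electrified plane\<close>

context developed_surface
begin

section \<open>Lifts of simple closed geodesics, and self-crossing of the other axes\<close>

definition simple_line :: "(real \<Rightarrow> complex) \<Rightarrow> bool" where
  "simple_line Q \<longleftrightarrow> hyp_line Q \<and> (\<exists>c l. closed_geodesic S c l \<and> simple_geodesic c \<and> (\<forall>t. E (Q t) = c t))"

lemma simple_line_deck:
  assumes "simple_line Q" "deck h" shows "simple_line (\<lambda>t. h (Q t))"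
proof -
  obtain c l where c: "hyp_line Q" "closed_geodesic S c l" "simple_geodesic c" "\<forall>t. E (Q t) = c t"
    using assms(1) unfolding simple_line_def by blast
  have "\<forall>t. E (h (Q t)) = c t" using deck_E[OF assms(2) hyp_lineD(1)[OF c(1)]] c(4) by simp
  then show ?thesis unfolding simple_line_def using deck_line[OF assms(2) c(1)] c(2,3) by blast
qed

lemma period_multiple:
  assumes "\<And>t. c (t + l) = c t"
  shows "c (t + of_int k * l) = c (t :: real)"
proof -
  have n: "c (t + real n * l) = c t" for n t
  proof (induction n)
    case (Suc n)
    have "c (t + real (Suc n) * l) = c ((t + real n * l) + l)" by (simp add: algebra_simps)
    also have "\<dots> = c t" using assms[of "t + real n * l"] Suc by metis
    finally show ?case .
  qed simp
  show ?thesis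
  proof (cases "k \<ge> 0")
    case True
    then show ?thesis using n[of t "nat k"] by simp
  next
    case False
    have "c ((t + of_int k * l) + real (nat (- k)) * l) = c (t + of_int k * l)" by (rule n)
    moreover have "(t + of_int k * l) + real (nat (- k)) * l = t" using False by simp
    ultimately show ?thesis by metis
  qed
qed

text \<open>A simple geodesic is injective modulo its least period, so u and v differ by a multiple
  of it.\<close>

lemma simple_geodesic_return:
  assumes s: "simple_geodesic c" and eq: "c u = c v"
  shows "c (t + (v - u)) = c t"
proof -
  obtain l where l: "l > 0" "\<And>t. c (t + l) = c t" "inj_on c {0..<l}"
    using s unfolding simple_geodesic_def primitive_period_def has_period_def by blast
  have red: "u - of_int \<lfloor>u / l\<rfloor> * l \<in> {0..<l}" "c (u - of_int \<lfloor>u / l\<rfloor> * l) = c u" for u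
  proof -
    show "u - of_int \<lfloor>u / l\<rfloor> * l \<in> {0..<l}"
      using floor_divide_lower[OF l(1), of u] floor_divide_upper[OF l(1), of u] by (simp add: algebra_simps)
    show "c (u - of_int \<lfloor>u / l\<rfloor> * l) = c u" using period_multiple[of c l u "- \<lfloor>u / l\<rfloor>"] l(2) by simp
  qed
  have "u - of_int \<lfloor>u / l\<rfloor> * l = v - of_int \<lfloor>v / l\<rfloor> * l"
    using inj_onD[OF l(3), of "u - of_int \<lfloor>u / l\<rfloor> * l" "v - of_int \<lfloor>v / l\<rfloor> * l"] red eq by metis
  then have "v - u = of_int (\<lfloor>v / l\<rfloor> - \<lfloor>u / l\<rfloor>) * l" by (simp add: algebra_simps)
  then show ?thesis using period_multiple[of c l, OF l(2)] by metis
qed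

text \<open>This is how simplicity is used: a simple line that meets its translate under h coincides
  with it, and h moves the line along itself.\<close>

lemma simple_line_return:
  assumes Q: "simple_line Q" and h: "deck h" and uv: "h (Q u) = Q v"
  shows "h (Q t) = Q (t + (v - u))"
proof -
  obtain c l where c: "hyp_line Q" "simple_geodesic c" "\<forall>t. E (Q t) = c t" using Q unfolding simple_line_def by blast
  have e: "E (h (Q x)) = c x" for x using deck_E[OF h hyp_lineD(1)[OF c(1)]] c(3) by simp
  have "c u = c v" using e[of u] uv c(3) by simp
  then have ret: "c (x + (v - u)) = c x" for x by (rule simple_geodesic_return[OF c(2)])
  show ?thesis
    using line_lift_unique[OF deck_line[OF h c(1)] hyp_line_shift[OF c(1), of "v - u"], of u t] e c(3) ret uv by simp
qed

text \<open>If every coincidence of values were a period, \<open>c\<close> would be injective on its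
  least period. The least period exists: local injectivity bounds periods below by e, and if the
  infimum were not attained, two periods close to it would differ by a period shorter than
  e.\<close>

lemma nonsimple_return:
  assumes c: "closed_geodesic S c l" and ns: "\<not> simple_geodesic c"
  shows "\<exists>s t. c s = c t \<and> s \<noteq> t \<and> \<not> (\<forall>x. c (x + (s - t)) = c x)"
proof (rule ccontr)
  assume "\<not> ?thesis"
  then have ret: "c (x + (s - t)) = c x" if "c s = c t" "s \<noteq> t" for s t x using that by blast
  obtain e where e: "e > 0" "\<forall>s\<in>{0 - e<..<0 + e}. \<forall>s'\<in>{0 - e<..<0 + e}. dist (c s) (c s') = \<bar>s - s'\<bar>"
    using c unfolding closed_geodesic_def by blast
  have pe: "k \<ge> e" if "has_period c k" for k
  proof (rule ccontr)
    assume "\<not> k \<ge> e"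
    moreover have k: "k > 0" "c k = c 0" using that unfolding has_period_def by (auto dest: spec[of _ 0])
    ultimately have "dist (c k) (c 0) = \<bar>k - 0\<bar>" by (intro e(2)[rule_format]) auto
    then show False using k by simp
  qed
  define P where "P = {k. has_period c k}"
  define a where "a = Inf P"
  have ne: "P \<noteq> {}" using c unfolding P_def closed_geodesic_def by blast
  have bdd: "bdd_below P" using pe unfolding P_def by (intro bdd_belowI[of _ e]) auto
  have le: "a \<le> k" if "k \<in> P" for k unfolding a_def by (rule cInf_lower[OF that bdd])
  have "a \<in> P"
  proof (rule ccontr)
    assume n: "a \<notin> P"
    obtain k1 where k1: "k1 \<in> P" "k1 < a + e"
      using cInf_less_iff[OF ne bdd, of "a + e"] e(1) unfolding a_def by auto
    have "a < k1" using le[OF k1(1)] n k1(1) by (metis order_less_le)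
    then obtain k2 where k2: "k2 \<in> P" "k2 < k1" using cInf_less_iff[OF ne bdd, of k1] unfolding a_def by auto
    have per: "c (t + k1) = c t" "c (t + k2) = c t" for t using k1 k2 unfolding P_def has_period_def by auto
    have "c (t + (k1 - k2)) = c t" for t using per(1)[of "t - k2"] per(2)[of "t - k2"] by (simp add: algebra_simps)
    then have "has_period c (k1 - k2)" using k2 unfolding has_period_def by simp
    then show False using pe[of "k1 - k2"] le[OF k2(1)] k1(2) by linarith
  qed
  then have prim: "primitive_period c a" unfolding primitive_period_def using le unfolding P_def by blast
  have "inj_on c {0..<a}"
  proof (rule inj_onI)
    have no: False if "c s = c t" "t < s" "s - t < a" for s t
    proof -
      have "has_period c (s - t)" unfolding has_period_def using ret[of s t] that by simp
      then have "a \<le> s - t" using le unfolding P_def by simp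
      then show False using that by linarith
    qed
    fix s t assume "s \<in> {0..<a}" "t \<in> {0..<a}" "c s = c t"
    then show "s = t" using no[of s t] no[of t s] by (cases s t rule: linorder_cases) auto
  qed
  then show False using ns prim unfolding simple_geodesic_def by blast
qed

text \<open>A coincidence c s = c t gives h with \<open>h (A t) = A s\<close>. If h preserved the
  axis as a translation, s - t would be a period. If it reversed the axis, it would fix a midpoint
  and so be the identity, contrary to s \<noteq> t.\<close>

lemma nonsimple_axis_crossing:
  assumes A: "hyp_line A" "\<And>t. E (A t) = c t" and c: "closed_geodesic S c l" "\<not> simple_geodesic c"
  shows "\<exists>h s t u. deck h \<and> h (A t) = A s \<and> h (A u) \<notin> range A"
proof -
  obtain s t where st: "c s = c t" "s \<noteq> t" "\<not> (\<forall>x. c (x + (s - t)) = c x)" using nonsimple_return[OF c] by blast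
  obtain h where h: "deck h" "h (A t) = A s"
    using deck_exists[OF hyp_lineD(1)[OF A(1)] hyp_lineD(1)[OF A(1)], of t s] A(2) st(1) by auto
  have "\<exists>u. h (A u) \<notin> range A"
  proof (rule ccontr)
    assume "\<not> ?thesis"
    then obtain r where r: "h (A (t + 1)) = A r" by auto
    note hA = deck_line[OF h(1) A(1)]
    have "hD (h (A t)) (h (A (t + 1))) = 1" using hyp_lineD(2)[OF hA, of t "t + 1"] by simp
    then have "\<bar>s - r\<bar> = 1" unfolding h(2) r using hyp_lineD(2)[OF A(1)] by simp
    then consider "r = s + 1" | "r = s - 1" by linarith
    then show False
    proof cases
      case 1
      have "h (A x) = A (x + (s - t))" for x
      proof (rule hyp_line_unique[OF hyp_line_shift[OF A(1), of "s - t"], of _ t "t + 1" x])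
        show "0 < Im (h (A x))" by (rule hyp_lineD(1)[OF hA])
        show "hD (A (t + (s - t))) (h (A x)) = \<bar>x - t\<bar>"
          using hyp_lineD(2)[OF hA, of t x] h(2) by (simp add: abs_minus_commute)
        have "t + 1 + (s - t) = r" using 1 by simp
        then show "hD (A (t + 1 + (s - t))) (h (A x)) = \<bar>x - (t + 1)\<bar>"
          using hyp_lineD(2)[OF hA, of "t + 1" x] r by (metis abs_minus_commute)
      qed simp
      then have "c (x + (s - t)) = c x" for x
        using A(2) deck_E[OF h(1) hyp_lineD(1)[OF A(1)]] by metis
      then show False using st by blast
    next
      case 2
      have rev: "hyp_line (\<lambda>x. A (s + t - x))" using A(1) unfolding hyp_line_def by (auto simp: abs_minus_commute)
      have "h (A x) = A (s + t - x)" for x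
      proof (rule hyp_line_unique[OF rev, of _ t "t + 1" x])
        show "0 < Im (h (A x))" by (rule hyp_lineD(1)[OF hA])
        show "hD (A (s + t - t)) (h (A x)) = \<bar>x - t\<bar>"
          using hyp_lineD(2)[OF hA, of t x] h(2) by (simp add: abs_minus_commute)
        have "s + t - (t + 1) = r" using 2 by simp
        then show "hD (A (s + t - (t + 1))) (h (A x)) = \<bar>x - (t + 1)\<bar>"
          using hyp_lineD(2)[OF hA, of "t + 1" x] r by (metis abs_minus_commute)
      qed simp
      from this[of "(s + t) / 2"] have "h (A ((s + t) / 2)) = A ((s + t) / 2)" by (simp add: field_simps)
      then have "h (A t) = A t"
        using deck_unique[OF h(1) deck_id hyp_lineD(1)[OF A(1)] _ hyp_lineD(1)[OF A(1)]] by blast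
      then have "hD (A s) (A t) = 0" using h(2) by simp
      then show False using hyp_lineD(2)[OF A(1)] st by simp
    qed
  qed
  then show ?thesis using h by blast
qed

section \<open>The electrified distance, its chains and its behaviour along hyperbolic
  geodesics\<close>

definition edges :: "(complex \<times> complex) set" where
  "edges = {(u, v). Im u > 0 \<and> Im v > 0 \<and> (hD u v \<le> 1 \<or> (\<exists>Q. simple_line Q \<and> u \<in> range Q \<and> v \<in> range Q))}"

text \<open>Simple lines get diameter at most 1 without adding cone points, so \<open>dg\<close> and
  \<open>hD\<close> live on the same set and can be compared directly.\<close>

definition dg :: "complex \<Rightarrow> complex \<Rightarrow> nat" where
  "dg u v = (LEAST n. (u, v) \<in> edges ^^ n)"

lemma edges_sym: "(u, v) \<in> edges \<Longrightarrow> (v, u) \<in> edges"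
  unfolding edges_def by (auto simp: hyp_dist_commute)

lemma edges_refl: "Im u > 0 \<Longrightarrow> (u, u) \<in> edges"
  unfolding edges_def by simp

lemma edges_pow_in: "(u, v) \<in> edges ^^ n \<Longrightarrow> Im u > 0 \<Longrightarrow> Im v > 0"
  by (cases n) (auto simp: edges_def)

lemma edges_pow_sym: "(u, v) \<in> edges ^^ n \<Longrightarrow> (v, u) \<in> edges ^^ n"
proof (induction n arbitrary: u v)
  case (Suc n)
  then obtain w where "(u, w) \<in> edges ^^ n" "(w, v) \<in> edges" by auto
  then show ?case using Suc.IH edges_sym by (meson relpow_Suc_I2)
qed simp

lemma edges_pow_mono:
  assumes "(u, v) \<in> edges ^^ n" "Im u > 0" "n \<le> m" shows "(u, v) \<in> edges ^^ m"
proof -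
  have "(v, v) \<in> edges ^^ k" for k
    by (induction k) (use edges_refl[OF edges_pow_in[OF assms(1,2)]] in auto)
  then have "(u, v) \<in> edges ^^ (n + (m - n))" using assms(1) by (subst relpow_add) auto
  then show ?thesis using assms(3) by simp
qed

lemma edges_pow_dist:
  assumes "Im u > 0" "Im v > 0" "hD u v \<le> real n" shows "(u, v) \<in> edges ^^ n"
  using assms(2,3)
proof (induction n arbitrary: v)
  case 0
  then have "hD u v = 0" using hyp_dist_nonneg[OF assms(1) 0(1)] by simp
  then show ?case using hyp_dist_eq_0_iff[OF assms(1) 0(1)] by simp
next
  case (Suc n)
  obtain J where J: "hyp_line J" "J 0 = u" "J (hD u v) = v" using hyp_line_through[OF assms(1) Suc.prems(1)] by blast
  define t where "t = max 0 (hD u v - 1)"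
  have "hD u (J t) = t" using hyp_lineD(2)[OF J(1), of 0 t] J(2) unfolding t_def by auto
  then have "(u, J t) \<in> edges ^^ n" using Suc.IH[OF hyp_lineD(1)[OF J(1)], of t] Suc.prems unfolding t_def by auto
  moreover have "hD (J t) v \<le> 1"
    using hyp_lineD(2)[OF J(1), of t "hD u v"] J(3) hyp_dist_nonneg[OF assms(1) Suc.prems(1)] unfolding t_def by auto
  then have "(J t, v) \<in> edges" unfolding edges_def using hyp_lineD(1)[OF J(1)] Suc.prems by simp
  ultimately show ?case by auto
qed

lemma dg_path:
  assumes "Im u > 0" "Im v > 0" shows "(u, v) \<in> edges ^^ dg u v"
proof -
  have "(u, v) \<in> edges ^^ nat \<lceil>hD u v\<rceil>" by (rule edges_pow_dist[OF assms]) linarith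
  then show ?thesis unfolding dg_def by (rule LeastI)
qed

lemma dg_le: "(u, v) \<in> edges ^^ n \<Longrightarrow> dg u v \<le> n"
  unfolding dg_def by (rule Least_le)

lemma dg_commute: "dg u v = dg v u"
  unfolding dg_def using edges_pow_sym by metis

lemma dg_triangle:
  assumes "Im x > 0" "Im y > 0" "Im z > 0" shows "dg x z \<le> dg x y + dg y z"
  by (rule dg_le) (use dg_path[of x y] dg_path[of y z] assms in \<open>auto simp: relpow_add\<close>)

lemma dg_eq_0_iff: "Im x > 0 \<Longrightarrow> Im y > 0 \<Longrightarrow> dg x y = 0 \<longleftrightarrow> x = y"
proof
  assume "Im x > 0" "Im y > 0" "dg x y = 0"
  then show "x = y" using dg_path[of x y] by simp
next
  assume "x = y" then show "dg x y = 0" using dg_le[of x y 0] by simp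
qed

lemma dg_le_dist:
  assumes "Im u > 0" "Im v > 0" shows "real (dg u v) \<le> hD u v + 1"
proof -
  have "dg u v \<le> nat \<lceil>hD u v\<rceil>" by (rule dg_le, rule edges_pow_dist[OF assms]) linarith
  then show ?thesis using hyp_dist_nonneg[OF assms] by linarith
qed

lemma edges_deck:
  assumes "deck h" "(u, v) \<in> edges" shows "(h u, h v) \<in> edges"
proof -
  have I: "Im u > 0" "Im v > 0" using assms unfolding edges_def by auto
  have "hD u v \<le> 1 \<or> (\<exists>Q. simple_line Q \<and> u \<in> range Q \<and> v \<in> range Q)" using assms unfolding edges_def by auto
  then have "hD (h u) (h v) \<le> 1 \<or> (\<exists>Q. simple_line Q \<and> h u \<in> range Q \<and> h v \<in> range Q)"
  proof (elim disjE exE conjE)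
    fix Q assume "simple_line Q" "u \<in> range Q" "v \<in> range Q"
    then show ?thesis using simple_line_deck[OF _ assms(1), of Q] by (intro disjI2 exI[of _ "\<lambda>t. h (Q t)"]) auto
  qed (use deck_dist[OF assms(1) I] in simp)
  then show ?thesis unfolding edges_def using deck_in[OF assms(1)] I by simp
qed

lemma dg_deck:
  assumes h: "deck h" and I: "Im u > 0" "Im v > 0" shows "dg (h u) (h v) = dg u v"
proof -
  have pw: "(k u, k v) \<in> edges ^^ n" if "deck k" "(u, v) \<in> edges ^^ n" for k u v n
    using that(2)
  proof (induction n arbitrary: v)
    case (Suc n)
    then obtain w where "(u, w) \<in> edges ^^ n" "(w, v) \<in> edges" by auto
    then show ?case using Suc.IH edges_deck[OF that(1)] by (meson relpow_Suc_I)
  qed simp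
  obtain k where k: "deck k" "\<And>z. Im z > 0 \<Longrightarrow> k (h z) = z" using deck_inverse[OF h] by metis
  have "dg (h u) (h v) \<le> dg u v" using dg_le[OF pw[OF h dg_path[OF I]]] .
  moreover have "dg u v \<le> dg (h u) (h v)"
    using dg_le[OF pw[OF k(1) dg_path[OF deck_in[OF h I(1)] deck_in[OF h I(2)]]]] k(2) I by simp
  ultimately show ?thesis by simp
qed

text \<open>A line contains the interval between any two of its points, so intermediate points of an
  edge are adjacent to its ends. This is the source of \<open>link\<close> for
  \<open>dg\<close>.\<close>

lemma edges_seg:
  assumes "(u, v) \<in> edges" "m \<in> hyp.seg u v"
  shows "(m, u) \<in> edges" "(m, v) \<in> edges" and "hD u v \<le> 1 \<or> (\<exists>Q. simple_line Q \<and> m \<in> range Q \<and> u \<in> range Q \<and> v \<in> range Q)"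
proof -
  have I: "Im u > 0" "Im v > 0" "Im m > 0" and D: "hD u m + hD m v = hD u v"
    using assms unfolding edges_def hyp.seg_def by auto
  note nn = hyp_dist_nonneg[OF I(1,3)] hyp_dist_nonneg[OF I(3,2)]
  have "hD u v \<le> 1 \<or> (\<exists>Q. simple_line Q \<and> u \<in> range Q \<and> v \<in> range Q)" using assms unfolding edges_def by auto
  then show 3: "hD u v \<le> 1 \<or> (\<exists>Q. simple_line Q \<and> m \<in> range Q \<and> u \<in> range Q \<and> v \<in> range Q)"
    using seg_subset_line[of _ m] assms(2) unfolding simple_line_def by (metis rangeE)
  show "(m, u) \<in> edges" "(m, v) \<in> edges"
  proof -
    have "hD m u \<le> 1 \<and> hD m v \<le> 1" if "hD u v \<le> 1" using that D nn hyp_dist_commute[of m u] by linarith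
    then show "(m, u) \<in> edges" "(m, v) \<in> edges" unfolding edges_def using I 3 by blast+
  qed
qed

text \<open>A shortest edge path serves as connecting chain, since its vertices are no farther from
  x than y is; all constants can be 1.\<close>

lemma dg_coarse_geodesic: "coarse_geodesic hyp_plane hD (2 * ln 5) (\<lambda>u v. real (dg u v)) 1"
proof -
  interpret cp: coarse_paths hyp_plane hD "2 * ln 5" "\<lambda>u v. real (dg u v)" 1
  proof
    show "real (dg x y) = real (dg y x)" for x y by (simp add: dg_commute)
    show "real (dg x z) \<le> real (dg x y) + real (dg y z)" if "x \<in> hyp_plane" "y \<in> hyp_plane" "z \<in> hyp_plane" for x y z
      using dg_triangle[of x y z] that by simp
    show "real (dg x y) \<le> 1 * hD x y + 1" if "x \<in> hyp_plane" "y \<in> hyp_plane" for x y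
      using dg_le_dist[of x y] that by simp
  qed (auto simp: dg_eq_0_iff)
  have link: "cp.link u v" if "(u, v) \<in> edges" for u v
    unfolding cp.link_def
    using edges_seg(1,2)[OF that] dg_le[of _ _ 1] by auto
  have chain: "(x, y) \<in> cp.chain_rel {z \<in> hyp_plane. real (dg x z) \<le> real N + 1} ^^ n"
    if "(x, y) \<in> edges ^^ n" "n \<le> N" "Im x > 0" for x y n N
    using that(1,2)
  proof (induction n arbitrary: y)
    case (Suc n)
    then obtain w where w: "(x, w) \<in> edges ^^ n" "(w, y) \<in> edges" by auto
    have "dg x w \<le> n" "dg x y \<le> Suc n" using dg_le w(1) Suc.prems(1) by blast+
    then have "(w, y) \<in> cp.chain_rel {z \<in> hyp_plane. real (dg x z) \<le> real N + 1}"
      unfolding cp.chain_rel_def using link[OF w(2)] w(2) Suc.prems(2) by (auto simp: edges_def)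
    then show ?case using Suc.IH[OF w(1)] Suc.prems(2) by auto
  qed simp
  show ?thesis
  proof (unfold_locales, goal_cases)
    case (1 x y)
    then have "Im x > 0" "Im y > 0" by auto
    then show ?case using chain[OF dg_path, of x y "dg x y"] by (intro exI[of _ "dg x y"]) auto
  qed
qed

text \<open>A shortest edge path between the ends is a \<open>quasi_path\<close>, so by
  \<open>morse\<close> the hyperbolic geodesic passes near one of its vertices at time t, and at
  vertices \<open>dg\<close> is exactly additive. The defect is thus 2H.\<close>

lemma dg_between_geodesic:
  "\<exists>H. \<forall>c L t. geod hyp_plane hD c L \<and> t \<in> {0..L} \<longrightarrow>
     real (dg (c 0) (c t)) + real (dg (c t) (c L)) \<le> real (dg (c 0) (c L)) + H"
proof -
  interpret cg: coarse_geodesic hyp_plane hD "2 * ln 5" "\<lambda>u v. real (dg u v)" 1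
    by (rule dg_coarse_geodesic)
  obtain H where H: "\<And>p n c L t. cg.quasi_path p n \<Longrightarrow> geod hyp_plane hD c L \<Longrightarrow> c 0 = p 0 \<Longrightarrow> c L = p n \<Longrightarrow> L \<ge> 0 \<Longrightarrow>
      t \<in> {0..L} \<Longrightarrow> \<exists>i\<le>n. real (dg (c t) (p i)) \<le> H"
    using cg.morse by (metis (no_types, lifting))
  have "real (dg (c 0) (c t)) + real (dg (c t) (c L)) \<le> real (dg (c 0) (c L)) + 2 * H"
    if c: "geod hyp_plane hD c L" and t: "t \<in> {0..L}" for c L t
  proof -
    have L: "L \<ge> 0" using t by auto
    have cI: "Im (c s) > 0" if "s \<in> {0..L}" for s using hyp.geod_in[OF c that] by simp
    have I: "Im (c 0) > 0" "Im (c t) > 0" "Im (c L) > 0" using cI L t by auto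
    define n where "n = dg (c 0) (c L)"
    have "(c 0, c L) \<in> edges ^^ n" unfolding n_def by (rule dg_path[OF I(1,3)])
    then obtain p where p: "p 0 = c 0" "p n = c L" "\<forall>i<n. (p i, p (Suc i)) \<in> edges"
      unfolding relpow_fun_conv by blast
    have sub: "(p i, p j) \<in> edges ^^ (j - i)" if "i \<le> j" "j \<le> n" for i j
      unfolding relpow_fun_conv using p(3) that by (intro exI[of _ "\<lambda>k. p (i + k)"]) auto
    have pI: "Im (p i) > 0" if "i \<le> n" for i
      using edges_pow_in[OF sub[of 0 i]] that p(1) I(1) by simp
    have dist: "dg (p i) (p j) = j - i" if "i \<le> j" "j \<le> n" for i j
    proof -
      have "n \<le> dg (p 0) (p i) + dg (p i) (p j) + dg (p j) (p n)"
      proof -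
        have "dg (p 0) (p n) = n" unfolding p(1,2) by (rule n_def[symmetric])
        moreover have "dg (p 0) (p n) \<le> dg (p 0) (p j) + dg (p j) (p n)"
          "dg (p 0) (p j) \<le> dg (p 0) (p i) + dg (p i) (p j)"
          using that by (auto intro!: dg_triangle pI)
        ultimately show ?thesis by linarith
      qed
      moreover have "dg (p 0) (p i) \<le> i" "dg (p i) (p j) \<le> j - i" "dg (p j) (p n) \<le> n - j"
        using dg_le[OF sub[of 0 i]] dg_le[OF sub[of i j]] dg_le[OF sub[of j n]] that by auto
      ultimately show ?thesis using that by linarith
    qed
    have link: "cg.link (p i) (p (Suc i))" if "i < n" for i
      unfolding cg.link_def using edges_seg(1,2)[of "p i" "p (Suc i)"] p(3) that dg_le[of _ _ 1] by auto
    have "cg.quasi_path p n" unfolding cg.quasi_path_def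
    proof (intro conjI allI impI)
      fix i j assume ij: "i \<le> n" "j \<le> n"
      have "real (dg (p i) (p j)) = \<bar>real i - real j\<bar>"
        using dist[of i j] dist[of j i] ij dg_commute[of "p i" "p j"] by (cases "i \<le> j") auto
      then show "\<bar>real i - real j\<bar> \<le> 1 * real (dg (p i) (p j)) + 1" by simp
    qed (use pI link in auto)
    then obtain i where i: "i \<le> n" "real (dg (c t) (p i)) \<le> H"
      using H[OF _ c p(1)[symmetric] p(2)[symmetric] L t] by blast
    have "dg (c 0) (p i) = i" "dg (p i) (c L) = n - i" using dist[of 0 i] dist[of i n] i(1) p by auto
    moreover have "dg (c 0) (c t) \<le> dg (c 0) (p i) + dg (p i) (c t)" "dg (c t) (c L) \<le> dg (c t) (p i) + dg (p i) (c L)"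
      using dg_triangle I pI[OF i(1)] by auto
    ultimately show ?thesis using i dg_commute[of "p i" "c t"] unfolding n_def[symmetric] by linarith
  qed
  then show ?thesis by blast
qed

lemma dg_between:
  "\<exists>C. \<forall>x m y. Im x > 0 \<and> Im m > 0 \<and> Im y > 0 \<and> hD x m + hD m y \<le> hD x y + K \<longrightarrow>
     real (dg x m) + real (dg m y) \<le> real (dg x y) + C"
proof -
  obtain H where H: "\<And>c L t. geod hyp_plane hD c L \<Longrightarrow> t \<in> {0..L} \<Longrightarrow>
     real (dg (c 0) (c t)) + real (dg (c t) (c L)) \<le> real (dg (c 0) (c L)) + H"
    using dg_between_geodesic by blast
  have "real (dg x m) + real (dg m y) \<le> real (dg x y) + (H + 2 * (1 * (K + 2 * ln 5) + 1))"
    if "Im x > 0" "Im m > 0" "Im y > 0" "hD x m + hD m y \<le> hD x y + K" for x m y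
  proof (rule hyp.coarse_between_transfer[where d = "\<lambda>x y. real (dg x y)"])
    show "real (dg x y) = real (dg y x)" for x y by (simp add: dg_commute)
    show "real (dg x z) \<le> real (dg x y) + real (dg y z)" if "x \<in> hyp_plane" "y \<in> hyp_plane" "z \<in> hyp_plane" for x y z
      using dg_triangle[of x y z] that by simp
    show "real (dg x y) \<le> 1 * hD x y + 1" if "x \<in> hyp_plane" "y \<in> hyp_plane" for x y
      using dg_le_dist[of x y] that by simp
    show "real (dg (c 0) (c t)) + real (dg (c t) (c L)) \<le> real (dg (c 0) (c L)) + H"
      if "geod hyp_plane hD c L" "t \<in> {0..L}" for c L t by (rule H[OF that])
  qed (use that in simp_all)
  then show ?thesis by blast
qed

lemma dg_hyperbolic: "gromov_hyperbolic hyp_plane (\<lambda>x y. real (dg x y))"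
proof -
  obtain C where C: "\<And>x m y. Im x > 0 \<Longrightarrow> Im m > 0 \<Longrightarrow> Im y > 0 \<Longrightarrow> hD x m + hD m y \<le> hD x y + 2 * ln 5 \<Longrightarrow>
     real (dg x m) + real (dg m y) \<le> real (dg x y) + C"
    using dg_between[of "2 * ln 5"] by blast
  show ?thesis
  proof (rule hyp.gromov_hyperbolic_transfer[of _ "max C 0"])
    show "real (dg x y) = real (dg y x)" for x y by (simp add: dg_commute)
    show "real (dg x z) \<le> real (dg x y) + real (dg y z)" if "x \<in> hyp_plane" "y \<in> hyp_plane" "z \<in> hyp_plane" for x y z
      using dg_triangle[of x y z] that by simp
    show "real (dg x m) + real (dg m y) \<le> real (dg x y) + max C 0"
      if "x \<in> hyp_plane" "m \<in> hyp_plane" "y \<in> hyp_plane" "hD x m + hD m y \<le> hD x y + 2 * ln 5" for x m y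
      using C[of x m y] that by simp
  qed simp
qed

section \<open>Unboundedness of \<open>dg\<close> along an axis that crosses its translate\<close>

lemma deck_translate:
  assumes g: "deck g" and A: "hyp_line A" "\<And>t. g (A t) = A (t + l)"
  shows "\<exists>k. deck k \<and> (\<forall>t. k (A t) = A (t - real N * l))"
proof (induction N)
  case 0
  then show ?case using deck_id by (intro exI[of _ "\<lambda>z. z"]) simp
next
  case (Suc N)
  then obtain k where k: "deck k" "\<forall>t. k (A t) = A (t - real N * l)" by blast
  obtain g' where g': "deck g'" "\<And>z. Im z > 0 \<Longrightarrow> g' (g z) = z" using deck_inverse[OF g] by metis
  have "g' (A t) = A (t - l)" for t
    using g'(2)[OF hyp_lineD(1)[OF A(1), of "t - l"]] A(2)[of "t - l"] by simp
  then have "k (g' (A t)) = A (t - real (Suc N) * l)" for t using k(2) by (simp add: algebra_simps)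
  then show ?case using deck_comp[OF k(1) g'(1)] by blast
qed

text \<open>A short chain of edges along a long piece of the axis \<open>A\<close> contains, by the pigeonhole principle,
  an edge on a simple line \<open>Q\<close> that follows \<open>A\<close> for a long time; then \<open>h Q\<close> crosses \<open>Q\<close>
  because \<open>h A\<close> crosses \<open>A\<close>.\<close>

lemma dg_axis_unbounded:
  assumes g: "deck g" and A: "hyp_line A" "\<And>t. g (A t) = A (t + l)" and l: "l > 0"
    and h: "deck h" "h (A t0) = A s0" "h (A u0) \<notin> range A"
  shows "\<exists>k. dg (A 0) (A (real k * l)) > n"
proof (rule ccontr)
  assume "\<not> ?thesis"
  then have bounded: "dg (A 0) (A (real k * l)) \<le> n" for k by (meson not_less)
  \<comment> \<open>At most n edges, padded to N > 0 as \<open>seg_polygon\<close> requires; K below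
    is its constant for N sides.\<close>
  define N where "N = Suc n"
  define K where "K = 2 * (2 * ln 5) * real N"
  have K0: "K \<ge> 0" unfolding K_def by simp
  have AI: "Im (A t) > 0" for t by (rule hyp_lineD(1)[OF A(1)])
  obtain f where f: "is_mob f" "\<And>t. f (A t) = vert t" using hyp_line_normalize[OF A(1)] by blast
  note fi = hyp_isom_mob[OF f(1)]
  have f_inj: "z = w" if "f z = f w" "Im z > 0" "Im w > 0" for z w
    using hyp_isom_dist[OF fi that(2,3)] that hyp_dist_eq_0_iff[OF that(2,3)] by simp
  note hA = deck_line[OF h(1) A(1)]
  define B where "B s = f (h (A s))" for s
  have B: "hyp_line B" unfolding B_def using hyp_line_isom[OF hA fi] .
  have B0: "Re (B t0) = 0" unfolding B_def h(2) f(2) by simp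
  have B1: "Re (B u0) \<noteq> 0"
  proof
    assume "Re (B u0) = 0"
    then have "B u0 = vert (ln (Im (B u0)))" using hyp_lineD(1)[OF B, of u0] by (simp add: complex_eq_iff)
    then have "f (h (A u0)) = f (A (ln (Im (B u0))))" unfolding f(2) by (simp add: B_def)
    then have "h (A u0) = A (ln (Im (B u0)))" by (rule f_inj[OF _ hyp_lineD(1)[OF hA] AI])
    then show False using h(3) by blast
  qed
  obtain L where L: "L > 0" and stable: "\<And>Q Q' zm zp Pm Pp sm sp s's s'p. \<lbrakk>hyp_line Q; hyp_line Q';
     sm \<le> -L; sp \<ge> L; s's \<le> -L; s'p \<ge> L;
     zm \<in> range Q; zp \<in> range Q; Pm \<in> range Q'; Pp \<in> range Q';
     hD (vert sm) zm \<le> K; hD (vert sp) zp \<le> K; hD (B s's) Pm \<le> K; hD (B s'p) Pp \<le> K\<rbrakk>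
     \<Longrightarrow> (\<exists>u v. Q u = Q' v) \<and> Pp \<notin> range Q"
    by (rule crossing_lines_stable[OF B B0 B1 K0]) blast
  obtain M where M: "real M > (L + K + 2) / l" using reals_Archimedean2 by blast
  have Ml: "real M * l > L + K + 2" using M l by (simp add: field_simps)
  \<comment> \<open>N + 1 marked points for N edges. Even multiples of M l make the midpoint of
    \<open>T i\<close> and \<open>T j\<close> a multiple of l, so that a power of \<open>g\<close>
    can bring it to 0.\<close>
  define T where "T j = real (2 * j * M) * l" for j :: nat
  have T_le: "T i \<le> T j" if "i \<le> j" for i j unfolding T_def using that l by (intro mult_right_mono of_nat_mono) auto
  have "(A 0, A (T N)) \<in> edges ^^ N"
    using edges_pow_mono[OF dg_path[OF AI[of 0] AI[of "T N"]] AI[of 0], of N] bounded[of "2 * N * M"]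
    unfolding T_def N_def by simp
  then obtain p where p: "p 0 = A 0" "p N = A (T N)" "\<forall>i<N. (p i, p (Suc i)) \<in> edges"
    unfolding relpow_fun_conv by blast
  have pI: "Im (p i) > 0" if "i \<le> N" for i
    using p(3) that AI[of 0] p(1) by (cases i) (auto simp: edges_def)
  have "\<exists>i<N. \<exists>m\<in>hyp.seg (p i) (p (Suc i)). hD (A (T j)) m \<le> K" if "j \<le> N" for j
  proof -
    have "0 \<le> T j" "T j \<le> T N" using T_le[OF that] T_le[of 0 j] unfolding T_def by auto
    then have "A (T j) \<in> hyp.seg (p 0) (p N)"
      unfolding p(1,2) hyp.seg_def using AI hyp_lineD(2)[OF A(1)] by auto
    from hyp.seg_polygon[of N p, OF _ this] show ?thesis unfolding K_def N_def[symmetric] using pI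
      by (auto simp: N_def)
  qed
  then obtain ix mp where ix: "\<And>j. j \<le> N \<Longrightarrow> ix j < N \<and> mp j \<in> hyp.seg (p (ix j)) (p (Suc (ix j))) \<and> hD (A (T j)) (mp j) \<le> K"
    by metis
  have "\<not> inj_on ix {..N}"
  proof
    assume "inj_on ix {..N}"
    then have "card {..N} \<le> card {..<N}" by (rule card_inj_on_le) (use ix in auto)
    then show False by simp
  qed
  then obtain i j where ij: "i \<le> N" "j \<le> N" "i < j" "ix i = ix j"
    unfolding inj_on_def by (metis atMost_iff linorder_neqE_nat)
  define a b where "a = mp i" and "b = mp j"
  define e where "e = ix i"
  have e: "e < N" "a \<in> hyp.seg (p e) (p (Suc e))" "b \<in> hyp.seg (p e) (p (Suc e))"
    "hD (A (T i)) a \<le> K" "hD (A (T j)) b \<le> K"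
    using ix[OF ij(1)] ix[OF ij(2)] ij(4) unfolding e_def a_def b_def by auto
  have abI: "Im a > 0" "Im b > 0" using e(2,3) by (auto simp: hyp.seg_def)
  have peI: "Im (p e) > 0" "Im (p (Suc e)) > 0" using pI e(1) by auto
  have ed: "(p e, p (Suc e)) \<in> edges" using p(3) e(1) by blast
  have Tij: "T j - T i \<ge> 2 * (real M * l)"
  proof -
    have "T (Suc i) \<le> T j" by (rule T_le) (use ij in simp)
    then show ?thesis unfolding T_def by (simp add: algebra_simps)
  qed
  \<comment> \<open>A short edge cannot come within K of two marked points, whose distance exceeds
    2(L + K + 2).\<close>
  have "\<not> hD (p e) (p (Suc e)) \<le> 1"
  proof
    assume short: "hD (p e) (p (Suc e)) \<le> 1"
    have "hD a (p e) \<le> 1" "hD (p e) b \<le> 1"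
      using e(2,3) short hyp_dist_nonneg[OF abI(1) peI(2)] hyp_dist_nonneg[OF abI(2) peI(2)] hyp_dist_commute[of a]
      by (auto simp: hyp.seg_def)
    then have "hD (A (T i)) (A (T j)) \<le> K + 2 + K"
      using hyp_dist_triangle[OF AI abI(1) AI, of "T i" "T j"] hyp_dist_triangle[OF abI(1) peI(1) AI, of "T j"]
        hyp_dist_triangle[OF peI(1) abI(2) AI, of "T j"] e(4,5) hyp_dist_commute[of b "A (T j)"]
      by linarith
    then have "\<bar>T i - T j\<bar> \<le> K + 2 + K" unfolding hyp_lineD(2)[OF A(1)] .
    then show False using Tij Ml L K0 by linarith
  qed
  then obtain Q where Q: "simple_line Q" "p e \<in> range Q" "p (Suc e) \<in> range Q" using ed unfolding edges_def by auto
  have Ql: "hyp_line Q" using Q(1) unfolding simple_line_def by blast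
  have ab: "a \<in> range Q" "b \<in> range Q" using seg_subset_line[OF Ql] e(2,3) Q(2,3) by (metis rangeE)+
  \<comment> \<open>Centres the long stretch at parameter 0: it becomes the symmetric interval from
    \<open>sm\<close> to \<open>sp\<close>, of half-length at least L.\<close>
  obtain k where k: "deck k" "\<forall>t. k (A t) = A (t - real ((i + j) * M) * l)" using deck_translate[OF g A] by blast
  define Q1 where "Q1 t = k (Q t)" for t
  have Q1: "simple_line Q1" unfolding Q1_def by (rule simple_line_deck[OF Q(1) k(1)])
  then have Q1l: "hyp_line Q1" unfolding simple_line_def by blast
  define sm sp where "sm = T i - real ((i + j) * M) * l" and "sp = T j - real ((i + j) * M) * l"
  have s_eq: "sp = (T j - T i) / 2" "sm = - ((T j - T i) / 2)" unfolding sm_def sp_def T_def by (simp_all add: field_simps)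
  have s: "sm \<le> -L" "sp \<ge> L" 
  proof -
    have "2 * L \<le> T j - T i" using Tij Ml K0 by linarith
    then show "sm \<le> -L" "sp \<ge> L" unfolding s_eq by simp_all
  qed
  have kab: "Im (k a) > 0" "Im (k b) > 0" "k a \<in> range Q1" "k b \<in> range Q1"
    using deck_in[OF k(1)] abI ab unfolding Q1_def by auto
  have near: "hD (A sm) (k a) \<le> K" "hD (A sp) (k b) \<le> K"
    using deck_dist[OF k(1) AI abI(1), of "T i"] deck_dist[OF k(1) AI abI(2), of "T j"] k(2) e(4,5)
    unfolding sm_def sp_def by auto
  \<comment> \<open>\<open>Q1\<close> follows A, hence \<open>h Q1\<close> follows h A; in the
    coordinate \<open>f\<close> these two are \<open>vert\<close> and \<open>B\<close>.\<close>
  have "(\<exists>u v. f (Q1 u) = f (h (Q1 v))) \<and> f (h (k b)) \<notin> range (\<lambda>t. f (Q1 t))"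
  proof (rule stable[where Q = "\<lambda>t. f (Q1 t)" and Q' = "\<lambda>t. f (h (Q1 t))" and sm = sm and sp = sp and s's = sm and s'p = sp
        and zm = "f (k a)" and zp = "f (k b)" and Pm = "f (h (k a))" and Pp = "f (h (k b))"])
    show "hyp_line (\<lambda>t. f (Q1 t))" by (rule hyp_line_isom[OF Q1l fi])
    show "hyp_line (\<lambda>t. f (h (Q1 t)))" by (rule hyp_line_isom[OF deck_line[OF h(1) Q1l] fi])
    show "hD (vert sm) (f (k a)) \<le> K" "hD (vert sp) (f (k b)) \<le> K"
      using near hyp_isom_dist[OF fi AI] kab f(2) by metis+
    show "hD (B sm) (f (h (k a))) \<le> K" "hD (B sp) (f (h (k b))) \<le> K"
      unfolding B_def using near hyp_isom_dist[OF fi deck_in[OF h(1) AI] deck_in[OF h(1)]] kab deck_dist[OF h(1) AI]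
      by metis+
  qed (use s kab in auto)
  then obtain u v where uv: "f (Q1 u) = f (h (Q1 v))" and out: "f (h (k b)) \<notin> range (\<lambda>t. f (Q1 t))" by blast
  \<comment> \<open>The common point forces h to move \<open>Q1\<close> along itself, so
    \<open>h (k b)\<close> is on \<open>Q1\<close>, against \<open>out\<close>.\<close>
  have "h (Q1 v) = Q1 u" using f_inj[OF uv] hyp_lineD(1)[OF Q1l] deck_in[OF h(1)] by metis
  from simple_line_return[OF Q1 h(1) this] have "h (k b) \<in> range Q1" using kab(4) by auto
  then show False using out by auto
qed

end

section \<open>Word geodesics\<close>

lemma compact_hyp_disc: "compact {z. Im z > 0 \<and> hD \<i> z \<le> R}"
proof -
  let ?A = "{z. Im z > 0 \<and> hD \<i> z \<le> R}" and ?B = "{z. exp (- R) \<le> Im z}"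
  have BH: "?B \<subseteq> hyp_plane" by (auto intro: less_le_trans[OF exp_gt_zero])
  have "?A \<subseteq> ?B"
  proof
    fix z assume "z \<in> ?A"
    then have z: "Im z > 0" "hD \<i> z \<le> R" by auto
    have "\<bar>ln (Im \<i>) - ln (Im z)\<bar> \<le> hD \<i> z" by (rule hyp_dist_ge_ln_Im) (use z in auto)
    then have "- R \<le> ln (Im z)" using z(2) by simp
    then have "exp (- R) \<le> exp (ln (Im z))" by simp
    then show "z \<in> ?B" using z(1) by simp
  qed
  then have eq: "?A = ?B \<inter> hD \<i> -` {..R}" using BH by auto
  have "closed ?B" by (rule closed_halfspace_Im_ge)
  moreover have "continuous_on ?B (hD \<i>)" by (rule continuous_on_subset[OF continuous_on_hyp_dist BH]) simp
  ultimately have "closed ?A" unfolding eq by (simp add: continuous_on_closed_vimage[THEN iffD1, rule_format] Int_commute)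
  moreover have "bounded ?A"
  proof (rule boundedI)
    fix z assume "z \<in> ?A"
    then have z: "Im z > 0" "hD \<i> z \<le> R" by auto
    have "(cmod (\<i> - z))\<^sup>2 \<le> 2 * exp R * (cosh R - 1) * (Im \<i>)\<^sup>2" by (rule cmod_le_hyp_dist) (use z in auto)
    then have "cmod (\<i> - z) \<le> sqrt (2 * exp R * (cosh R - 1))" by (simp add: real_le_rsqrt)
    then show "cmod z \<le> sqrt (2 * exp R * (cosh R - 1)) + 1"
      using norm_triangle_ineq4[of \<i> "\<i> - z"] by simp
  qed
  ultimately show ?thesis by (simp add: compact_eq_bounded_closed)
qed

text \<open>With \<open>d = hD\<close> a link is a pair at distance at most A, and
  \<open>morse\<close> becomes the Morse lemma for discrete quasigeodesics. A geodesic sampled at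
  unit steps is the connecting chain.\<close>

lemma hyp_coarse_geodesic:
  assumes A: "A \<ge> 1" shows "coarse_geodesic hyp_plane hD (2 * ln 5) hD A"
proof -
  have le: "x \<le> A * x + A" if "x \<ge> 0" for x
    using mult_right_mono[OF A that] A by linarith
  interpret cp: coarse_paths hyp_plane hD "2 * ln 5" hD A
    by unfold_locales (use A le hyp_dist_nonneg hyp_dist_triangle in \<open>auto simp: hyp_dist_commute\<close>)
  have link: "cp.link u v" if "Im u > 0" "Im v > 0" "hD u v \<le> A" for u v
    unfolding cp.link_def hyp.seg_def
  proof
    fix m assume "m \<in> {m \<in> hyp_plane. hD u m + hD m v = hD u v}"
    then have m: "Im m > 0" "hD u m + hD m v = hD u v" by auto
    show "hD m u \<le> A \<and> hD m v \<le> A"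
      using m(2) that hyp_dist_nonneg[OF that(1) m(1)] hyp_dist_nonneg[OF m(1) that(2)] hyp_dist_commute[of m u] by auto
  qed
  show ?thesis
  proof (unfold_locales, goal_cases)
    case (1 x y)
    then have I: "Im x > 0" "Im y > 0" by auto
    let ?D = "hD x y" and ?Z = "{z \<in> hyp_plane. hD x z \<le> hD x y + A}"
    have D0: "?D \<ge> 0" by (rule hyp_dist_nonneg[OF I])
    obtain J where J: "hyp_line J" "J 0 = x" "J ?D = y" using hyp_line_through[OF I] by blast
    define n where "n = nat \<lceil>?D\<rceil>"
    have n: "?D \<le> real n" "real n \<le> ?D + 1" unfolding n_def using D0 by linarith+
    define q where "q k = J (min (real k) ?D)" for k
    have qI: "Im (q k) > 0" for k unfolding q_def by (rule hyp_lineD(1)[OF J(1)])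
    have qZ: "q k \<in> ?Z" for k
    proof -
      have "hD x (q k) = min (real k) ?D"
        using hyp_lineD(2)[OF J(1), of 0 "min (real k) ?D"] J(2) D0 unfolding q_def by simp
      then show ?thesis using qI A by simp
    qed
    have "hD (q k) (q (Suc k)) \<le> 1" for k unfolding q_def hyp_lineD(2)[OF J(1)] by linarith
    then have "cp.link (q k) (q (Suc k))" for k using link[OF qI qI] A by (meson order_trans)
    then have "(q k, q (Suc k)) \<in> cp.chain_rel ?Z" for k unfolding cp.chain_rel_def using qZ by blast
    moreover have "q 0 = x" "q n = y" unfolding q_def using J n D0 by (auto simp: min_def)
    ultimately have "(x, y) \<in> cp.chain_rel ?Z ^^ n" unfolding relpow_fun_conv by blast
    moreover have "real n \<le> A * ?D + A" using n(2) mult_right_mono[OF A D0] A by linarith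
    ultimately show ?case by blast
  qed
qed

text \<open>A discrete quasigeodesic stays close to the geodesic between its endpoints: the geodesic is
  covered by neighbourhoods of the path, and a point where the covering passes from the part
  before \<open>p j\<close> to the part after it is close to \<open>p j\<close>.\<close>

lemma quasigeodesic_between:
  assumes A: "A \<ge> 1"
  obtains K where "\<And>p n i j k. \<lbrakk>\<And>a. a \<le> n \<Longrightarrow> Im (p a) > 0; \<And>a. a < n \<Longrightarrow> hD (p a) (p (Suc a)) \<le> A;
      \<And>a b. a \<le> n \<Longrightarrow> b \<le> n \<Longrightarrow> \<bar>real a - real b\<bar> \<le> A * hD (p a) (p b) + A; i \<le> j; j \<le> k; k \<le> n\<rbrakk>
      \<Longrightarrow> hD (p i) (p j) + hD (p j) (p k) \<le> hD (p i) (p k) + K"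
proof -
  interpret cg: coarse_geodesic hyp_plane hD "2 * ln 5" hD A by (rule hyp_coarse_geodesic[OF A])
  obtain H where H0: "H \<ge> 0" and H: "\<And>p n c L t. cg.quasi_path p n \<Longrightarrow> geod hyp_plane hD c L \<Longrightarrow> c 0 = p 0 \<Longrightarrow> c L = p n \<Longrightarrow> L \<ge> 0 \<Longrightarrow>
      t \<in> {0..L} \<Longrightarrow> \<exists>i\<le>n. hD (c t) (p i) \<le> H"
    using cg.morse by (metis (no_types, lifting))
  \<comment> \<open>Bounds the index difference of two path points at distance at most 2H +
    1.\<close>
  define W where "W = A * (2 * H + 1) + A"
  have "hD (p i) (p j) + hD (p j) (p k) \<le> hD (p i) (p k) + 2 * (H + A * W)"
    if pI: "\<And>a. a \<le> n \<Longrightarrow> Im (p a) > 0" and step: "\<And>a. a < n \<Longrightarrow> hD (p a) (p (Suc a)) \<le> A"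
      and qg: "\<And>a b. a \<le> n \<Longrightarrow> b \<le> n \<Longrightarrow> \<bar>real a - real b\<bar> \<le> A * hD (p a) (p b) + A"
      and ijk: "i \<le> j" "j \<le> k" "k \<le> n" for p n i j k
  proof -
    have I: "Im (p i) > 0" "Im (p j) > 0" "Im (p k) > 0" using pI ijk by auto
    define L where "L = hD (p i) (p k)"
    have L0: "L \<ge> 0" unfolding L_def by (rule hyp_dist_nonneg[OF I(1,3)])
    have "p i \<in> hyp_plane" "p k \<in> hyp_plane" using I by auto
    then obtain c where c: "geod hyp_plane hD c L" "c 0 = p i" "c L = p k"
      unfolding L_def using hyp_geod_exists by blast
    have cI: "Im (c t) > 0" if "t \<in> {0..L}" for t using hyp.geod_in[OF c(1) that] by simp
    have lin: "hD (p a) (p (a + m)) \<le> A * real m" if "a + m \<le> n" for a m using that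
    proof (induction m)
      case 0 then show ?case by simp
    next
      case (Suc m)
      have "hD (p a) (p (a + Suc m)) \<le> hD (p a) (p (a + m)) + hD (p (a + m)) (p (Suc (a + m)))"
        using hyp_dist_triangle[of "p a" "p (a + m)" "p (Suc (a + m))"] pI Suc.prems by simp
      also have "\<dots> \<le> A * real m + A" using Suc step[of "a + m"] by (intro add_mono) auto
      finally show ?case by (simp add: algebra_simps)
    qed
    have link: "cg.link (p (i + a)) (p (i + Suc a))" if "a < k - i" for a
      unfolding cg.link_def
    proof
      fix m assume "m \<in> hyp.seg (p (i + a)) (p (i + Suc a))"
      then have m: "Im m > 0" "hD (p (i + a)) m + hD m (p (i + Suc a)) = hD (p (i + a)) (p (i + Suc a))"
        by (auto simp: hyp.seg_def)
      have ia: "Im (p (i + a)) > 0" "Im (p (i + Suc a)) > 0" using pI that ijk by auto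
      have "hD (p (i + a)) (p (i + Suc a)) \<le> A" using step[of "i + a"] that ijk by simp
      then show "hD m (p (i + a)) \<le> A \<and> hD m (p (i + Suc a)) \<le> A"
        using m(2) hyp_dist_nonneg[OF ia(1) m(1)] hyp_dist_nonneg[OF m(1) ia(2)]
          hyp_dist_commute[of m "p (i + a)"] by linarith
    qed
    have qp: "cg.quasi_path (\<lambda>a. p (i + a)) (k - i)" unfolding cg.quasi_path_def
    proof (intro conjI allI impI)
      fix a b assume ab: "a \<le> k - i" "b \<le> k - i"
      then have "i + a \<le> n" "i + b \<le> n" using ijk by auto
      from qg[OF this] show "\<bar>real a - real b\<bar> \<le> A * hD (p (i + a)) (p (i + b)) + A" by simp
    qed (use pI ijk link in auto)
    have near: "\<exists>a. i \<le> a \<and> a \<le> k \<and> hD (c t) (p a) \<le> H" if t: "t \<in> {0..L}" for t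
    proof -
      obtain a where "a \<le> k - i" "hD (c t) (p (i + a)) \<le> H"
        using H[OF qp c(1) _ _ L0 t] c ijk by auto
      then show ?thesis using ijk by (intro exI[of _ "i + a"]) auto
    qed
    \<comment> \<open>Times at which the geodesic is near the part of the path up to
      \<open>p j\<close>.\<close>
    define P where "P = {t \<in> {0..L}. \<exists>a. i \<le> a \<and> a \<le> j \<and> hD (c t) (p a) \<le> H}"
    have P0: "0 \<in> P" unfolding P_def using L0 c(2) H0 ijk by (auto intro!: exI[of _ i])
    have bdd: "bdd_above P" unfolding P_def by (intro bdd_aboveI[of _ L]) auto
    define s where "s = Sup P"
    have sP: "t \<le> s" if "t \<in> P" for t unfolding s_def by (rule cSup_upper[OF that bdd])
    have "\<exists>t\<in>P. s - 1/2 < t" using less_cSup_iff[of P "s - 1/2"] P0 bdd unfolding s_def by auto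
    then obtain t1 a where t1: "t1 \<in> {0..L}" "s - 1/2 < t1" "t1 \<le> s" and a: "i \<le> a" "a \<le> j" "hD (c t1) (p a) \<le> H"
      using sP unfolding P_def by blast
    \<comment> \<open>\<open>t1\<close> lies in \<open>P\<close> just before its supremum and
      \<open>t2\<close> just beyond it, so \<open>c t2\<close> is near the later part of the path.
      If the geodesic ends first, \<open>t2 = L\<close> and the end \<open>p k\<close>
      serves.\<close>
    define t2 where "t2 = min L (s + 1/2)"
    have t2: "t2 \<in> {0..L}" "\<bar>t1 - t2\<bar> \<le> 1" unfolding t2_def using t1 L0 by auto
    have "\<exists>b. j \<le> b \<and> b \<le> k \<and> hD (c t2) (p b) \<le> H"
    proof (cases "t2 = L")
      case True
      then show ?thesis using c(3) H0 ijk by (intro exI[of _ k]) auto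
    next
      case False
      then have "t2 \<notin> P" using sP[of t2] unfolding t2_def by auto
      then have no: "\<not> (i \<le> a \<and> a \<le> j \<and> hD (c t2) (p a) \<le> H)" for a using t2(1) unfolding P_def by blast
      obtain b where "i \<le> b" "b \<le> k" "hD (c t2) (p b) \<le> H" using near[OF t2(1)] by blast
      then show ?thesis using no[of b] by (intro exI[of _ b]) auto
    qed
    then obtain b where b: "j \<le> b" "b \<le> k" "hD (c t2) (p b) \<le> H" by blast
    have ab: "Im (p a) > 0" "Im (p b) > 0" "a \<le> n" "b \<le> n" using pI a b ijk by auto
    note ct = cI[OF t1(1)] cI[OF t2(1)]
    have "hD (c t1) (c t2) \<le> 1" using hyp.geod_dist[OF c(1) t1(1) t2(1)] t2(2) by simp
    then have "hD (p a) (p b) \<le> 2 * H + 1"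
      using hyp_dist_triangle[OF ab(1) ct(1) ab(2)] hyp_dist_triangle[OF ct ab(2)] a(3) b(3)
        hyp_dist_commute[of "p a" "c t1"] by linarith
    then have "A * hD (p a) (p b) \<le> A * (2 * H + 1)" using A by (intro mult_left_mono) auto
    then have "real j - real a \<le> W" using qg[OF ab(3,4)] a(2) b(1) unfolding W_def by linarith
    then have "A * real (j - a) \<le> A * W" using a(2) A by (intro mult_left_mono) auto
    then have "hD (p a) (p j) \<le> A * W" using lin[of a "j - a"] a(2) ijk by simp
    then have j1: "hD (c t1) (p j) \<le> H + A * W" using hyp_dist_triangle[OF ct(1) ab(1) I(2)] a(3) by linarith
    have "hD (p i) (c t1) = t1" "hD (c t1) (p k) = L - t1"
      using hyp.geod_dist[OF c(1), of 0 t1] hyp.geod_dist[OF c(1), of t1 L] c t1 L0 by auto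
    moreover define V where "V = H + A * W"
    ultimately show ?thesis
      using hyp_dist_triangle[OF I(1) ct(1) I(2)] hyp_dist_triangle[OF I(2) ct(1) I(3)] j1
        hyp_dist_commute[of "p j" "c t1"] unfolding L_def V_def[symmetric] by linarith
  qed
  then show thesis by (rule that)
qed

context developed_surface
begin

section \<open>The orbit map of \<Gamma> into the plane\<close>

lemma G_inv_closed: "A \<in> carrier G \<Longrightarrow> inv\<^bsub>G\<^esub> A \<in> carrier G"
  by (rule group.inv_closed[OF group_G])

lemma holo_inv:
  assumes "A \<in> carrier G" "Im z > 0" shows "holo (inv\<^bsub>G\<^esub> A) (holo A z) = z"
proof -
  have "holo (inv\<^bsub>G\<^esub> A \<otimes>\<^bsub>G\<^esub> A) z = z"
    unfolding group.l_inv[OF group_G assms(1)] by (rule holo_one[OF assms(2)])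
  then show ?thesis using holo_mult_closed(2)[OF G_inv_closed[OF assms(1)] assms(1) assms(2)] by metis
qed

definition orb :: "(real \<Rightarrow> 'a) set \<Rightarrow> complex" where "orb A = holo A \<i>"

lemma orb_in: "A \<in> carrier G \<Longrightarrow> Im (orb A) > 0"
  unfolding orb_def by (rule holo_in) auto

lemma orb_mult: "A \<in> carrier G \<Longrightarrow> B \<in> carrier G \<Longrightarrow> orb (A \<otimes>\<^bsub>G\<^esub> B) = holo A (orb B)"
  unfolding orb_def by (rule holo_mult_closed(2)) auto

lemma orb_inj: "A \<in> carrier G \<Longrightarrow> B \<in> carrier G \<Longrightarrow> orb A = orb B \<Longrightarrow> A = B"
  unfolding orb_def by (rule holo_inj)

lemma orb_dist_diff:
  assumes "A \<in> carrier G" "B \<in> carrier G"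
  shows "hD \<i> (orb (inv\<^bsub>G\<^esub> A \<otimes>\<^bsub>G\<^esub> B)) = hD (orb A) (orb B)"
proof -
  have "orb (inv\<^bsub>G\<^esub> A \<otimes>\<^bsub>G\<^esub> B) = holo (inv\<^bsub>G\<^esub> A) (orb B)" using orb_mult G_inv_closed assms by blast
  moreover have "\<i> = holo (inv\<^bsub>G\<^esub> A) (orb A)" unfolding orb_def using holo_inv[OF assms(1), of \<i>] by simp
  ultimately show ?thesis
    using deck_dist[OF holo_deck[OF G_inv_closed[OF assms(1)]] orb_in[OF assms(1)] orb_in[OF assms(2)]] by metis
qed

text \<open>A disc of radius r/2 contains at most one orbit point, since \<open>E\<close> takes one
  value on the orbit and is injective at distances below r; finitely many such discs cover a compact
  disc.\<close>

lemma finite_orbit_ball: "finite {A \<in> carrier G. hD \<i> (orb A) \<le> R}"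
proof -
  let ?D = "{z. Im z > 0 \<and> hD \<i> z \<le> R}" and ?F = "{A \<in> carrier G. hD \<i> (orb A) \<le> R}"
  have op: "open (hball z (r/2))" if "z \<in> ?D" for z using open_hball[of z] that by simp
  have cov: "?D \<subseteq> (\<Union>z\<in>?D. hball z (r/2))" using r_pos by auto
  obtain X where X: "X \<subseteq> ?D" "finite X" "?D \<subseteq> (\<Union>z\<in>X. hball z (r/2))"
    using compactE_image[OF compact_hyp_disc[of R] op cov] by blast
  have "\<forall>A\<in>?F. \<exists>z. z \<in> X \<and> orb A \<in> hball z (r/2)"
  proof
    fix A assume "A \<in> ?F"
    then have "orb A \<in> ?D" using orb_in by simp
    then have "orb A \<in> (\<Union>z\<in>X. hball z (r/2))" using X(3) by (rule rev_subsetD)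
    then show "\<exists>z. z \<in> X \<and> orb A \<in> hball z (r/2)" by (elim UN_E) blast
  qed
  from bchoice[OF this] obtain f where "\<forall>A\<in>?F. f A \<in> X \<and> orb A \<in> hball (f A) (r/2)" ..
  then have f: "\<And>A. A \<in> ?F \<Longrightarrow> f A \<in> X \<and> orb A \<in> hball (f A) (r/2)" by (rule bspec)
  have "inj_on f ?F"
  proof (rule inj_onI)
    fix A B assume A: "A \<in> ?F" and B: "B \<in> ?F" and eq: "f A = f B"
    have c: "A \<in> carrier G" "B \<in> carrier G" using A B by blast+
    have "f A \<in> ?D" using f[OF A] X(1) by blast
    then have I: "Im (f A) > 0" "Im (orb A) > 0" "Im (orb B) > 0" using orb_in c by blast+
    have "hD (f A) (orb A) < r / 2" "hD (f A) (orb B) < r / 2" using f[OF A] f[OF B] eq by simp_all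
    then have "hD (orb A) (orb B) < r"
      using hyp_dist_triangle[OF I(2,1,3)] hyp_dist_commute[of "orb A" "f A"] by linarith
    moreover have "E (orb A) = E (orb B)" unfolding orb_def using deck_E[OF holo_deck] c by simp
    ultimately have "orb A = orb B" using E_inj_near[OF I(2,3)] by blast
    then show "A = B" using orb_inj c by blast
  qed
  moreover have "f ` ?F \<subseteq> X" using f by blast
  ultimately show ?thesis using X(2) inj_on_finite by blast
qed

lemma orb_cobounded: obtains R where "R \<ge> 0" "\<And>z. Im z > 0 \<Longrightarrow> \<exists>A\<in>carrier G. hD z (orb A) \<le> R"
proof -
  obtain R where R: "\<forall>z. Im z > 0 \<longrightarrow> (\<exists>h. deck h \<and> hD z (h \<i>) \<le> R)" using deck_cobounded by blast
  have "\<exists>A\<in>carrier G. hD z (orb A) \<le> max R 0" if z: "Im z > 0" for z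
  proof -
    obtain h where h: "deck h" "hD z (h \<i>) \<le> R" using R z by blast
    obtain A where A: "A \<in> carrier G" "\<And>z. Im z > 0 \<Longrightarrow> holo A z = h z" using holo_surj[OF h(1)] by metis
    have "orb A = h \<i>" unfolding orb_def using A(2)[of \<i>] by simp
    then show ?thesis using A(1) h(2) by (intro bexI[of _ A]) auto
  qed
  then show thesis using that[of "max R 0"] by simp
qed

section \<open>Words, word length, and orbits of word geodesics\<close>

definition words :: "(real \<Rightarrow> 'a) set set \<Rightarrow> (real \<Rightarrow> 'a) set \<Rightarrow> (real \<Rightarrow> 'a) set list \<Rightarrow> bool" where
  "words T A ws \<longleftrightarrow> set ws \<subseteq> T \<union> m_inv G ` T \<and> foldr (mult G) ws \<one>\<^bsub>G\<^esub> = A"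

lemma word_length_words: "word_length G T A = (LEAST n. \<exists>ws. length ws = n \<and> words T A ws)"
  unfolding word_length_def words_def ..

lemma words_append:
  assumes T: "T \<subseteq> carrier G" and "words T A ws" "words T B vs"
  shows "words T (A \<otimes>\<^bsub>G\<^esub> B) (ws @ vs)"
proof -
  have c: "set ws \<subseteq> carrier G" if "words T A ws" for A ws
    using that T G_inv_closed unfolding words_def by blast
  have fc: "foldr (mult G) ws \<one>\<^bsub>G\<^esub> \<in> carrier G" if "set ws \<subseteq> carrier G" for ws
    using that by (induction ws) (auto simp: G_one_closed holo_mult_closed(1))
  have "foldr (mult G) (ws @ vs) \<one>\<^bsub>G\<^esub> = foldr (mult G) ws \<one>\<^bsub>G\<^esub> \<otimes>\<^bsub>G\<^esub> foldr (mult G) vs \<one>\<^bsub>G\<^esub>"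
    using c[OF assms(2)]
  proof (induction ws)
    case Nil
    then show ?case using fc[OF c[OF assms(3)]] group_G by (simp add: group.is_monoid monoid.l_one)
  next
    case (Cons w ws)
    then show ?case using fc[OF c[OF assms(3)]] fc[of ws] group_G
      by (simp add: group.is_monoid monoid.m_assoc)
  qed
  then show ?thesis using assms unfolding words_def by auto
qed

lemma words_exist:
  assumes T: "T \<subseteq> carrier G" and A: "A \<in> generate G T"
  shows "\<exists>ws. words T A ws"
  using A
proof (induction rule: generate.induct)
  case one
  then show ?case by (intro exI[of _ "[]"]) (simp add: words_def)
next
  case (incl h)
  then have "h \<in> carrier G" using T by blast
  then show ?case using incl group_G
    by (intro exI[of _ "[h]"]) (simp add: words_def group.is_monoid monoid.r_one)
next
  case (inv h)
  then have "inv\<^bsub>G\<^esub> h \<in> carrier G" using T G_inv_closed by blast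
  then show ?case using inv group_G
    by (intro exI[of _ "[inv\<^bsub>G\<^esub> h]"]) (simp add: words_def group.is_monoid monoid.r_one)
next
  case (eng h1 h2)
  then show ?case using words_append[OF T] by blast
qed

lemma word_length_attained:
  assumes T: "finite_generating_set G T" and A: "A \<in> carrier G"
  shows "\<exists>ws. length ws = word_length G T A \<and> words T A ws"
proof -
  have "T \<subseteq> carrier G" "A \<in> generate G T" using T A unfolding finite_generating_set_def by auto
  then have "\<exists>n ws. length ws = n \<and> words T A ws" using words_exist by blast
  then show ?thesis unfolding word_length_words by (rule LeastI_ex)
qed

lemma word_length_mult:
  assumes T: "finite_generating_set G T" and A: "A \<in> carrier G" and B: "B \<in> carrier G"
  shows "word_length G T (A \<otimes>\<^bsub>G\<^esub> B) \<le> word_length G T A + word_length G T B"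
proof -
  obtain ws where ws: "length ws = word_length G T A" "words T A ws" using word_length_attained[OF T A] by blast
  obtain vs where vs: "length vs = word_length G T B" "words T B vs" using word_length_attained[OF T B] by blast
  have "T \<subseteq> carrier G" using T unfolding finite_generating_set_def by blast
  then have "words T (A \<otimes>\<^bsub>G\<^esub> B) (ws @ vs)" using words_append ws vs by blast
  then have "word_length G T (A \<otimes>\<^bsub>G\<^esub> B) \<le> length (ws @ vs)"
    unfolding word_length_words by (intro Least_le) blast
  then show ?thesis using ws vs by simp
qed

text \<open>Going back one unit towards \<open>\<i>\<close> and taking an orbit point nearby changes
  the group element by a factor from the finite set F of elements with displacement at most 2R +
  1.\<close>

lemma svarc_milnor:
  assumes T: "finite_generating_set G T"
  obtains W where "W \<ge> 0" "\<And>A. A \<in> carrier G \<Longrightarrow> real (word_length G T A) \<le> W * hD \<i> (orb A) + W"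
proof -
  obtain R where R: "R \<ge> 0" "\<And>z. Im z > 0 \<Longrightarrow> \<exists>A\<in>carrier G. hD z (orb A) \<le> R" using orb_cobounded by blast
  define F where "F = {A \<in> carrier G. hD \<i> (orb A) \<le> 2 * R + 1}"
  have finF: "finite F" unfolding F_def by (rule finite_orbit_ball)
  define W where "W = Max (insert 0 (word_length G T ` F))"
  have W: "word_length G T A \<le> W" if "A \<in> F" for A unfolding W_def using finF that by (intro Max_ge) auto
  \<comment> \<open>The induction measures a point z with \<open>orb A\<close> within R of it, and
    not \<open>orb A\<close> itself, so the error R does not accumulate.\<close>
  have ind: "word_length G T A \<le> W * n + W"
    if "A \<in> carrier G" "Im z > 0" "hD z (orb A) \<le> R" "hD \<i> z \<le> real n" for A z n
    using that
  proof (induction n arbitrary: A z)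
    case 0
    have iI: "Im \<i> > 0" by simp
    have "hD \<i> z = 0" using hyp_dist_nonneg[OF iI 0(2)] 0(4) by simp
    then have "z = \<i>" using hyp_dist_eq_0_iff[OF iI 0(2)] by simp
    then have "A \<in> F" unfolding F_def using 0 R(1) by simp
    then show ?case using W by simp
  next
    case (Suc n)
    obtain J where J: "hyp_line J" "J 0 = \<i>" "J (hD \<i> z) = z" using hyp_line_through[of \<i> z] Suc.prems by auto
    have D0: "hD \<i> z \<ge> 0" using hyp_dist_nonneg[of \<i> z] Suc.prems by simp
    define t where "t = max 0 (hD \<i> z - 1)"
    have JI: "Im (J t) > 0" by (rule hyp_lineD(1)[OF J(1)])
    have Jt: "hD \<i> (J t) = t" "hD (J t) z \<le> 1"
      using hyp_lineD(2)[OF J(1), of 0 t] hyp_lineD(2)[OF J(1), of t "hD \<i> z"] J D0 unfolding t_def by auto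
    have "t \<le> real n" unfolding t_def using Suc.prems by simp
    then have tn: "hD \<i> (J t) \<le> real n" using Jt(1) by simp
    obtain B where B: "B \<in> carrier G" "hD (J t) (orb B) \<le> R" using R(2)[OF JI] by blast
    have BI: "inv\<^bsub>G\<^esub> B \<in> carrier G" using G_inv_closed B by blast
    note I = orb_in[OF B(1)] orb_in[OF Suc.prems(1)]
    have "hD (orb B) (orb A) \<le> 2 * R + 1"
      using hyp_dist_triangle[OF I(1) JI I(2)] hyp_dist_triangle[OF JI Suc.prems(2) I(2)] B(2) Jt(2) Suc.prems(3)
        hyp_dist_commute[of "orb B" "J t"] by linarith
    then have "inv\<^bsub>G\<^esub> B \<otimes>\<^bsub>G\<^esub> A \<in> F" unfolding F_def using orb_dist_diff[OF B(1) Suc.prems(1)]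
        holo_mult_closed(1)[OF BI Suc.prems(1)] by simp
    then have "word_length G T (inv\<^bsub>G\<^esub> B \<otimes>\<^bsub>G\<^esub> A) \<le> W" by (rule W)
    moreover have "B \<otimes>\<^bsub>G\<^esub> (inv\<^bsub>G\<^esub> B \<otimes>\<^bsub>G\<^esub> A) = A"
      using monoid.m_assoc[OF group.is_monoid[OF group_G] B(1) BI Suc.prems(1)] group.r_inv[OF group_G B(1)]
        monoid.l_one[OF group.is_monoid[OF group_G] Suc.prems(1)] by simp
    moreover have "word_length G T B \<le> W * n + W" by (rule Suc.IH[OF B(1) JI B(2) tn])
    ultimately show ?case
      using word_length_mult[OF T B(1) holo_mult_closed(1)[OF BI Suc.prems(1)]] by simp
  qed
  have "real (word_length G T A) \<le> (2 * real W) * hD \<i> (orb A) + 2 * real W" if A: "A \<in> carrier G" for A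
  proof -
    let ?D = "hD \<i> (orb A)"
    have D0: "?D \<ge> 0" using hyp_dist_nonneg[of \<i> "orb A"] orb_in[OF A] by simp
    have "?D \<le> real (nat \<lceil>?D\<rceil>)" by linarith
    then have "word_length G T A \<le> W * nat \<lceil>?D\<rceil> + W"
      using ind[OF A orb_in[OF A], of "nat \<lceil>?D\<rceil>"] R(1) by simp
    then have "real (word_length G T A) \<le> real W * real (nat \<lceil>?D\<rceil>) + real W" by (metis of_nat_add of_nat_le_iff of_nat_mult)
    also have "\<dots> \<le> real W * (?D + 1) + real W" using D0 by (intro add_right_mono mult_left_mono) linarith+
    also have "\<dots> \<le> (2 * real W) * ?D + 2 * real W" using D0 by (simp add: algebra_simps)
    finally show ?thesis .
  qed
  then show thesis using that[of "2 * real W"] by simp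
qed

text \<open>Consecutive elements differ by one generator or its inverse, which bounds the steps, and
  \<open>svarc_milnor\<close> bounds index differences by orbit distances. So orbits of word
  geodesics are quasigeodesics with uniform constants, and \<open>quasigeodesic_between\<close>
  applies.\<close>

lemma word_geodesic_between:
  assumes T: "finite_generating_set G T"
  obtains M K where "M \<ge> 0"
    "\<And>n h i j k. \<lbrakk>word_geodesic G T n h; i \<le> j; j \<le> k; k \<le> n\<rbrakk> \<Longrightarrow>
      hD (orb (h i)) (orb (h j)) + hD (orb (h j)) (orb (h k)) \<le> hD (orb (h i)) (orb (h k)) + K"
    "\<And>n h i. \<lbrakk>word_geodesic G T n h; i < n\<rbrakk> \<Longrightarrow> hD (orb (h i)) (orb (h (Suc i))) \<le> M"
proof -
  obtain W where W: "W \<ge> 0" "\<And>A. A \<in> carrier G \<Longrightarrow> real (word_length G T A) \<le> W * hD \<i> (orb A) + W"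
    using svarc_milnor[OF T] by blast
  define M where "M = Max (insert 0 ((\<lambda>A. hD \<i> (orb A)) ` (T \<union> m_inv G ` T)))"
  have finT: "finite (T \<union> m_inv G ` T)" and Tc: "T \<subseteq> carrier G" using T unfolding finite_generating_set_def by auto
  have M: "hD \<i> (orb A) \<le> M" if "A \<in> T \<union> m_inv G ` T" for A
    unfolding M_def using finT that by (intro Max_ge) auto
  have M0: "M \<ge> 0" unfolding M_def using finT by (intro Max_ge) auto
  have step: "hD (orb (h i)) (orb (h (Suc i))) \<le> M" if wg: "word_geodesic G T n h" and i: "i < n" for n h i
  proof -
    have c: "h i \<in> carrier G" "h (Suc i) \<in> carrier G" using wg i unfolding word_geodesic_def by auto
    have "real (word_dist G T (h i) (h (Suc i))) = \<bar>real i - real (Suc i)\<bar>"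
      using wg i unfolding word_geodesic_def by (metis Suc_leI less_imp_le_nat)
    then have w1: "word_length G T (inv\<^bsub>G\<^esub> (h i) \<otimes>\<^bsub>G\<^esub> h (Suc i)) = 1" unfolding word_dist_def by simp
    have cc: "inv\<^bsub>G\<^esub> (h i) \<otimes>\<^bsub>G\<^esub> h (Suc i) \<in> carrier G" using holo_mult_closed(1) G_inv_closed c by blast
    obtain ws where ws: "length ws = 1" "words T (inv\<^bsub>G\<^esub> (h i) \<otimes>\<^bsub>G\<^esub> h (Suc i)) ws"
      using word_length_attained[OF T cc] w1 by auto
    then obtain t where t: "ws = [t]" by (metis One_nat_def length_0_conv length_Suc_conv)
    have tT: "t \<in> T \<union> m_inv G ` T" using ws t unfolding words_def by simp
    then have "t \<in> carrier G" using Tc G_inv_closed by blast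
    then have "inv\<^bsub>G\<^esub> (h i) \<otimes>\<^bsub>G\<^esub> h (Suc i) = t"
      using ws t group_G unfolding words_def by (simp add: group.is_monoid monoid.r_one)
    then show ?thesis using orb_dist_diff[OF c] M[OF tT] by simp
  qed
  define A where "A = max 1 (max M W)"
  have A: "A \<ge> 1" "M \<le> A" "W \<le> A" unfolding A_def by auto
  obtain K where K: "\<And>p n i j k. \<lbrakk>\<And>a. a \<le> n \<Longrightarrow> Im (p a) > 0; \<And>a. a < n \<Longrightarrow> hD (p a) (p (Suc a)) \<le> A;
      \<And>a b. a \<le> n \<Longrightarrow> b \<le> n \<Longrightarrow> \<bar>real a - real b\<bar> \<le> A * hD (p a) (p b) + A; i \<le> j; j \<le> k; k \<le> n\<rbrakk>
      \<Longrightarrow> hD (p i) (p j) + hD (p j) (p k) \<le> hD (p i) (p k) + K"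
    by (rule quasigeodesic_between[OF A(1)]) blast
  have btw: "hD (orb (h i)) (orb (h j)) + hD (orb (h j)) (orb (h k)) \<le> hD (orb (h i)) (orb (h k)) + K"
    if wg: "word_geodesic G T n h" and ijk: "i \<le> j" "j \<le> k" "k \<le> n" for n h i j k
  proof (rule K[where p = "\<lambda>a. orb (h a)" and n = n])
    have hc: "h a \<in> carrier G" if "a \<le> n" for a using wg that unfolding word_geodesic_def by blast
    show "Im (orb (h a)) > 0" if "a \<le> n" for a using orb_in hc that by blast
    show "hD (orb (h a)) (orb (h (Suc a))) \<le> A" if "a < n" for a using step[OF wg that] A by simp
    show "\<bar>real a - real b\<bar> \<le> A * hD (orb (h a)) (orb (h b)) + A" if ab: "a \<le> n" "b \<le> n" for a b
    proof -
      have c: "h a \<in> carrier G" "h b \<in> carrier G" using hc ab by auto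
      have "\<bar>real a - real b\<bar> = real (word_length G T (inv\<^bsub>G\<^esub> (h a) \<otimes>\<^bsub>G\<^esub> h b))"
        using wg ab unfolding word_geodesic_def word_dist_def by metis
      also have "\<dots> \<le> W * hD (orb (h a)) (orb (h b)) + W"
        using W(2)[OF holo_mult_closed(1)[OF G_inv_closed[OF c(1)] c(2)]] orb_dist_diff[OF c] by simp
      also have "\<dots> \<le> A * hD (orb (h a)) (orb (h b)) + A"
        using A hyp_dist_nonneg[OF orb_in[OF c(1)] orb_in[OF c(2)]] by (intro add_mono mult_right_mono) auto
      finally show ?thesis .
    qed
  qed (use ijk in auto)
  show thesis by (rule that[OF M0 btw step])
qed

end

section \<open>The action\<close>

text \<open>The sequence \<open>a n / n\<close> is Cauchy because \<open>a (m * n)\<close> differs from both \<open>n * a m\<close> and \<open>m * a n\<close>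
  by a bounded multiple of \<open>n\<close> and \<open>m\<close>.\<close>

lemma quasi_additive_limit:
  fixes a :: "nat \<Rightarrow> real"
  assumes sub: "\<And>m n. a (m + n) \<le> a m + a n" and sup: "\<And>m n. a m + a n \<le> a (m + n) + C"
    and big: "a k > C" and nonneg: "\<And>n. a n \<ge> 0"
  shows "\<exists>\<tau>>0. (\<lambda>n. a n / real n) \<longlonglongrightarrow> \<tau>"
proof -
  have C: "C \<ge> 0" using sub[of 0 0] sup[of 0 0] by simp
  have k: "k > 0"
  proof (rule ccontr)
    assume "\<not> k > 0"
    then show False using big sup[of 0 0] by simp
  qed
  have mult: "\<bar>a (n * m) - real n * a m\<bar> \<le> real n * C" if "n > 0" for n m
    using that
  proof (induction n)
    case (Suc n)
    show ?case
    proof (cases "n = 0")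
      case True
      then show ?thesis using C by simp
    next
      case False
      have e: "Suc n * m = m + n * m" by simp
      have "\<bar>a (m + n * m) - a m - a (n * m)\<bar> \<le> C" using sub[of m "n * m"] sup[of m "n * m"] C by linarith
      moreover have "\<bar>a (n * m) - real n * a m\<bar> \<le> real n * C" using Suc False by simp
      moreover have "real (Suc n) * a m = a m + real n * a m" "real (Suc n) * C = C + real n * C"
        by (simp_all add: algebra_simps)
      ultimately show ?thesis unfolding e by linarith
    qed
  qed simp
  have diff: "\<bar>a n / real n - a m / real m\<bar> \<le> C / real m + C / real n" if mn: "m > 0" "n > 0" for m n
  proof -
    have "\<bar>real n * a m - real m * a n\<bar> \<le> real n * C + real m * C"
      using mult[OF mn(2), of m] mult[OF mn(1), of n] by (simp add: mult.commute)
    then have "\<bar>real n * a m - real m * a n\<bar> / (real n * real m) \<le> (real n * C + real m * C) / (real n * real m)"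
      by (intro divide_right_mono) auto
    moreover have "(real n * C + real m * C) / (real n * real m) = C / real m + C / real n"
      using mn by (simp add: field_simps)
    moreover have "\<bar>real n * a m - real m * a n\<bar> / (real n * real m) = \<bar>a n / real n - a m / real m\<bar>"
    proof -
      have "a n / real n - a m / real m = - ((real n * a m - real m * a n) / (real n * real m))"
        using mn by (simp add: field_simps)
      then show ?thesis by (simp add: abs_divide)
    qed
    ultimately show ?thesis by simp
  qed
  have "Cauchy (\<lambda>n. a n / real n)"
  proof (rule metric_CauchyI)
    fix e :: real assume e: "e > 0"
    obtain M where M: "real M > 2 * C / e" using reals_Archimedean2 by blast
    have small: "C / real m < e / 2" if "m \<ge> Suc M" for m
    proof -
      have "real m > 2 * C / e" using M that by linarith
      then show ?thesis using e that by (simp add: field_simps)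
    qed
    have "dist (a m / real m) (a n / real n) < e" if "m \<ge> Suc M" "n \<ge> Suc M" for m n
    proof -
      have "\<bar>a n / real n - a m / real m\<bar> \<le> C / real m + C / real n" by (rule diff) (use that in auto)
      then have "\<bar>a n / real n - a m / real m\<bar> < e" using small[OF that(1)] small[OF that(2)] by linarith
      then show ?thesis by (simp add: dist_real_def abs_minus_commute)
    qed
    then show "\<exists>M. \<forall>m\<ge>M. \<forall>n\<ge>M. dist (a m / real m) (a n / real n) < e" by blast
  qed
  then obtain \<tau> where \<tau>: "(\<lambda>n. a n / real n) \<longlonglongrightarrow> \<tau>" using Cauchy_convergent convergent_def by blast
  \<comment> \<open>Positivity of the limit: along multiples of k the quotients are at least (a k -
    C)/k.\<close>
  have "((\<lambda>n. a n / real n) \<circ> (\<lambda>j. Suc j * k)) \<longlonglongrightarrow> \<tau>"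
    by (rule LIMSEQ_subseq_LIMSEQ[OF \<tau>]) (use k in \<open>auto simp: strict_mono_Suc_iff\<close>)
  moreover have "((\<lambda>n. a n / real n) \<circ> (\<lambda>j. Suc j * k)) j \<ge> (a k - C) / real k" for j
  proof -
    have "real (Suc j) * (a k - C) \<le> a (Suc j * k)" using mult[of "Suc j" k] by (simp add: algebra_simps)
    then have "real (Suc j) * (a k - C) / (real (Suc j) * real k) \<le> a (Suc j * k) / (real (Suc j) * real k)"
      by (intro divide_right_mono) auto
    moreover have "real (Suc j) * (a k - C) / (real (Suc j) * real k) = (a k - C) / real k" by simp
    ultimately show ?thesis by (simp only: comp_def of_nat_mult)
  qed
  ultimately have "(a k - C) / real k \<le> \<tau>" by (intro LIMSEQ_le_const) auto
  moreover have "(a k - C) / real k > 0" using big k by simp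
  ultimately show ?thesis using \<tau> by (intro exI[of _ \<tau>]) linarith
qed

text \<open>Along a path that is coarsely monotone for \<open>d\<close>, the running maximum of the distance to the
  starting point is a parametrization by a quasigeodesic.\<close>

lemma monotone_path_quasigeodesic:
  fixes d :: "'x \<Rightarrow> 'x \<Rightarrow> real" and h :: "nat \<Rightarrow> 'x"
  assumes nn: "\<And>x y. d x y \<ge> 0" and sym: "\<And>x y. d x y = d y x"
    and hX: "\<And>i. i \<le> n \<Longrightarrow> h i \<in> X"
    and btw: "\<And>i j k. i \<le> j \<Longrightarrow> j \<le> k \<Longrightarrow> k \<le> n \<Longrightarrow> d (h i) (h j) + d (h j) (h k) \<le> d (h i) (h k) + C"
    and tri: "\<And>i j k. i \<le> n \<Longrightarrow> j \<le> n \<Longrightarrow> k \<le> n \<Longrightarrow> d (h i) (h k) \<le> d (h i) (h j) + d (h j) (h k)"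
    and refl: "d (h 0) (h 0) = 0"
    and step: "\<And>i. i < n \<Longrightarrow> d (h i) (h (Suc i)) \<le> M" and M: "M \<ge> 0"
  shows "\<exists>N\<ge>0. \<exists>\<gamma>. quasigeodesic X d 1 (4 * C + 2 * M + 1) N \<gamma> \<and> (\<exists>\<theta> :: nat \<Rightarrow> real.
     mono_on {0..n} \<theta> \<and> \<theta> ` {0..n} \<subseteq> {0..N} \<and> \<theta> 0 = 0 \<and> \<theta> n = N \<and> (\<forall>i\<le>n. d (\<gamma> (\<theta> i)) (h i) \<le> 2 * C))"
proof -
  define D where "D i = d (h 0) (h i)" for i
  define \<theta> where "\<theta> i = Max (D ` {0..i})" for i
  have D_le: "D j \<le> D i + C" if "j \<le> i" "i \<le> n" for i j
    using btw[of 0 j i] that nn[of "h j" "h i"] unfolding D_def by simp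
  have C: "C \<ge> 0" using btw[of 0 0 0] refl by simp
  have \<theta>_ge: "D j \<le> \<theta> i" if "j \<le> i" for i j unfolding \<theta>_def by (rule Max_ge) (use that in auto)
  have \<theta>_att: "\<exists>j\<le>i. \<theta> i = D j" for i
  proof -
    have "\<theta> i \<in> D ` {0..i}" unfolding \<theta>_def by (rule Max_in) auto
    then show ?thesis by auto
  qed
  have \<theta>_D: "D i \<le> \<theta> i" "\<theta> i \<le> D i + C" if "i \<le> n" for i
    using \<theta>_ge[of i i] \<theta>_att[of i] D_le that by auto
  have \<theta>_mono: "\<theta> i \<le> \<theta> j" if "i \<le> j" for i j
    using \<theta>_att[of i] \<theta>_ge[of _ j] that by (metis order_trans)
  have \<theta>0: "\<theta> 0 = 0" unfolding \<theta>_def D_def using refl by simp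
  have \<theta>_nn: "\<theta> i \<ge> 0" for i using \<theta>_mono[of 0 i] \<theta>0 by simp
  define N where "N = \<theta> n"
  \<comment> \<open>The first time at which the running maximum reaches s. It overshoots s by at
    most M + C, as one step changes D by at most M and \<theta> exceeds D by at most C.\<close>
  define idx where "idx s = (LEAST i. \<theta> i \<ge> s)" for s
  have idx: "\<theta> (idx s) \<ge> s" "idx s \<le> i" if "\<theta> i \<ge> s" for s i
    unfolding idx_def using that by (auto intro: LeastI Least_le)
  have idx_n: "idx s \<le> n" "\<theta> (idx s) \<ge> s" if "s \<le> N" for s using idx[of s n] that unfolding N_def by auto
  have idx_up: "\<theta> (idx s) \<le> s + M + C" if "0 \<le> s" "s \<le> N" for s
  proof (cases "idx s")
    case 0
    then show ?thesis using \<theta>0 that M C by simp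
  next
    case (Suc i)
    then have i: "\<theta> i < s" unfolding idx_def using not_less_Least[of i "\<lambda>i. \<theta> i \<ge> s"] by (simp add: idx_def)
    have iN: "Suc i \<le> n" using idx_n(1)[OF that(2)] Suc by simp
    have "D (Suc i) \<le> D i + M" using tri[of 0 i "Suc i"] step[of i] iN unfolding D_def by simp
    then show ?thesis unfolding Suc using \<theta>_D(2)[of "Suc i"] \<theta>_ge[of i i] i iN by linarith
  qed
  have idx_mono: "idx s \<le> idx t" if "s \<le> t" "t \<le> N" for s t
    using idx(2)[of s "idx t"] idx_n(2)[OF that(2)] that by simp
  have dD: "\<bar>d (h i) (h j) - (D j - D i)\<bar> \<le> C" if "i \<le> j" "j \<le> n" for i j
    using btw[of 0 i j] tri[of 0 i j] that unfolding D_def by (simp add: abs_le_iff)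
  have key: "\<bar>d (h (idx s)) (h (idx t)) - (t - s)\<bar> \<le> 4 * C + 2 * M + 1" if "0 \<le> s" "s \<le> t" "t \<le> N" for s t
  proof -
    have s: "s \<le> N" and t: "0 \<le> t" using that by auto
    show ?thesis
      using dD[OF idx_mono[OF that(2,3)] idx_n(1)[OF that(3)]] idx_up[OF that(1) s] idx_up[OF t that(3)]
        idx_n(2)[OF s] idx_n(2)[OF that(3)] \<theta>_D[OF idx_n(1)[OF s]] \<theta>_D[OF idx_n(1)[OF that(3)]] C M by linarith
  qed
  have "quasigeodesic X d 1 (4 * C + 2 * M + 1) N (\<lambda>s. h (idx s))"
    unfolding quasigeodesic_def
  proof (intro conjI ballI)
    show "(\<lambda>s. h (idx s)) ` {0..N} \<subseteq> X" using hX idx_n(1) by auto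
    fix s t assume st: "s \<in> {0..N}" "t \<in> {0..N}"
    have "\<bar>d (h (idx s)) (h (idx t)) - \<bar>s - t\<bar>\<bar> \<le> 4 * C + 2 * M + 1"
      using key[of s t] key[of t s] st sym[of "h (idx s)" "h (idx t)"] by (cases "s \<le> t") auto
    then show "\<bar>s - t\<bar> / 1 - (4 * C + 2 * M + 1) \<le> d (h (idx s)) (h (idx t))"
      "d (h (idx s)) (h (idx t)) \<le> 1 * \<bar>s - t\<bar> + (4 * C + 2 * M + 1)"
      unfolding abs_le_iff[of "_ - \<bar>s - t\<bar>"] by simp_all
  qed
  moreover have "mono_on {0..n} \<theta>" using \<theta>_mono by (auto intro: mono_onI)
  moreover have "\<theta> ` {0..n} \<subseteq> {0..N}" unfolding N_def using \<theta>_nn \<theta>_mono by auto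
  moreover have "d (h (idx (\<theta> i))) (h i) \<le> 2 * C" if i: "i \<le> n" for i
  proof -
    have j: "idx (\<theta> i) \<le> i" "\<theta> (idx (\<theta> i)) \<ge> \<theta> i" using idx[of "\<theta> i" i] by auto
    then have "\<theta> (idx (\<theta> i)) = \<theta> i" using \<theta>_mono[OF j(1)] by simp
    then show ?thesis using dD[OF j(1) i] \<theta>_D[OF i] \<theta>_D(2)[of "idx (\<theta> i)"] j i by linarith
  qed
  ultimately show ?thesis using \<theta>0 \<theta>_nn[of n] unfolding N_def
    by (intro exI[of _ "\<theta> n"] conjI exI[of _ "\<lambda>s. h (idx s)"] exI[of _ \<theta>]) auto
qed

context developed_surface
begin

section \<open>The metric on \<Gamma> and the action by left multiplication\<close>

definition dX :: "(real \<Rightarrow> 'a) set \<Rightarrow> (real \<Rightarrow> 'a) set \<Rightarrow> real" where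
  "dX A B = real (dg (orb A) (orb B))"

text \<open>Restricted to the carrier because the elements of \<open>BijGroup\<close> are
  extensional functions.\<close>

definition act :: "(real \<Rightarrow> 'a) set \<Rightarrow> (real \<Rightarrow> 'a) set \<Rightarrow> (real \<Rightarrow> 'a) set" where
  "act A = (\<lambda>B\<in>carrier G. A \<otimes>\<^bsub>G\<^esub> B)"

lemma dX_triangle: "\<lbrakk>A \<in> carrier G; B \<in> carrier G; C \<in> carrier G\<rbrakk> \<Longrightarrow> dX A C \<le> dX A B + dX B C"
  unfolding dX_def using dg_triangle[OF orb_in orb_in orb_in, of A B C] by simp

lemma dX_commute: "dX A B = dX B A"
  unfolding dX_def using dg_commute[of "orb A" "orb B"] by (rule arg_cong)

lemma dX_invariant:
  assumes "A \<in> carrier G" "B \<in> carrier G" "C \<in> carrier G"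
  shows "dX (A \<otimes>\<^bsub>G\<^esub> B) (A \<otimes>\<^bsub>G\<^esub> C) = dX B C"
  unfolding dX_def
  using orb_mult[OF assms(1,2)] orb_mult[OF assms(1,3)] dg_deck[OF holo_deck[OF assms(1)] orb_in[OF assms(2)] orb_in[OF assms(3)]]
  by simp

text \<open>Points are separated because different elements have different orbit points and
  different points of the plane have positive \<open>dg\<close>.\<close>

lemma dX_metric: "Metric_space (carrier G) dX"
proof
  show "dX A B = 0 \<longleftrightarrow> A = B" if "A \<in> carrier G" "B \<in> carrier G" for A B
    unfolding dX_def using dg_eq_0_iff[OF orb_in[OF that(1)] orb_in[OF that(2)]] orb_inj[OF that] by auto
  show "0 \<le> dX A B" for A B unfolding dX_def by simp
  show "dX A B = dX B A" for A B by (rule dX_commute)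
  show "dX A C \<le> dX A B + dX B C" if "A \<in> carrier G" "B \<in> carrier G" "C \<in> carrier G" for A B C
    using that by (rule dX_triangle)
qed

lemma dX_hyperbolic: "gromov_hyperbolic (carrier G) dX"
proof -
  obtain \<delta> where \<delta>: "\<delta> \<ge> 0" "\<forall>x\<in>hyp_plane. \<forall>y\<in>hyp_plane. \<forall>z\<in>hyp_plane. \<forall>w\<in>hyp_plane.
    min (gromov_product (\<lambda>x y. real (dg x y)) w x y) (gromov_product (\<lambda>x y. real (dg x y)) w y z) - \<delta>
      \<le> gromov_product (\<lambda>x y. real (dg x y)) w x z"
    using dg_hyperbolic unfolding gromov_hyperbolic_def by blast
  have gp: "gromov_product dX w x y = gromov_product (\<lambda>x y. real (dg x y)) (orb w) (orb x) (orb y)" for w x y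
    unfolding gromov_product_def dX_def ..
  have orbH: "orb A \<in> hyp_plane" if "A \<in> carrier G" for A using orb_in[OF that] by simp
  show ?thesis unfolding gromov_hyperbolic_def
    by (intro exI[of _ \<delta>] conjI ballI \<delta>(1)) (unfold gp, intro \<delta>(2)[rule_format] orbH)
qed

lemma act_hom: "group_hom G (BijGroup (carrier G)) act"
proof -
  interpret group G by (rule group_G)
  have bij: "act A \<in> Bij (carrier G)" if A: "A \<in> carrier G" for A
  proof -
    have "bij_betw (\<lambda>B. A \<otimes>\<^bsub>G\<^esub> B) (carrier G) (carrier G)"
      by (rule bij_betw_byWitness[of _ "\<lambda>B. inv\<^bsub>G\<^esub> A \<otimes>\<^bsub>G\<^esub> B"]) (use A in \<open>auto simp: m_assoc[symmetric]\<close>)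
    then show ?thesis unfolding Bij_def act_def by simp
  qed
  have "act (A \<otimes>\<^bsub>G\<^esub> B) = act A \<otimes>\<^bsub>BijGroup (carrier G)\<^esub> act B" if "A \<in> carrier G" "B \<in> carrier G" for A B
    using bij that by (auto simp: BijGroup_def act_def compose_def restrict_def m_assoc fun_eq_iff)
  then have "act \<in> hom G (BijGroup (carrier G))" using bij by (auto simp: hom_def BijGroup_def)
  then show ?thesis by (intro group_hom.intro group_BijGroup group_G) (simp add: group_hom_axioms_def)
qed

lemma act_action: "isometric_action G (carrier G) dX act"
  unfolding isometric_action_def group_action_def
proof (intro conjI ballI)
  show "group_hom G (BijGroup (carrier G)) act" by (rule act_hom)
  show "dX (act A B) (act A C) = dX B C" if "A \<in> carrier G" "B \<in> carrier G" "C \<in> carrier G" for A B C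
    using dX_invariant that by (simp add: act_def)
qed

lemma act_cobounded: "cobounded_action G (carrier G) dX act"
proof -
  have "dX B (act B \<one>\<^bsub>G\<^esub>) \<le> 0" if "B \<in> carrier G" for B
    using that G_one_closed monoid.r_one[OF group.is_monoid[OF group_G] that] dg_eq_0_iff[OF orb_in orb_in, of B B]
    by (simp add: act_def dX_def)
  then show ?thesis unfolding cobounded_action_def using G_one_closed by blast
qed

lemma act_int_pow: "A \<in> carrier G \<Longrightarrow> act A [^]\<^bsub>BijGroup (carrier G)\<^esub> (k :: int) = act (A [^]\<^bsub>G\<^esub> k)"
  by (rule group_hom.hom_int_pow[OF act_hom, symmetric])

lemma act_nat_pow: "A \<in> carrier G \<Longrightarrow> act A [^]\<^bsub>BijGroup (carrier G)\<^esub> (k :: nat) = act (A [^]\<^bsub>G\<^esub> k)"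
  by (rule group_hom.hom_nat_pow[OF act_hom, symmetric])

lemma holo_nat_pow:
  assumes A: "A \<in> carrier G" and J: "hyp_line J" "\<And>t. holo A (J t) = J (t + l)"
  shows "holo (A [^]\<^bsub>G\<^esub> (k :: nat)) (J t) = J (t + real k * l)"
proof -
  interpret group G by (rule group_G)
  show ?thesis
  proof (induction k arbitrary: t)
    case 0
    then show ?case using holo_one[OF hyp_lineD(1)[OF J(1)]] by simp
  next
    case (Suc k)
    have "holo (A [^]\<^bsub>G\<^esub> Suc k) (J t) = holo (A [^]\<^bsub>G\<^esub> k) (holo A (J t))"
      using holo_mult_closed(2)[of "A [^]\<^bsub>G\<^esub> k" A "J t"] A hyp_lineD(1)[OF J(1)] by simp
    then show ?case using Suc J(2) by (simp add: algebra_simps)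
  qed
qed

lemma holo_int_pow:
  assumes A: "A \<in> carrier G" and J: "hyp_line J" "\<And>t. holo A (J t) = J (t + l)"
  shows "holo (A [^]\<^bsub>G\<^esub> (k :: int)) (J t) = J (t + of_int k * l)"
proof -
  interpret group G by (rule group_G)
  show ?thesis
  proof (cases k rule: int_cases2)
    case (nonneg n)
    then show ?thesis using holo_nat_pow[OF A J, of n t] by (simp add: int_pow_int)
  next
    case (nonpos n)
    have "A [^]\<^bsub>G\<^esub> k = inv\<^bsub>G\<^esub> (A [^]\<^bsub>G\<^esub> n)" unfolding nonpos using A by (simp add: int_pow_neg int_pow_int)
    moreover have "holo (inv\<^bsub>G\<^esub> (A [^]\<^bsub>G\<^esub> n)) (holo (A [^]\<^bsub>G\<^esub> n) (J (t - real n * l))) = J (t - real n * l)"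
      by (rule holo_inv) (use A hyp_lineD(1)[OF J(1)] in auto)
    ultimately show ?thesis using holo_nat_pow[OF A J, of n "t - real n * l"] by (simp add: nonpos)
  qed
qed

section \<open>Dynamics of elements and bounded backtracking\<close>

lemma simple_elliptic:
  assumes A: "A \<in> carrier G" and s: "represents_simple S p A"
  shows "elliptic (carrier G) dX (act A)"
  unfolding elliptic_def
proof
  interpret group G by (rule group_G)
  interpret M: Metric_space "carrier G" dX by (rule dX_metric)
  obtain c l where c: "represents_geodesic S A c l" "simple_geodesic c" using s unfolding represents_simple_def by blast
  obtain J where J: "hyp_line J" "\<forall>t. E (J t) = c t" "\<And>t. holo A (J t) = J (t + l)"
    using holonomy_axis[OF A c(1)] by blast
  have Js: "simple_line J" unfolding simple_line_def using J(1,2) c unfolding represents_geodesic_def by blast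
  have JJ: "dg (J a) (J b) \<le> 1" for a b
  proof (rule dg_le)
    show "(J a, J b) \<in> edges ^^ 1" unfolding edges_def using Js hyp_lineD(1)[OF J(1)] by auto
  qed
  fix B assume B: "B \<in> carrier G"
  have pw: "(act A [^]\<^bsub>BijGroup (carrier G)\<^esub> (k :: int)) B = A [^]\<^bsub>G\<^esub> k \<otimes>\<^bsub>G\<^esub> B" for k
    unfolding act_int_pow[OF A] using B by (simp add: act_def)
  define b where "b = dg (orb B) (J 0)"
  have near: "dg (orb (A [^]\<^bsub>G\<^esub> (k :: int) \<otimes>\<^bsub>G\<^esub> B)) (J (of_int k * l)) = b" for k
    using orb_mult[of "A [^]\<^bsub>G\<^esub> k" B] holo_int_pow[OF A J(1,3), of k 0] A B
      dg_deck[OF holo_deck[of "A [^]\<^bsub>G\<^esub> k"] orb_in[OF B] hyp_lineD(1)[OF J(1)], of 0]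
    unfolding b_def by simp
  have "dX (A [^]\<^bsub>G\<^esub> j \<otimes>\<^bsub>G\<^esub> B) (A [^]\<^bsub>G\<^esub> k \<otimes>\<^bsub>G\<^esub> B) \<le> 2 * real b + 1" for j k :: int
  proof -
    let ?x = "orb (A [^]\<^bsub>G\<^esub> j \<otimes>\<^bsub>G\<^esub> B)" and ?y = "orb (A [^]\<^bsub>G\<^esub> k \<otimes>\<^bsub>G\<^esub> B)"
    have I: "Im ?x > 0" "Im ?y > 0" using orb_in A B by simp_all
    note JI = hyp_lineD(1)[OF J(1)]
    have "dg ?x ?y \<le> dg ?x (J (of_int j * l)) + (dg (J (of_int j * l)) (J (of_int k * l)) + dg (J (of_int k * l)) ?y)"
      using dg_triangle[OF I(1) JI I(2), of "of_int j * l"] dg_triangle[OF JI[of "of_int j * l"] JI[of "of_int k * l"] I(2)]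
      by linarith
    also have "\<dots> \<le> b + (1 + b)"
      using near[of j] near[of k] JJ[of "of_int j * l" "of_int k * l"] dg_commute[of ?y "J (of_int k * l)"] by linarith
    finally show ?thesis unfolding dX_def by linarith
  qed
  then show "M.mbounded (range (\<lambda>k::int. (act A [^]\<^bsub>BijGroup (carrier G)\<^esub> k) B))"
    unfolding pw M.mbounded_alt using A B by (auto intro!: exI[of _ "2 * real b + 1"])
qed

text \<open>The displacement \<open>a k\<close> on the axis is subadditive, superadditive up to the
  defect C by \<open>dg_between\<close>, and exceeds C for some k; so \<open>a k / k\<close> has a
  positive limit. Any other base point changes the displacement by at most 2b, hence has the same
  limit.\<close>

lemma nonsimple_loxodromic:
  assumes A: "A \<in> carrier G" and s: "represents_nonsimple S p A"
  shows "loxodromic (carrier G) dX (act A)"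
proof -
  interpret group G by (rule group_G)
  obtain c l where c: "represents_geodesic S A c l" "\<not> simple_geodesic c" using s unfolding represents_nonsimple_def by blast
  have cg: "closed_geodesic S c l" using c(1) unfolding represents_geodesic_def by blast
  then have l: "l > 0" unfolding closed_geodesic_def has_period_def by blast
  obtain J where J: "hyp_line J" "\<And>t. E (J t) = c t" "\<And>t. holo A (J t) = J (t + l)"
    using holonomy_axis[OF A c(1)] by blast
  note JI = hyp_lineD(1)[OF J(1)]
  obtain h s t u where h: "deck h" "h (J t) = J s" "h (J u) \<notin> range J"
    using nonsimple_axis_crossing[OF J(1,2) cg c(2)] by blast
  define a where "a k = real (dg (J 0) (J (real k * l)))" for k :: nat
  have shift: "real (dg (J (real m * l)) (J (real (m + n) * l))) = a n" for m n
  proof -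
    have "dg (holo (A [^]\<^bsub>G\<^esub> m) (J 0)) (holo (A [^]\<^bsub>G\<^esub> m) (J (real n * l))) = dg (J 0) (J (real n * l))"
      by (rule dg_deck[OF holo_deck JI JI]) (use A in simp)
    then show ?thesis unfolding holo_nat_pow[OF A J(1,3)] a_def by (simp add: algebra_simps)
  qed
  have sub: "a (m + n) \<le> a m + a n" for m n
    using dg_triangle[OF JI[of 0] JI[of "real m * l"] JI[of "real (m + n) * l"]] shift[of m n] unfolding a_def by linarith
  obtain C where C: "\<And>x m y. Im x > 0 \<and> Im m > 0 \<and> Im y > 0 \<and> hD x m + hD m y \<le> hD x y + 0 \<Longrightarrow>
     real (dg x m) + real (dg m y) \<le> real (dg x y) + C" using dg_between[of 0] by blast
  have sup: "a m + a n \<le> a (m + n) + C" for m n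
  proof -
    have "hD (J 0) (J (real m * l)) + hD (J (real m * l)) (J (real (m + n) * l)) \<le> hD (J 0) (J (real (m + n) * l)) + 0"
      unfolding hyp_lineD(2)[OF J(1)] using l by (simp add: algebra_simps)
    then show ?thesis using C[of "J 0" "J (real m * l)" "J (real (m + n) * l)"] JI shift[of m n] unfolding a_def by simp
  qed
  obtain k where "dg (J 0) (J (real k * l)) > nat \<lceil>C\<rceil>"
    using dg_axis_unbounded[OF holo_deck[OF A] J(1,3) l h] by blast
  then have "a k > C" unfolding a_def by linarith
  then obtain \<tau> where \<tau>: "\<tau> > 0" "(\<lambda>k. a k / real k) \<longlonglongrightarrow> \<tau>"
    using quasi_additive_limit[of a C k, OF sub sup] unfolding a_def by (metis of_nat_0_le_iff)
  have "(\<lambda>k. dX B ((act A [^]\<^bsub>BijGroup (carrier G)\<^esub> k) B) / real k) \<longlonglongrightarrow> \<tau>" if B: "B \<in> carrier G" for B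
  proof -
    define b where "b = real (dg (orb B) (J 0))"
    define f where "f k = dX B (A [^]\<^bsub>G\<^esub> k \<otimes>\<^bsub>G\<^esub> B)" for k :: nat
    have bd: "\<bar>f k - a k\<bar> \<le> 2 * b" for k
    proof -
      let ?y = "orb (A [^]\<^bsub>G\<^esub> k \<otimes>\<^bsub>G\<^esub> B)"
      have I: "Im (orb B) > 0" "Im ?y > 0" using orb_in A B by simp_all
      have "real (dg ?y (J (real k * l))) = b"
        using orb_mult[of "A [^]\<^bsub>G\<^esub> k" B] holo_nat_pow[OF A J(1,3), of k 0] A B
          dg_deck[OF holo_deck[of "A [^]\<^bsub>G\<^esub> k"] orb_in[OF B] JI, of 0]
        unfolding b_def by simp
      then show ?thesis
        using dg_triangle[OF I(1) JI[of 0] I(2)] dg_triangle[OF JI[of 0] JI[of "real k * l"] I(2)]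
          dg_triangle[OF JI[of 0] I(1) JI[of "real k * l"]] dg_triangle[OF I(1) I(2) JI[of "real k * l"]]
          dg_commute[of ?y "J (real k * l)"] dg_commute[of "J 0" "orb B"]
        unfolding f_def dX_def a_def b_def by linarith
    qed
    have "(\<lambda>k. (f k - a k) / real k) \<longlonglongrightarrow> 0"
    proof (rule Lim_null_comparison)
      show "\<forall>\<^sub>F k in sequentially. norm ((f k - a k) / real k) \<le> 2 * b / real k"
        using bd by (auto simp: abs_divide intro!: always_eventually divide_right_mono)
      show "(\<lambda>k. 2 * b / real k) \<longlonglongrightarrow> 0" by (rule lim_const_over_n)
    qed
    then have "(\<lambda>k. (f k - a k) / real k + a k / real k) \<longlonglongrightarrow> 0 + \<tau>" using \<tau>(2) by (rule tendsto_add)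
    then have "(\<lambda>k. f k / real k) \<longlonglongrightarrow> \<tau>" by (simp add: diff_divide_distrib)
    moreover have "(act A [^]\<^bsub>BijGroup (carrier G)\<^esub> k) B = A [^]\<^bsub>G\<^esub> k \<otimes>\<^bsub>G\<^esub> B" for k :: nat
      unfolding act_nat_pow[OF A] using B by (simp add: act_def)
    ultimately show ?thesis unfolding f_def by simp
  qed
  then show ?thesis unfolding loxodromic_def using \<tau>(1) by blast
qed

text \<open>Orbits of word geodesics are coarsely monotone for \<open>hD\<close>, hence for
  \<open>dg\<close> by \<open>dg_between\<close>, and such paths are quasigeodesics after
  reparametrization. Multiplicative constant 1 is attained.\<close>

lemma act_bounded_backtracking: "bounded_backtracking G (carrier G) dX act"
  unfolding bounded_backtracking_def bounded_backtracking_wrt_def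
proof (intro allI impI ballI)
  interpret group G by (rule group_G)
  fix T B assume T: "finite_generating_set G T" and B: "B \<in> carrier G"
  obtain M K where M: "M \<ge> 0"
    and K: "\<And>n h i j k. \<lbrakk>word_geodesic G T n h; i \<le> j; j \<le> k; k \<le> n\<rbrakk> \<Longrightarrow>
      hD (orb (h i)) (orb (h j)) + hD (orb (h j)) (orb (h k)) \<le> hD (orb (h i)) (orb (h k)) + K"
    and step: "\<And>n h i. \<lbrakk>word_geodesic G T n h; i < n\<rbrakk> \<Longrightarrow> hD (orb (h i)) (orb (h (Suc i))) \<le> M"
    using word_geodesic_between[OF T] by blast
  obtain C0 where C0: "\<And>x m y. Im x > 0 \<and> Im m > 0 \<and> Im y > 0 \<and> hD x m + hD m y \<le> hD x y + K \<Longrightarrow>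
     real (dg x m) + real (dg m y) \<le> real (dg x y) + C0" using dg_between[of K] by blast
  define C where "C = max C0 0"
  define b where "b = dX \<one>\<^bsub>G\<^esub> B"
  \<comment> \<open>M + 1 bounds a step measured in \<open>dg\<close>; b accounts for passing from
    the orbit of the identity to the orbit of B.\<close>
  define L where "L = 4 * C + 2 * (M + 1) + 1 + b"
  have b0: "b \<ge> 0" unfolding b_def dX_def by simp
  have C: "C \<ge> 0" unfolding C_def by simp
  have main: "\<exists>N\<ge>0. \<exists>\<gamma>. quasigeodesic (carrier G) dX 1 L N \<gamma> \<and> (\<exists>\<theta> :: nat \<Rightarrow> real.
     mono_on {0..n} \<theta> \<and> \<theta> ` {0..n} \<subseteq> {0..N} \<and> \<theta> 0 = 0 \<and> \<theta> n = N \<and> (\<forall>i\<le>n. dX (\<gamma> (\<theta> i)) (act (h i) B) \<le> L))"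
    if wg: "word_geodesic G T n h" for n h
  proof -
    have hc: "h i \<in> carrier G" if "i \<le> n" for i using wg that unfolding word_geodesic_def by blast
    have "\<exists>N\<ge>0. \<exists>\<gamma>. quasigeodesic (carrier G) dX 1 (4 * C + 2 * (M + 1) + 1) N \<gamma> \<and> (\<exists>\<theta> :: nat \<Rightarrow> real.
     mono_on {0..n} \<theta> \<and> \<theta> ` {0..n} \<subseteq> {0..N} \<and> \<theta> 0 = 0 \<and> \<theta> n = N \<and> (\<forall>i\<le>n. dX (\<gamma> (\<theta> i)) (h i) \<le> 2 * C))"
    proof (rule monotone_path_quasigeodesic)
      show "dX (h i) (h j) + dX (h j) (h k) \<le> dX (h i) (h k) + C" if "i \<le> j" "j \<le> k" "k \<le> n" for i j k
      proof -
        have "real (dg (orb (h i)) (orb (h j))) + real (dg (orb (h j)) (orb (h k))) \<le> real (dg (orb (h i)) (orb (h k))) + C0"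
          by (rule C0) (use K[OF wg that] orb_in hc that in auto)
        then show ?thesis unfolding dX_def C_def by simp
      qed
      show "dX (h i) (h (Suc i)) \<le> M + 1" if "i < n" for i
        using step[OF wg that] dg_le_dist[OF orb_in orb_in, of "h i" "h (Suc i)"] hc that unfolding dX_def by simp
      show "dX (h 0) (h 0) = 0" unfolding dX_def using dg_eq_0_iff[OF orb_in orb_in, of "h 0" "h 0"] hc by simp
    qed (use M hc dX_triangle dX_commute in \<open>auto simp: dX_def\<close>)
    then obtain N \<gamma> \<theta> where N: "N \<ge> 0" and \<gamma>: "quasigeodesic (carrier G) dX 1 (4 * C + 2 * (M + 1) + 1) N \<gamma>"
      and \<theta>: "mono_on {0..n} \<theta>" "\<theta> ` {0..n} \<subseteq> {0..N}" "\<theta> 0 = 0" "\<theta> n = N" "\<forall>i\<le>n. dX (\<gamma> (\<theta> i)) (h i) \<le> 2 * C"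
      by blast
    have "quasigeodesic (carrier G) dX 1 L N \<gamma>" unfolding quasigeodesic_def
    proof (intro conjI ballI)
      show "\<gamma> ` {0..N} \<subseteq> carrier G" using \<gamma> unfolding quasigeodesic_def by blast
      fix s t assume st: "s \<in> {0..N}" "t \<in> {0..N}"
      then have "\<bar>s - t\<bar> / 1 - (4 * C + 2 * (M + 1) + 1) \<le> dX (\<gamma> s) (\<gamma> t)"
        "dX (\<gamma> s) (\<gamma> t) \<le> 1 * \<bar>s - t\<bar> + (4 * C + 2 * (M + 1) + 1)" using \<gamma> unfolding quasigeodesic_def by blast+
      then show "\<bar>s - t\<bar> / 1 - L \<le> dX (\<gamma> s) (\<gamma> t)" "dX (\<gamma> s) (\<gamma> t) \<le> 1 * \<bar>s - t\<bar> + L"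
        unfolding L_def using b0 by linarith+
    qed
    moreover have "dX (\<gamma> (\<theta> i)) (act (h i) B) \<le> L" if i: "i \<le> n" for i
    proof -
      have "i \<in> {0..n}" using i by simp
      then have "\<theta> i \<in> {0..N}" using \<theta>(2) by blast
      then have \<gamma>c: "\<gamma> (\<theta> i) \<in> carrier G" using \<gamma> unfolding quasigeodesic_def by blast
      have "dX (h i) (act (h i) B) = b"
        using dX_invariant[OF hc[OF i] one_closed B] hc[OF i] B unfolding b_def by (simp add: act_def)
      moreover have "dX (\<gamma> (\<theta> i)) (act (h i) B) \<le> dX (\<gamma> (\<theta> i)) (h i) + dX (h i) (act (h i) B)"
        by (rule dX_triangle) (use \<gamma>c hc[OF i] B in \<open>auto simp: act_def\<close>)
      moreover have "dX (\<gamma> (\<theta> i)) (h i) \<le> 2 * C" using \<theta>(5) i by blast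
      ultimately have "dX (\<gamma> (\<theta> i)) (act (h i) B) \<le> 2 * C + b" by linarith
      also have "\<dots> \<le> L" unfolding L_def using C M by simp
      finally show ?thesis .
    qed
    ultimately show ?thesis using N \<theta> by blast
  qed
  have Lpos: "L > 0" unfolding L_def using C M b0 by (smt (verit))
  show "\<exists>La>0. \<exists>C>0. \<forall>n h. word_geodesic G T n h \<longrightarrow>
        (\<exists>N\<ge>0. \<exists>\<gamma>. quasigeodesic (carrier G) dX La C N \<gamma> \<and>
          (\<exists>\<theta> :: nat \<Rightarrow> real. mono_on {0..n} \<theta> \<and> \<theta> ` {0..n} \<subseteq> {0..N} \<and> \<theta> 0 = 0 \<and> \<theta> n = N \<and>
             (\<forall>i\<le>n. dX (\<gamma> (\<theta> i)) (act (h i) B) \<le> C)))"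
    by (rule exI[of _ 1], intro conjI[OF zero_less_one], rule exI[of _ L]) (use Lpos main in blast)
qed

end

theorem corollary4:
  fixes S :: "'a::metric_space set" and p :: 'a and \<Gamma> :: "(real \<Rightarrow> 'a) set monoid"
  assumes "closed_hyperbolic_surface S"
    and "p \<in> S"
    and "\<Gamma> = fundamental_group S p"
  shows "\<exists>(X :: (real \<Rightarrow> 'a) set set) d \<phi>.
           Metric_space X d \<and> gromov_hyperbolic X d \<and>
           isometric_action \<Gamma> X d \<phi> \<and> cobounded_action \<Gamma> X d \<phi> \<and>
           (\<forall>g\<in>carrier \<Gamma>. represents_simple S p g \<longrightarrow> elliptic X d (\<phi> g)) \<and>
           (\<forall>g\<in>carrier \<Gamma>. represents_nonsimple S p g \<longrightarrow> loxodromic X d (\<phi> g)) \<and>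
           bounded_backtracking \<Gamma> X d \<phi>"
proof -
  obtain E r where E: "E \<i> = p" "\<forall>q. Im q > 0 \<longrightarrow> chart S r q E"
    using hyperbolic_developing_map[OF assms(1,2)] by blast
  interpret developed_surface S E r p
    by unfold_locales (use E assms(1) in \<open>auto simp: closed_hyperbolic_surface_def\<close>)
  show ?thesis unfolding assms(3)
    using dX_metric dX_hyperbolic act_action act_cobounded simple_elliptic nonsimple_loxodromic
      act_bounded_backtracking by blast
qed

end
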